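(* Suppose that: (i) (fourth moment upper condition) the fourth moments of the covariates are finite under both distributions and there is a constant $\alpha>0$ such that for every PSD matrix (operator) $A$, $$\mathbb E_{\mathrm{src}}[xx^\top A xx^\top]\preceq \alpha\,\mathrm{tr}(GA)\,G,\qquad \mathbb E_{\mathrm{tgt}}[xx^\top A xx^\top]\preceq \alpha\,\mathrm{tr}(HA)\,H;$$ (ii) (noise condition) there is a constant $\sigma^2>0$ such that $$\mathbb E_{\mathrm{src}}[(y-\langle w^*,x\rangle)^2xx^\top]\preceq\sigma^2 G,\qquad \mathbb E_{\mathrm{tgt}}[(y-\langle w^*,x\rangle)^2xx^\top]\preceq\sigma^2 H.$$ Let $w_{M+N}$ be the output of the pretraining-finetuning SGD with $M$ source data and $N$ target data, and let $M_{\mathrm{eff}}:=M/\log M$, $N_{\mathrm{eff}}:=N/\log N$. Suppose that $0<\gamma_0,\gamma_M<\min\{1/(4\alpha\,\mathrm{tr}(G)),\,1/(4\alpha\,\mathrm{tr}(H))\}$. Then $$\mathbb E[\mathcal E(w_{M+N})]\le \mathrm{BiasErr}+\mathrm{VarErr}.$$ Moreover, for any two index sets $\mathbb J,\mathbb K\subset\mathbb N_+$, $$\mathrm{VarErr}\lesssim\sigma^2\Big(\frac{D_{\mathrm{eff}}^{\mathrm{ft}}}{M_{\mathrm{eff}}}+\frac{D_{\mathrm{eff}}}{N_{\mathrm{eff}}}\Big),$$ $$\begin{aligned}\mathrm{BiasErr}\lesssim{}&\Big\|\prod_{t=M}^{M+N-1}(I-\gamma_tH)\prod_{t=0}^{M-1}(I-\gamma_tG)(w_0-w^*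 )\Big\|_H^2+\alpha\,\|w_0-w^*\|^2_{\frac{I_{\mathbb J}}{M_{\mathrm{eff}}\gamma_0}+G_{\mathbb J^c}}\cdot\frac{D_{\mathrm{eff}}^{\mathrm{ft}}}{M_{\mathrm{eff}}}\\&+\alpha\Big(\Big\|\prod_{t=0}^{M-1}(I-\gamma_tG)(w_0-w^* )\Big\|^2_{\frac{I_{\mathbb K}}{N_{\mathrm{eff}}\gamma_M}+H_{\mathbb K^c}}+\|w_0-w^*\|^2_{\frac{I_{\mathbb J}}{M_{\mathrm{eff}}\gamma_0}+G_{\mathbb J^c}}\Big)\cdot\frac{D_{\mathrm{eff}}}{N_{\mathrm{eff}}},\end{aligned}$$ where $$D_{\mathrm{eff}}^{\mathrm{ft}}:=\mathrm{tr}\Big(\prod_{t=0}^{N-1}(I-\gamma_{M+t}H)^2H\cdot\big(G_{\mathbb J}^{-1}+M_{\mathrm{eff}}^2\gamma_0^2\,G_{\mathbb J^c}\big)\Big),\qquad D_{\mathrm{eff}}:=|\mathbb K|+N_{\mathrm{eff}}^2\gamma_M^2\sum_{i\notin\mathbb K}\lambda_i^2 .$$ In particular, these upper bounds are optimized (over $\mathbb J,\mathbb K$) when $\mathbb J=\{j:\mu_j\ge 1/(\gamma_0M_{\mathrm{eff}})\}$ and $\mathbb K=\{k:\lambda_k\ge1/(\gamma_MN_{\mathrm{eff}})\}$.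
   Context: Setting. Covariates $x$ lie in a Hilbert space ($d$-dimensional or countably infinite-dimensional) and responses $y\in\mathbb R$. $\mathcal D_{\mathrm{src}}$ and $\mathcal D_{\mathrm{tgt}}$ are the source and target distributions of $(x,y)$; $\mathbb E_{\mathrm{src}},\mathbb E_{\mathrm{tgt}}$ are expectations under them. $G:=\mathbb E_{\mathrm{src}}[xx^\top]$ and $H:=\mathbb E_{\mathrm{tgt}}[xx^\top]$ have finite entries and finite trace and are strictly positive definite, with eigenvalues $(\mu_i)_{i\ge1}$ and $(\lambda_i)_{i\ge1}$ respectively. Let $\mathrm{risk}_{\mathrm{src}}(w)=\frac12\mathbb E_{\mathrm{src}}(y-w^\top x)^2$, $\mathrm{risk}_{\mathrm{tgt}}(w)=\frac12\mathbb E_{\mathrm{tgt}}(y-w^\top x)^2$; it is assumed that there is a unique $w^*$ simultaneously minimizing both. The target excess risk is $\mathcal E(w):=\mathrm{risk}_{\mathrm{tgt}}(w)-\mathrm{risk}_{\mathrm{tgt}}(w^* )=\frac12(w-w^* )^\top H(w-w^* )$. SGD. Independent data $(x_i,y_i)\sim\mathcal D_{\mathrm{src}}$ for $i=1,\dots,M$ and $(x_i,y_i)\sim\mathcal D_{\mathrm{tgt}}$ for $i=M+1,\dots,M+N$ ($M,N\ge2$). $w_0=0$ and $w_t=w_{t-1}-\gamma_{t-1}(x_tx_t^\top w_{t-1}-x_ty_t)$ for $t=1,\dots,M+N$, with $\gamma_t=\gamma_0/2^{\lfloor t/M_{\mathrm{eff}}\rfloor}$ for $0\le t<M$ and $\gamma_t=\gamma_M/2^{\lfloor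 (t-M)/N_{\mathrm{eff}}\rfloor}$ for $M\le t<M+N$. Output: $w_{M+N}$. Here $\log$ is base 2. Bias and variance errors. For a symmetric $A$ put $(\mathcal I-\gamma\mathcal T_G(\gamma))\circ A:=A-\gamma(GA+AG)+\gamma^2\mathbb E_{\mathrm{src}}[xx^\top Axx^\top]$ and $(\mathcal I-\gamma\mathcal T_H(\gamma))\circ A:=A-\gamma(HA+AH)+\gamma^2\mathbb E_{\mathrm{tgt}}[xx^\top Axx^\top]$. Let $\Sigma_G:=\mathbb E_{\mathrm{src}}[(y-\langle w^*,x\rangle)^2xx^\top]$, $\Sigma_H:=\mathbb E_{\mathrm{tgt}}[(y-\langle w^*,x\rangle)^2xx^\top]$. Define $B_0=(w_0-w^* )(w_0-w^* )^\top$, $C_0=0$, and, for $1\le t\le M$, $B_t=(\mathcal I-\gamma_{t-1}\mathcal T_G(\gamma_{t-1}))\circ B_{t-1}$, $C_t=(\mathcal I-\gamma_{t-1}\mathcal T_G(\gamma_{t-1}))\circ C_{t-1}+\gamma_{t-1}^2\Sigma_G$; for $M<t\le M+N$ use the same recursions with $H$ in place of $G$. Then $\mathrm{BiasErr}:=\langle H,B_{M+N}\rangle$ and $\mathrm{VarErr}:=\langle H,C_{M+N}\rangle$, where $\langle A,B\rangle=\mathrm{tr}(A^\top B)$. Notation. $\|v\|_A^2:=v^\top Av$. For an index set $\mathbb K\subset\mathbb N_+$ with complement $\mathbb K^c$, and $(v_i)$ the orthonormal eigenvectors of $H$: $H_{\mathbb K}=\sum_{i\in\mathbb K}\lambda_iv_iv_i^\top$,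 $H_{\mathbb K}^{-1}=\sum_{i\in\mathbb K}\lambda_i^{-1}v_iv_i^\top$, $aI_{\mathbb K}+H_{\mathbb K^c}=\sum_{i\in\mathbb K}a\,v_iv_i^\top+\sum_{i\notin\mathbb K}\lambda_iv_iv_i^\top$; $G_{\mathbb J}$, $G_{\mathbb J}^{-1}$, $aI_{\mathbb J}+G_{\mathbb J^c}$ are defined likewise from the eigenvalues $\mu_i$ and orthonormal eigenvectors of $G$. (In dimension $d$, index sets are subsets of $\{1,\dots,d\}$.) $f\lesssim g$ means $f\le cg$ for an absolute constant $c>0$. *)

theory Defs
  imports "HOL-Probability.Probability" "HOL-Library.Extended_Nat"
begin

text \<open>Operators are plain functions. \<^term>\<open>outer x\<close> is the rank-one operator $x x^\top$.\<close>

definition outer :: "'a::real_inner \<Rightarrow> 'a \<Rightarrow> 'a" where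
  "outer x = (\<lambda>v. (x \<bullet> v) *\<^sub>R x)"

definition psd :: "('a::real_inner \<Rightarrow> 'a) \<Rightarrow> bool" where
  "psd A \<longleftrightarrow> bounded_linear A \<and> (\<forall>v w. v \<bullet> A w = A v \<bullet> w) \<and> (\<forall>v. 0 \<le> v \<bullet> A v)"

text \<open>The Loewner order; it is only applied to symmetric operators.\<close>

definition loewner_le :: "('a::real_inner \<Rightarrow> 'a) \<Rightarrow> ('a \<Rightarrow> 'a) \<Rightarrow> bool" where
  "loewner_le A B \<longleftrightarrow> (\<forall>v. v \<bullet> A v \<le> v \<bullet> B v)"

definition sqnorm :: "('a::real_inner \<Rightarrow> 'a) \<Rightarrow> 'a \<Rightarrow> real" where
  "sqnorm A v = v \<bullet> A v"

definition orthonormal_basis :: "'a::real_inner set \<Rightarrow> nat set \<Rightarrow> (nat \<Rightarrow> 'a) \<Rightarrow> bool" where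
  "orthonormal_basis S I e \<longleftrightarrow>
     (\<forall>i\<in>I. \<forall>j\<in>I. e i \<bullet> e j = (if i = j then 1 else 0)) \<and> closure (span (e ` I)) = S"

text \<open>The trace, computed in an orthonormal basis \<^term>\<open>e\<close>; for trace-class operators the value does
  not depend on the basis. The extended version is meant for operators with a nonnegative diagonal
  whose trace may be infinite.\<close>

definition op_trace :: "(nat \<Rightarrow> 'a::real_inner) \<Rightarrow> nat set \<Rightarrow> ('a \<Rightarrow> 'a) \<Rightarrow> real" where
  "op_trace e I A = (\<Sum>\<^sub>\<infinity>i\<in>I. e i \<bullet> A (e i))"

definition op_etrace :: "(nat \<Rightarrow> 'a::real_inner) \<Rightarrow> nat set \<Rightarrow> ('a \<Rightarrow> 'a) \<Rightarrow> ennreal" where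
  "op_etrace e I A = (\<Sum>\<^sub>\<infinity>i\<in>I. ennreal (e i \<bullet> A (e i)))"

definition op_inner :: "(nat \<Rightarrow> 'a::real_inner) \<Rightarrow> nat set \<Rightarrow> ('a \<Rightarrow> 'a) \<Rightarrow> ('a \<Rightarrow> 'a) \<Rightarrow> real" where
  "op_inner e I A B = op_trace e I (adjoint A \<circ> B)"

text \<open>$\sum_{i \in K} s_i e_i e_i^\top$. If the coefficients are unbounded, the value is meaningful only
  on the domain of this operator, which contains every \<^term>\<open>e i\<close>.\<close>

definition spec_op :: "(nat \<Rightarrow> 'a::real_inner) \<Rightarrow> nat set \<Rightarrow> (nat \<Rightarrow> real) \<Rightarrow> 'a \<Rightarrow> 'a" where
  "spec_op e K s = (\<lambda>x. \<Sum>\<^sub>\<infinity>i\<in>K. s i *\<^sub>R outer (e i) x)"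

text \<open>\<^term>\<open>contraction g A\<close> is $I - g A$.\<close>

definition contraction :: "real \<Rightarrow> ('a::real_vector \<Rightarrow> 'a) \<Rightarrow> 'a \<Rightarrow> 'a" where
  "contraction g A = (\<lambda>v. v - g *\<^sub>R A v)"

primrec op_prod :: "(nat \<Rightarrow> 'a \<Rightarrow> 'a) \<Rightarrow> nat \<Rightarrow> 'a \<Rightarrow> 'a" where
  "op_prod F 0 = id"
| "op_prod F (Suc n) = F n \<circ> op_prod F n"

definition second_moment ::
    "('a::{real_inner, banach, second_countable_topology} \<times> real) measure \<Rightarrow> 'a \<Rightarrow> 'a" where
  "second_moment D = (\<lambda>v. \<integral>z. outer (fst z) v \<partial>D)"

definition fourth_moment ::
    "('a::{real_inner, banach, second_countable_topology} \<times> real) measure \<Rightarrow> ('a \<Rightarrow> 'a) \<Rightarrow> 'a \<Rightarrow> 'a" where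
  "fourth_moment D A = (\<lambda>v. \<integral>z. outer (fst z) (A (outer (fst z) v)) \<partial>D)"

definition noise_cov ::
    "('a::{real_inner, banach, second_countable_topology} \<times> real) measure \<Rightarrow> 'a \<Rightarrow> 'a \<Rightarrow> 'a" where
  "noise_cov D w = (\<lambda>v. \<integral>z. (snd z - w \<bullet> fst z)\<^sup>2 *\<^sub>R outer (fst z) v \<partial>D)"

definition risk ::
    "('a::{real_inner, banach, second_countable_topology} \<times> real) measure \<Rightarrow> 'a \<Rightarrow> real" where
  "risk D w = 1/2 * (\<integral>z. (snd z - w \<bullet> fst z)\<^sup>2 \<partial>D)"

text \<open>The Hilbert space of the covariates is a closed subspace \<open>hilb\<close> of the ambient type, not the whole
  type: its dimension is then a quantifiable value, and a constant chosen before the problem is uniform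
  over all dimensions.\<close>

record 'a problem =
  hilb :: "'a set"
  hdim :: enat
  src :: "('a \<times> real) measure"
  tgt :: "('a \<times> real) measure"
  src_vec :: "nat \<Rightarrow> 'a"
  src_val :: "nat \<Rightarrow> real"
  tgt_vec :: "nat \<Rightarrow> 'a"
  tgt_val :: "nat \<Rightarrow> real"
  wstar :: 'a
  n_src :: nat
  n_tgt :: nat
  step_src :: real
  step_tgt :: real

definition idx :: "'a problem \<Rightarrow> nat set" where
  "idx p = {i. 1 \<le> i \<and> enat i \<le> hdim p}"

definition Gop :: "'a::{real_inner, banach, second_countable_topology} problem \<Rightarrow> 'a \<Rightarrow> 'a" where
  "Gop p = second_moment (src p)"

definition Hop :: "'a::{real_inner, banach, second_countable_topology} problem \<Rightarrow> 'a \<Rightarrow> 'a" where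
  "Hop p = second_moment (tgt p)"

definition tr_G :: "'a::{real_inner, banach, second_countable_topology} problem \<Rightarrow> real" where
  "tr_G p = op_trace (src_vec p) (idx p) (Gop p)"

definition tr_H :: "'a::{real_inner, banach, second_countable_topology} problem \<Rightarrow> real" where
  "tr_H p = op_trace (tgt_vec p) (idx p) (Hop p)"

text \<open>Integrability of the squared norm of \<open>x\<close> says that the second moment operator has finite trace;
  integrability of \<open>y\<^sup>2\<close> makes the risk finite.\<close>

definition data_law :: "'a::{real_inner, banach, second_countable_topology} set \<Rightarrow> ('a \<times> real) measure \<Rightarrow> bool" where
  "data_law S D \<longleftrightarrow>
     prob_space D \<and> sets D = sets borel \<and> (AE z in D. fst z \<in> S) \<and>
     integrable D (\<lambda>z. (norm (fst z))\<^sup>2) \<and> integrable D (\<lambda>z. (snd z)\<^sup>2) \<and>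
     (\<forall>v\<in>S. v \<noteq> 0 \<longrightarrow> 0 < v \<bullet> second_moment D v)"

definition covariate_shift :: "'a::{real_inner, banach, second_countable_topology} problem \<Rightarrow> bool" where
  "covariate_shift p \<longleftrightarrow>
     subspace (hilb p) \<and> closed (hilb p) \<and>
     data_law (hilb p) (src p) \<and> data_law (hilb p) (tgt p) \<and>
     orthonormal_basis (hilb p) (idx p) (src_vec p) \<and>
     (\<forall>i\<in>idx p. Gop p (src_vec p i) = src_val p i *\<^sub>R src_vec p i) \<and>
     orthonormal_basis (hilb p) (idx p) (tgt_vec p) \<and>
     (\<forall>i\<in>idx p. Hop p (tgt_vec p i) = tgt_val p i *\<^sub>R tgt_vec p i) \<and>
     {w. is_arg_min (risk (src p)) (\<lambda>w. w \<in> hilb p) w \<and>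
         is_arg_min (risk (tgt p)) (\<lambda>w. w \<in> hilb p) w} = {wstar p}"

definition fourth_moment_upper ::
    "'a::{real_inner, banach, second_countable_topology} problem \<Rightarrow> real \<Rightarrow> bool" where
  "fourth_moment_upper p \<alpha> \<longleftrightarrow>
     integrable (src p) (\<lambda>z. norm (fst z) ^ 4) \<and> integrable (tgt p) (\<lambda>z. norm (fst z) ^ 4) \<and>
     (\<forall>A. psd A \<longrightarrow>
        loewner_le (fourth_moment (src p) A)
          (\<lambda>v. (\<alpha> * op_trace (src_vec p) (idx p) (Gop p \<circ> A)) *\<^sub>R Gop p v) \<and>
        loewner_le (fourth_moment (tgt p) A)
          (\<lambda>v. (\<alpha> * op_trace (tgt_vec p) (idx p) (Hop p \<circ> A)) *\<^sub>R Hop p v))"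

text \<open>The integrability part says that the two expectations exist; it must be stated because the
  Bochner integral of a non-integrable function is 0.\<close>

definition noise_upper ::
    "'a::{real_inner, banach, second_countable_topology} problem \<Rightarrow> real \<Rightarrow> bool" where
  "noise_upper p \<sigma> \<longleftrightarrow>
     integrable (src p) (\<lambda>z. (snd z - wstar p \<bullet> fst z)\<^sup>2 * (norm (fst z))\<^sup>2) \<and>
     integrable (tgt p) (\<lambda>z. (snd z - wstar p \<bullet> fst z)\<^sup>2 * (norm (fst z))\<^sup>2) \<and>
     loewner_le (noise_cov (src p) (wstar p)) (\<lambda>v. \<sigma>\<^sup>2 *\<^sub>R Gop p v) \<and>
     loewner_le (noise_cov (tgt p) (wstar p)) (\<lambda>v. \<sigma>\<^sup>2 *\<^sub>R Hop p v)"

definition excess_risk :: "'a::{real_inner, banach, second_countable_topology} problem \<Rightarrow> 'a \<Rightarrow> real" where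
  "excess_risk p w = risk (tgt p) w - risk (tgt p) (wstar p)"

definition eff_size :: "nat \<Rightarrow> real" where
  "eff_size n = real n / log 2 (real n)"

definition M_eff :: "'a problem \<Rightarrow> real" where
  "M_eff p = eff_size (n_src p)"

definition N_eff :: "'a problem \<Rightarrow> real" where
  "N_eff p = eff_size (n_tgt p)"

definition step :: "'a problem \<Rightarrow> nat \<Rightarrow> real" where
  "step p t =
     (if t < n_src p then step_src p / 2 ^ nat \<lfloor>real t / M_eff p\<rfloor>
      else step_tgt p / 2 ^ nat \<lfloor>real (t - n_src p) / N_eff p\<rfloor>)"

definition w_init :: "'a::real_vector" where
  "w_init = 0"

text \<open>The law of the \<open>t\<close>-th observation; observations are numbered from 1.\<close>

definition law :: "'a problem \<Rightarrow> nat \<Rightarrow> ('a \<times> real) measure" where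
  "law p t = (if t \<le> n_src p then src p else tgt p)"

definition is_sample :: "'a::topological_space problem \<Rightarrow> 'w measure \<Rightarrow> (nat \<Rightarrow> 'w \<Rightarrow> 'a \<times> real) \<Rightarrow> bool" where
  "is_sample p P Z \<longleftrightarrow>
     prob_space P \<and> prob_space.indep_vars P (\<lambda>_. borel) Z {1..n_src p + n_tgt p} \<and>
     (\<forall>t\<in>{1..n_src p + n_tgt p}. distr P borel (Z t) = law p t)"

primrec sgd :: "'a::real_inner problem \<Rightarrow> (nat \<Rightarrow> 'a \<times> real) \<Rightarrow> nat \<Rightarrow> 'a" where
  "sgd p z 0 = w_init"
| "sgd p z (Suc t) =
     sgd p z t - step p t *\<^sub>R (outer (fst (z (Suc t))) (sgd p z t) - snd (z (Suc t)) *\<^sub>R fst (z (Suc t)))"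

definition sgd_output :: "'a::real_inner problem \<Rightarrow> (nat \<Rightarrow> 'a \<times> real) \<Rightarrow> 'a" where
  "sgd_output p z = sgd p z (n_src p + n_tgt p)"

text \<open>\<^term>\<open>sgd_op D g\<close> is $\mathcal I - g \mathcal T(g)$ for the distribution \<^term>\<open>D\<close>.\<close>

definition sgd_op ::
    "('a::{real_inner, banach, second_countable_topology} \<times> real) measure \<Rightarrow> real \<Rightarrow> ('a \<Rightarrow> 'a) \<Rightarrow> 'a \<Rightarrow> 'a" where
  "sgd_op D g A = (\<lambda>v. A v - g *\<^sub>R (second_moment D (A v) + A (second_moment D v))
                        + g\<^sup>2 *\<^sub>R fourth_moment D A v)"

primrec bias_iter :: "'a::{real_inner, banach, second_countable_topology} problem \<Rightarrow> nat \<Rightarrow> 'a \<Rightarrow> 'a" where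
  "bias_iter p 0 = outer (w_init - wstar p)"
| "bias_iter p (Suc t) = sgd_op (law p (Suc t)) (step p t) (bias_iter p t)"

primrec var_iter :: "'a::{real_inner, banach, second_countable_topology} problem \<Rightarrow> nat \<Rightarrow> 'a \<Rightarrow> 'a" where
  "var_iter p 0 = (\<lambda>v. 0)"
| "var_iter p (Suc t) =
     (\<lambda>v. sgd_op (law p (Suc t)) (step p t) (var_iter p t) v
          + (step p t)\<^sup>2 *\<^sub>R noise_cov (law p (Suc t)) (wstar p) v)"

definition bias_err :: "'a::{real_inner, banach, second_countable_topology} problem \<Rightarrow> real" where
  "bias_err p = op_inner (tgt_vec p) (idx p) (Hop p) (bias_iter p (n_src p + n_tgt p))"

definition var_err :: "'a::{real_inner, banach, second_countable_topology} problem \<Rightarrow> real" where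
  "var_err p = op_inner (tgt_vec p) (idx p) (Hop p) (var_iter p (n_src p + n_tgt p))"

text \<open>Index sets may be infinite, so the effective dimensions take values in $[0,\infty]$.
  For infinite \<open>J\<close> the inverse of \<open>G\<close> on \<open>J\<close> is unbounded; the trace is therefore taken along the
  eigenvectors of \<open>G\<close>, which lie in its domain.\<close>

definition D_eff_ft ::
    "'a::{real_inner, banach, second_countable_topology} problem \<Rightarrow> nat set \<Rightarrow> ennreal" where
  "D_eff_ft p J =
     op_etrace (src_vec p) (idx p)
       (op_prod (\<lambda>t. contraction (step p (n_src p + t)) (Hop p) ^^ 2) (n_tgt p) \<circ> Hop p \<circ>
        (\<lambda>x. spec_op (src_vec p) J (\<lambda>j. 1 / src_val p j) x
             + ((M_eff p)\<^sup>2 * (step_src p)\<^sup>2) *\<^sub>R spec_op (src_vec p) (idx p - J) (src_val p) x))"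

definition D_eff :: "'a problem \<Rightarrow> nat set \<Rightarrow> ennreal" where
  "D_eff p K =
     (if finite K then of_nat (card K) else \<infinity>)
     + ennreal ((N_eff p)\<^sup>2 * (step_tgt p)\<^sup>2) * (\<Sum>\<^sub>\<infinity>i\<in>idx p - K. ennreal ((tgt_val p i)\<^sup>2))"

text \<open>$a I_K + A_{K^c}$ for the operator with eigenvectors \<^term>\<open>e\<close> and eigenvalues \<^term>\<open>s\<close>.\<close>

definition head_tail ::
    "(nat \<Rightarrow> 'a::real_inner) \<Rightarrow> (nat \<Rightarrow> real) \<Rightarrow> nat set \<Rightarrow> nat set \<Rightarrow> real \<Rightarrow> 'a \<Rightarrow> 'a" where
  "head_tail e s I K a = (\<lambda>x. spec_op e K (\<lambda>_. a) x + spec_op e (I - K) s x)"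

definition src_weight :: "'a::real_inner problem \<Rightarrow> nat set \<Rightarrow> 'a \<Rightarrow> 'a" where
  "src_weight p J = head_tail (src_vec p) (src_val p) (idx p) J (1 / (M_eff p * step_src p))"

definition tgt_weight :: "'a::real_inner problem \<Rightarrow> nat set \<Rightarrow> 'a \<Rightarrow> 'a" where
  "tgt_weight p K = head_tail (tgt_vec p) (tgt_val p) (idx p) K (1 / (N_eff p * step_tgt p))"

definition src_prod :: "'a::{real_inner, banach, second_countable_topology} problem \<Rightarrow> 'a \<Rightarrow> 'a" where
  "src_prod p = op_prod (\<lambda>t. contraction (step p t) (Gop p)) (n_src p)"

definition tgt_prod :: "'a::{real_inner, banach, second_countable_topology} problem \<Rightarrow> 'a \<Rightarrow> 'a" where
  "tgt_prod p = op_prod (\<lambda>t. contraction (step p (n_src p + t)) (Hop p)) (n_tgt p)"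

definition var_bound ::
    "'a::{real_inner, banach, second_countable_topology} problem \<Rightarrow> real \<Rightarrow> nat set \<Rightarrow> nat set \<Rightarrow> ennreal" where
  "var_bound p \<sigma> J K =
     ennreal (\<sigma>\<^sup>2) * (D_eff_ft p J / ennreal (M_eff p) + D_eff p K / ennreal (N_eff p))"

definition bias_bound ::
    "'a::{real_inner, banach, second_countable_topology} problem \<Rightarrow> real \<Rightarrow> nat set \<Rightarrow> nat set \<Rightarrow> ennreal" where
  "bias_bound p \<alpha> J K =
     ennreal (sqnorm (Hop p) (tgt_prod p (src_prod p (w_init - wstar p))))
     + ennreal (\<alpha> * sqnorm (src_weight p J) (w_init - wstar p)) * (D_eff_ft p J / ennreal (M_eff p))
     + ennreal (\<alpha> * (sqnorm (tgt_weight p K) (src_prod p (w_init - wstar p))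
                     + sqnorm (src_weight p J) (w_init - wstar p))) * (D_eff p K / ennreal (N_eff p))"

definition J_opt :: "'a problem \<Rightarrow> nat set" where
  "J_opt p = {j \<in> idx p. 1 / (step_src p * M_eff p) \<le> src_val p j}"

definition K_opt :: "'a problem \<Rightarrow> nat set" where
  "K_opt p = {k \<in> idx p. 1 / (step_tgt p * N_eff p) \<le> tgt_val p k}"

end

theory Submission imports Defs begin

text \<open>In the eigenbasis of the second moment operator, with eigenvalues $\mu_i$, the diagonal of the bias
  and of the variance iterate satisfies
  $p_{t+1,i} \le (1 - \gamma_t \mu_i)^2 p_{t,i} + \gamma_t^2 d_t \mu_i$. For the variance,
  $d_t \le 5\sigma^2/4$ because $C_t \preceq \sigma^2 \max(\gamma_0, \gamma_M) I$. For the bias,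
  $d_t = \alpha\, \mathrm{tr}(G B_t)$, so the recursions of all coordinates are coupled: the Lyapunov function
  $\sum_i \min(1/(M_{\mathrm{eff}}\gamma_0), \mu_i)\, p_{t,i}$ grows by a bounded factor only, which bounds
  $\sum_t \gamma_t d_t$, and a self-bounding argument turns this into
  $d_t \lesssim \alpha M_{\mathrm{eff}}\gamma_0 W / \sum_{s<t}\gamma_s$, where $W$ is the initial value of the
  Lyapunov function. Both inputs accumulate to at most a multiple of
  $M_{\mathrm{eff}}^{-1} \min(1/\mu, M_{\mathrm{eff}}^2\gamma_0^2\mu)$ in direction $\mu$.
  The noise handed over to finetuning is at most a multiple of $\alpha\gamma_0 W I$, whose trace against $H$ is
  at most a multiple of $W$ by the bound on $\gamma_0$ in terms of $\mathrm{tr}(H)$.\<close>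

section \<open>Geometrically decaying step sizes\<close>

text \<open>The bound on the sum of \<open>rate s * d s\<close> controls directions whose eigenvalue
  x is too small for damping, but it does not exclude that much of this mass arrives late, where
  little damping is left. The bound \<open>1/x\<close> therefore needs a pointwise estimate of the
  late inputs; this is what the self-bounding argument is for. The second obstacle is the change of
  phase: G and H need not commute, so the diagonal in the eigenbasis of G does not determine the one
  in the eigenbasis of H. The source moment is therefore also bounded as a quadratic form at every
  vector: the initial rank-one term, transported exactly by the mean contractions, plus a form
  diagonal in the eigenbasis of G. The first part yields the product term of the bias bound, the
  second the trace in \<open>D_eff_ft\<close>. The errors are estimated at the optimal index sets
  only, where head and tail coefficients combine in each direction to a minimum of two numbers; for
  any other index sets each coefficient is at least this minimum, so the bounds follow by
  monotonicity.\<close>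

lemma eff_size_ge_1:
  assumes "2 \<le> n" shows "1 \<le> eff_size n"
proof -
  have "log 2 (real n) \<le> log 2 (2 powr real n)"
    using assms of_nat_less_two_power[of n, where 'a=real] by (subst log_le_cancel_iff) (auto simp: powr_realpow)
  moreover have "0 < log 2 (real n)" using assms by simp
  ultimately show ?thesis by (simp add: eff_size_def)
qed

lemma eff_size_le:
  assumes "2 \<le> n" shows "eff_size n \<le> real n"
proof -
  have "1 \<le> log 2 (real n)" using assms by (simp add: le_log_iff)
  then show ?thesis using assms by (simp add: eff_size_def divide_le_eq mult_le_cancel_left1)
qed

locale halving_steps =
  fixes n :: nat and g0 :: real
  assumes n2: "2 \<le> n" and g0: "0 < g0"
begin

abbreviation "Ne \<equiv> eff_size n"

definition rate :: "nat \<Rightarrow> real" where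
  "rate t = g0 / 2 ^ nat \<lfloor>real t / Ne\<rfloor>"

text \<open>The interpolation \<open>u\<close> satisfies an exact one-step recursion, which the floor in \<^term>\<open>rate\<close> destroys.\<close>

definition u :: "nat \<Rightarrow> real" where
  "u t = g0 * 2 powr (- (real t / Ne))"

definition rate_sum :: "nat \<Rightarrow> real" where
  "rate_sum t = (\<Sum>s<t. rate s)"

lemma Ne: "1 \<le> Ne" "0 < Ne" "Ne \<le> real n"
  using eff_size_ge_1[OF n2] eff_size_le[OF n2] by auto

lemma rate_pos: "0 < rate t" and rate_le: "rate t \<le> g0"
  using g0 by (auto simp: rate_def divide_le_eq mult_le_cancel_left1)

lemma rate_nonneg: "0 \<le> rate t"
  using rate_pos[of t] by simp

lemma u_pos: "0 < u t" using g0 by (simp add: u_def)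

text \<open>The floor drops less than one unit of the exponent, hence at most a factor 2.\<close>

lemma u_le_rate: "u t \<le> rate t" and rate_le_u: "rate t \<le> 2 * u t"
proof -
  define k where "k = nat \<lfloor>real t / Ne\<rfloor>"
  have k: "real k \<le> real t / Ne" "real t / Ne \<le> real k + 1"
    using Ne unfolding k_def by (auto simp: of_nat_nat intro: less_imp_le)
  have r: "rate t = g0 * 2 powr (- real k)"
    by (simp add: rate_def k_def[symmetric] powr_minus powr_realpow field_simps)
  show "u t \<le> rate t"
    unfolding r u_def using g0 k by (intro mult_left_mono) auto
  have "2 powr (- real k) \<le> 2 powr (1 - real t / Ne)" using k by simp
  also have "\<dots> = 2 * 2 powr (- (real t / Ne))"
    by (simp add: powr_diff powr_minus field_simps)
  finally show "rate t \<le> 2 * u t"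
    unfolding r u_def using g0 mult_left_mono[of _ _ g0] by fastforce
qed

text \<open>The decrement of \<open>u\<close> is comparable to \<open>u / Ne\<close> from both
  sides. The bound from below telescopes to an upper bound on the total rate, the bound from above
  to a lower one.\<close>

lemma u_Suc_ge: "u t * (1 - 1 / Ne) \<le> u (Suc t)"
  and u_Suc_le: "u t / (3 * Ne) \<le> u t - u (Suc t)"
proof -
  define q where "q = 2 powr (- (1 / Ne))"
  have y: "0 < 1 / Ne" "1 / Ne \<le> 1" using Ne by auto
  have uq: "u (Suc t) = u t * q"
    by (simp add: u_def q_def powr_add[symmetric] add_divide_distrib add.commute)
  have ln2: "1 / 2 \<le> ln (2::real)" "ln (2::real) \<le> 1"
    using ln2_ge_two_thirds ln_le_minus_one[of 2] by auto
  have q: "q = exp (- (ln 2 / Ne))" by (simp add: q_def powr_def)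
  have "1 - 1 / Ne \<le> 1 - ln 2 / Ne" using ln2 Ne by (simp add: divide_right_mono)
  also have "\<dots> \<le> q" unfolding q using exp_ge_add_one_self[of "- (ln 2 / Ne)"] by simp
  finally have "1 - 1 / Ne \<le> q" .
  then show "u t * (1 - 1 / Ne) \<le> u (Suc t)"
    unfolding uq using u_pos[of t] by (intro mult_left_mono) auto
  \<comment> \<open>\<open>z\<close> halves \<open>1 / Ne\<close> to get below
    \<open>ln 2 / Ne\<close>; then \<open>z \<le> 1/2\<close> is exactly what makes
    \<open>inverse (1 + z) \<le> 1 - 2/3 * z\<close> true.\<close>
  define z where "z = 1 / Ne / 2"
  have z: "0 < z" "z \<le> 1/2" using y by (auto simp: z_def)
  have "z \<le> ln 2 / Ne" using ln2 Ne by (simp add: z_def field_simps)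
  then have "q \<le> exp (- z)" unfolding q by simp
  also have "\<dots> \<le> inverse (1 + z)"
    unfolding exp_minus using z exp_ge_add_one_self[of z] by (intro le_imp_inverse_le) auto
  also have "\<dots> \<le> 1 - 2/3 * z" using z by (simp add: field_simps)
  finally have "q \<le> 1 - 2/3 * z" .
  then have "1 / (3 * Ne) \<le> 1 - q" by (simp add: z_def)
  then have "u t * (1 / (3 * Ne)) \<le> u t * (1 - q)"
    using u_pos[of t] by (intro mult_left_mono) auto
  then show "u t / (3 * Ne) \<le> u t - u (Suc t)" by (simp add: uq algebra_simps)
qed

lemma u_0: "u 0 = g0" by (simp add: u_def)

text \<open>With \<open>Ne = n / log n\<close> a phase contains \<open>log n\<close> halvings, so
  the interpolated rate ends at \<open>g0 / n\<close>.\<close>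

lemma u_n: "u n = g0 / real n"
proof -
  have "real n / Ne = log 2 (real n)" using n2 by (simp add: eff_size_def)
  then show ?thesis using n2 by (simp add: u_def powr_minus field_simps)
qed

lemma rate_sum_Suc: "rate_sum (Suc t) = rate_sum t + rate t" and rate_sum_0: "rate_sum 0 = 0"
  by (simp_all add: rate_sum_def)

lemma rate_sum_nonneg: "0 \<le> rate_sum t"
  by (simp add: rate_sum_def sum_nonneg rate_nonneg)

lemma rate_sum_le: "rate_sum t \<le> 6 * (Ne * g0)"
proof -
  \<comment> \<open>The term \<open>- u t\<close> strengthens the claim: each
    \<open>rate t \<le> 2 * u t\<close> is paid by the decrement of \<open>u\<close>, and 6 is 2
    times the 3 of \<open>u_Suc_le\<close>.\<close>
  have "rate_sum t \<le> 6 * Ne * (g0 - u t)"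
  proof (induction t)
    case (Suc t)
    have "rate t \<le> 2 * u t" by (rule rate_le_u)
    also have "\<dots> = 6 * Ne * (u t / (3 * Ne))" using Ne by simp
    also have "\<dots> \<le> 6 * Ne * (u t - u (Suc t))" using u_Suc_le Ne by (intro mult_left_mono) auto
    finally show ?case using Suc by (simp add: rate_sum_Suc algebra_simps)
  qed (simp add: rate_sum_0 u_0)
  also have "\<dots> \<le> 6 * Ne * g0" using u_pos[of t] Ne by (intro mult_left_mono) auto
  finally show ?thesis by simp
qed

text \<open>Telescoping loses only the final value \<open>u n = g0 / n\<close>, which is at most
  half of \<open>g0\<close> because \<open>n\<close> is at least 2.\<close>

lemma rate_sum_n_ge: "Ne * g0 / 2 \<le> rate_sum n"
proof -
  have "Ne * (g0 - u t) \<le> rate_sum t" for t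
  proof (induction t)
    case (Suc t)
    have "Ne * (u t - u (Suc t)) \<le> Ne * (u t * (1 / Ne))"
      using u_Suc_ge[of t] Ne by (intro mult_left_mono) (auto simp: algebra_simps)
    also have "\<dots> \<le> rate t" using u_le_rate[of t] Ne by simp
    finally show ?case using Suc by (simp add: rate_sum_Suc algebra_simps)
  qed (simp add: rate_sum_0 u_0)
  from this[of n] have "Ne * (g0 - g0 / real n) \<le> rate_sum n" by (simp add: u_n)
  moreover have "g0 / 2 \<le> g0 - g0 / real n" using n2 g0 by (simp add: field_simps)
  then have "Ne * (g0 / 2) \<le> Ne * (g0 - g0 / real n)" using Ne by (intro mult_left_mono) auto
  ultimately show ?thesis by linarith
qed

subsection \<open>Damped accumulation\<close>

text \<open>Squares, because the factor acts on diagonal entries of a covariance, once from each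
  side.\<close>

definition surv :: "real \<Rightarrow> nat \<Rightarrow> nat \<Rightarrow> real" where
  "surv x s t = (\<Prod>r\<in>{s..<t}. (1 - rate r * x)\<^sup>2)"

text \<open>The solution, started at 0, of the scalar recursion in \<open>acc_Suc\<close>, written
  out by variation of constants. In this form it is linear in the sources \<open>d\<close>, which
  can thus be split by their time.\<close>

definition acc :: "(nat \<Rightarrow> real) \<Rightarrow> real \<Rightarrow> nat \<Rightarrow> real" where
  "acc d x t = (\<Sum>s<t. (rate s)\<^sup>2 * d s * x * surv x (Suc s) t)"

lemma surv_refl [simp]: "surv x t t = 1" by (simp add: surv_def)

lemma surv_Suc: "s \<le> t \<Longrightarrow> surv x s (Suc t) = (1 - rate t * x)\<^sup>2 * surv x s t"
  by (simp add: surv_def mult.commute)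

lemma surv_nonneg: "0 \<le> surv x s t"
  by (simp add: surv_def prod_nonneg)

lemma acc_0 [simp]: "acc d x 0 = 0" by (simp add: acc_def)

lemma acc_Suc: "acc d x (Suc t) = (1 - rate t * x)\<^sup>2 * acc d x t + (rate t)\<^sup>2 * d t * x"
  by (simp add: acc_def surv_Suc sum_distrib_left algebra_simps)

lemma acc_nonneg: "0 \<le> x \<Longrightarrow> (\<And>s. s < t \<Longrightarrow> 0 \<le> d s) \<Longrightarrow> 0 \<le> acc d x t"
  unfolding acc_def by (intro sum_nonneg mult_nonneg_nonneg) (auto simp: surv_nonneg)

lemma acc_cmult: "acc (\<lambda>s. c * d s) x t = c * acc d x t"
  by (simp add: acc_def sum_distrib_left algebra_simps)

lemma acc_add: "acc (\<lambda>s. d s + d' s) x t = acc d x t + acc d' x t"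
  by (simp add: acc_def sum.distrib[symmetric] algebra_simps)

lemma rate_mult_le:
  assumes "0 \<le> x" "g0 * x \<le> c" shows "0 \<le> rate t * x" "rate t * x \<le> c"
  using assms mult_right_mono[OF rate_le[of t], of x] rate_nonneg[of t] by auto

lemma surv_le_exp:
  assumes "0 \<le> x" "g0 * x \<le> 1" "s \<le> t"
  shows "surv x s t \<le> exp (- 2 * x * (rate_sum t - rate_sum s))"
  using assms(3)
proof (induction t rule: dec_induct)
  case (step t)
  have a: "0 \<le> rate t * x" "rate t * x \<le> 1" using rate_mult_le[OF assms(1,2)] by auto
  have "(1 - rate t * x)\<^sup>2 \<le> (exp (- (rate t * x)))\<^sup>2"
    using exp_ge_add_one_self[of "- (rate t * x)"] a by (intro power_mono) auto
  also have "\<dots> = exp (- 2 * x * rate t)" by (simp add: power2_eq_square exp_add[symmetric])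
  finally have "(1 - rate t * x)\<^sup>2 * surv x s t
      \<le> exp (- 2 * x * rate t) * exp (- 2 * x * (rate_sum t - rate_sum s))"
    using step surv_nonneg by (intro mult_mono) auto
  also have "\<dots> = exp (- 2 * x * (rate_sum (Suc t) - rate_sum s))"
    by (simp add: exp_add[symmetric] rate_sum_Suc algebra_simps)
  finally show ?case using step by (simp add: surv_Suc)
qed simp

lemma surv_le_1:
  assumes "0 \<le> x" "g0 * x \<le> 1" shows "surv x s t \<le> 1"
proof -
  have "(1 - rate r * x)\<^sup>2 \<le> 1" for r
    using rate_mult_le[OF assms, of r] by (simp add: abs_square_le_1)
  then show ?thesis unfolding surv_def by (intro prod_le_1) auto
qed

text \<open>The noise of step \<open>s\<close> is damped only from step \<open>Suc s\<close> on.
  Reinstating the factor of step \<open>s\<close>, which is at least \<open>(3/4)\<^sup>2\<close>,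
  gives an exponent in terms of \<open>rate_sum s\<close> at the price of 16/9.\<close>

lemma surv_Suc_le_exp:
  assumes "0 \<le> x" "g0 * x \<le> 1/4" "s < t"
  shows "surv x (Suc s) t \<le> 16/9 * exp (- 2 * x * (rate_sum t - rate_sum s))"
proof -
  have a: "0 \<le> rate s * x" "rate s * x \<le> 1/4" using rate_mult_le[OF assms(1,2)] by auto
  have "(3/4)\<^sup>2 \<le> (1 - rate s * x)\<^sup>2" using a by (intro power_mono) auto
  then have "9/16 * surv x (Suc s) t \<le> (1 - rate s * x)\<^sup>2 * surv x (Suc s) t"
    by (intro mult_right_mono) (auto simp: surv_nonneg power2_eq_square)
  also have "\<dots> = surv x s t"
    using assms(3) by (simp add: surv_def prod.atLeast_Suc_lessThan)
  also have "\<dots> \<le> exp (- 2 * x * (rate_sum t - rate_sum s))"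
    using assms by (intro surv_le_exp) auto
  finally show ?thesis by simp
qed

text \<open>Damping is ignored altogether; this is the right bound for eigenvalues too small to be
  damped within the phase.\<close>

lemma acc_le_rate_sum:
  assumes "0 \<le> x" "g0 * x \<le> 1" "\<And>s. s < t \<Longrightarrow> 0 \<le> d s"
  shows "acc d x t \<le> x * g0 * (\<Sum>s<t. rate s * d s)"
proof -
  have "(rate s)\<^sup>2 * d s * x * surv x (Suc s) t \<le> x * g0 * (rate s * d s)" if "s < t" for s
  proof -
    have "rate s * (rate s * d s * x) * surv x (Suc s) t \<le> g0 * (rate s * d s * x) * 1"
      using assms that rate_le[of s] rate_nonneg[of s] surv_le_1[OF assms(1,2), of "Suc s" t] g0
      by (intro mult_mono) (auto simp: surv_nonneg)
    then show ?thesis by (simp add: power2_eq_square algebra_simps)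
  qed
  then show ?thesis unfolding acc_def sum_distrib_left by (intro sum_mono) auto
qed

text \<open>A bound \<open>k * g0 * d0\<close> reproduces itself in a step if
  \<open>(1 - a)\<^sup>2 * k + a \<le> k\<close>, for which \<open>k * (2 - a) \<ge> 1\<close>
  suffices; the smallest \<open>k\<close> that serves all \<open>a \<le> 1/4\<close> is 4/7.\<close>

lemma acc_le_first_rate:
  assumes "0 \<le> x" "g0 * x \<le> 1/4" "0 \<le> d0" "\<And>s. s < t \<Longrightarrow> d s \<le> d0"
  shows "acc d x t \<le> 4/7 * g0 * d0"
  using assms(4)
proof (induction t)
  case (Suc t)
  define a where "a = rate t * x"
  have a: "0 \<le> a" "a \<le> 1/4" using rate_mult_le[OF assms(1,2)] by (auto simp: a_def)
  have k: "(1 - a)\<^sup>2 * (4/7) + a \<le> 4/7"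
  proof -
    have "a * a \<le> 1/4 * a" using a by (intro mult_right_mono) auto
    then show ?thesis by (simp add: power2_eq_square algebra_simps)
  qed
  have "(rate t)\<^sup>2 * d t * x \<le> (rate t)\<^sup>2 * d0 * x"
    using Suc.prems[of t] assms by (intro mult_right_mono mult_left_mono) auto
  also have "\<dots> = rate t * (a * d0)" by (simp add: a_def power2_eq_square)
  also have "\<dots> \<le> g0 * (a * d0)" using a assms rate_le[of t] by (intro mult_right_mono) auto
  finally have "acc d x (Suc t) \<le> (1 - a)\<^sup>2 * (4/7 * g0 * d0) + g0 * (a * d0)"
    unfolding acc_Suc a_def[symmetric]
    using mult_left_mono[OF Suc.IH, of "(1 - a)\<^sup>2"] Suc.prems by simp
  also have "\<dots> = g0 * d0 * ((1 - a)\<^sup>2 * (4/7) + a)" by (simp add: algebra_simps)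
  also have "\<dots> \<le> g0 * d0 * (4/7)" using k g0 assms by (intro mult_left_mono) auto
  finally show ?case by simp
qed (use g0 assms in simp)

text \<open>Per step, the summand \<open>2 * (x * u t)\<close> of the potential pays for the injected noise and \<open>2 / Ne\<close> pays
  for the decay of \<open>u\<close>.\<close>

lemma acc_potential:
  assumes "0 < x" "g0 * x \<le> 1" "0 \<le> d0" "\<And>s. s < t \<Longrightarrow> d s \<le> d0"
  shows "x * acc d x t \<le> d0 * (2 * (x * u t) + 2 / Ne)"
  using assms(4)
proof (induction t)
  case (Suc t)
  define a v where "a = rate t * x" and "v = x * u t"
  have a: "0 \<le> a" "a \<le> 1" using rate_mult_le[of x 1] assms by (auto simp: a_def)
  have v: "0 < v" "v \<le> a" "a \<le> 2 * v"
    using u_pos[of t] u_le_rate[of t] rate_le_u[of t] assms by (auto simp: a_def v_def)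
  have v': "v * (1 - 1 / Ne) \<le> x * u (Suc t)"
    using mult_left_mono[OF u_Suc_ge[of t], of x] assms by (simp add: v_def mult.assoc)
  have "(rate t)\<^sup>2 * d t * x * x \<le> (rate t)\<^sup>2 * d0 * x * x"
    using Suc.prems[of t] assms by (intro mult_right_mono mult_left_mono) auto
  then have "x * acc d x (Suc t) \<le> (1 - a)\<^sup>2 * (x * acc d x t) + a\<^sup>2 * d0"
    by (simp add: acc_Suc a_def power2_eq_square algebra_simps)
  also have "\<dots> \<le> (1 - a) * (d0 * (2 * v + 2 / Ne)) + a\<^sup>2 * d0"
  proof -
    have "(1 - a)\<^sup>2 * (x * acc d x t) \<le> (1 - a)\<^sup>2 * (d0 * (2 * v + 2 / Ne))"
      using Suc by (intro mult_left_mono) (auto simp: v_def)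
    also have "\<dots> \<le> (1 - a) * (d0 * (2 * v + 2 / Ne))"
      using a v Ne assms mult_left_mono[of "1 - a" 1 "1 - a"]
      by (intro mult_right_mono mult_nonneg_nonneg) (auto simp: power2_eq_square)
    finally show ?thesis by simp
  qed
  also have "\<dots> = d0 * ((1 - a) * (2 * v + 2 / Ne) + a\<^sup>2)" by (simp add: algebra_simps)
  also have "\<dots> \<le> d0 * (2 * (v * (1 - 1 / Ne)) + 2 / Ne)"
  proof (intro mult_left_mono)
    have "a * a \<le> a * (2 * v)" using a v by (intro mult_left_mono) auto
    moreover have "2 * v / Ne \<le> 2 * a / Ne" using v Ne by (simp add: divide_right_mono)
    ultimately show "(1 - a) * (2 * v + 2 / Ne) + a\<^sup>2 \<le> 2 * (v * (1 - 1 / Ne)) + 2 / Ne"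
      by (simp add: power2_eq_square algebra_simps diff_divide_distrib)
  qed (use assms in auto)
  also have "\<dots> \<le> d0 * (2 * (x * u (Suc t)) + 2 / Ne)" using v' assms by (intro mult_left_mono) auto
  finally show ?case .
qed (use assms Ne u_pos in \<open>auto simp: less_imp_le\<close>)

text \<open>At the end of the phase \<open>u\<close> is \<open>g0 / n\<close>, so the first summand
  of the potential has fallen to at most the second.\<close>

lemma acc_le_inverse:
  assumes "0 < x" "g0 * x \<le> 1" "0 \<le> d0" "\<And>s. s < n \<Longrightarrow> d s \<le> d0"
  shows "acc d x n \<le> 4 * d0 / (Ne * x)"
proof -
  have "x * u n \<le> 1 / real n" using assms n2 by (simp add: u_n divide_right_mono mult.commute)
  also have "\<dots> \<le> 1 / Ne" using Ne by (intro divide_left_mono) auto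
  finally have "d0 * (2 * (x * u n) + 2 / Ne) \<le> d0 * (4 / Ne)" using assms by (intro mult_left_mono) auto
  with acc_potential[of x d0 n d] assms have "x * acc d x n \<le> d0 * (4 / Ne)" by fastforce
  then show ?thesis using assms Ne by (simp add: field_simps)
qed

text \<open>Strong directions use the damped bound, with constant 4, weak ones the undamped bound,
  with constant 6 from \<open>rate_sum_le\<close>.\<close>

lemma acc_const_le:
  assumes "0 < x" "g0 * x \<le> 1" "0 \<le> d0" "\<And>s. s < n \<Longrightarrow> 0 \<le> d s" "\<And>s. s < n \<Longrightarrow> d s \<le> d0"
  shows "acc d x n \<le> 6 * d0 / Ne * min (1 / x) (Ne\<^sup>2 * g0\<^sup>2 * x)"
proof -
  have "acc d x n \<le> 4 * (d0 / Ne * (1 / x))" using acc_le_inverse[of x d0 d] assms by simp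
  also have "\<dots> \<le> 6 * (d0 / Ne * (1 / x))" using assms Ne by (intro mult_right_mono) auto
  finally have 1: "acc d x n \<le> 6 * d0 / Ne * (1 / x)" by simp
  have "(\<Sum>s<n. rate s * d s) \<le> (\<Sum>s<n. rate s * d0)"
    using assms rate_nonneg by (intro sum_mono mult_left_mono) auto
  also have "\<dots> = rate_sum n * d0" by (simp add: rate_sum_def sum_distrib_right)
  also have "\<dots> \<le> 6 * (Ne * g0) * d0" using rate_sum_le assms by (intro mult_right_mono) auto
  finally have "x * g0 * (\<Sum>s<n. rate s * d s) \<le> x * g0 * (6 * (Ne * g0) * d0)"
    using assms g0 by (intro mult_left_mono) auto
  then have "acc d x n \<le> x * g0 * (6 * (Ne * g0) * d0)"
    using acc_le_rate_sum[of x n d, OF _ assms(2,4)] assms(1) by linarith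
  also have "\<dots> = 6 * d0 / Ne * (Ne\<^sup>2 * g0\<^sup>2 * x)" using Ne by (simp add: power2_eq_square)
  finally show ?thesis using 1 by (simp add: min_def mult.commute)
qed

end

section \<open>A damped recursion coupled through a weighted sum\<close>

text \<open>Growth of the Lyapunov function over a phase: 5/4 is the growth per unit of
  \<open>rate t / (Ne * g0)\<close> in \<open>V_step\<close>, and 15/2 is 5/4 times the factor 6 of
  \<open>rate_sum_le\<close>.\<close>

definition mass_const :: real where "mass_const = exp (15/2)"

text \<open>Solves the self-bounding inequality of \<open>rate_sum_mult_b_le\<close>; 7/5 inverts
  the 5/7 that remains once 2/7 of the maximum is absorbed.\<close>

definition decay_const :: real where "decay_const = 7/5 * (6 + 4/9 * mass_const)"

text \<open>In \<open>acc_b_le\<close> the early sources contribute \<open>15 * mass_const\<close>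
  and the late ones \<open>16 * decay_const\<close>.\<close>

definition bias_const :: real where "bias_const = 16 * mass_const + 16 * decay_const"

lemma mass_const: "1 \<le> mass_const" by (simp add: mass_const_def)

lemma bias_const: "mass_const \<le> bias_const" "0 \<le> bias_const" "15 * mass_const + 16 * decay_const \<le> bias_const"
  using mass_const by (auto simp: bias_const_def decay_const_def)

text \<open>\<open>p t i\<close> stands for the \<open>i\<close>-th diagonal entry of the bias iterate in the eigenbasis of the
  second moment operator with eigenvalues \<open>m i\<close>; the gradient noise of one coordinate is fed by all
  the others through \<open>b\<close>.\<close>

locale coupled_recursion = halving_steps +
  fixes I :: "nat set" and m :: "nat \<Rightarrow> real" and \<alpha> :: real
    and p :: "nat \<Rightarrow> nat \<Rightarrow> real" and b :: "nat \<Rightarrow> real"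
  assumes alpha: "0 < \<alpha>"
    and m_pos: "\<And>i. i \<in> I \<Longrightarrow> 0 < m i"
    and m_sum: "m summable_on I"
    and small: "\<alpha> * g0 * (\<Sum>\<^sub>\<infinity>i\<in>I. m i) \<le> 1/4"
    and m_small: "\<And>i. i \<in> I \<Longrightarrow> g0 * m i \<le> 1/4"
    and p_nonneg: "\<And>t i. i \<in> I \<Longrightarrow> 0 \<le> p t i"
    and b: "\<And>t. ((\<lambda>i. m i * p t i) has_sum b t) I"
    and rec: "\<And>t i. t < n \<Longrightarrow> i \<in> I \<Longrightarrow>
      p (Suc t) i \<le> (1 - rate t * m i)\<^sup>2 * p t i + (rate t)\<^sup>2 * (\<alpha> * b t) * m i"
begin

text \<open>These are the coefficients of \<open>src_weight\<close> at the optimal head set; in the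
  source phase \<open>V 0\<close> is therefore the weighted squared distance between start and
  optimum.\<close>

definition wt :: "nat \<Rightarrow> real" where
  "wt i = min (1 / (Ne * g0)) (m i)"

definition V :: "nat \<Rightarrow> real" where
  "V t = (\<Sum>\<^sub>\<infinity>i\<in>I. wt i * p t i)"

lemma wt_pos: "i \<in> I \<Longrightarrow> 0 < wt i" and wt_le: "wt i \<le> m i" "wt i \<le> 1 / (Ne * g0)"
  using m_pos g0 Ne by (auto simp: wt_def)

lemma m_nonneg: "i \<in> I \<Longrightarrow> 0 \<le> m i" and wt_nonneg: "i \<in> I \<Longrightarrow> 0 \<le> wt i"
  using m_pos[of i] wt_pos[of i] by auto

lemma b_nonneg: "0 \<le> b t"
  using b[of t] by (rule has_sum_nonneg) (simp add: m_nonneg p_nonneg)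

lemma mp_sum: "(\<lambda>i. m i * p t i) summable_on I"
  using b by (rule has_sum_imp_summable)

lemma wp_sum: "(\<lambda>i. wt i * p t i) summable_on I"
  by (rule summable_on_comparison_test[OF mp_sum[of t]])
     (auto intro!: mult_right_mono mult_nonneg_nonneg wt_le p_nonneg wt_nonneg)

lemma V_nonneg: "0 \<le> V t"
  unfolding V_def by (intro infsum_nonneg mult_nonneg_nonneg wt_nonneg p_nonneg)

lemma wm_sum: "(\<lambda>i. wt i * m i) summable_on I"
  by (rule summable_on_comparison_test[OF summable_on_cmult_right[OF m_sum, of "1 / (Ne * g0)"]])
     (auto simp del: times_divide_eq_left intro!: mult_right_mono mult_nonneg_nonneg wt_le wt_nonneg m_nonneg)

lemma wmp_sum: "(\<lambda>i. wt i * m i * p t i) summable_on I"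
  by (rule summable_on_comparison_test[OF summable_on_cmult_right[OF mp_sum[of t], of "1 / (Ne * g0)"]])
     (auto simp: mult.assoc simp del: times_divide_eq_left
       intro!: mult_right_mono mult_nonneg_nonneg wt_le wt_nonneg m_nonneg p_nonneg)

text \<open>With \<open>D = \<Sum> wt i * m i * p t i\<close> one has \<open>b \<le> Ne g0 D + V\<close>, so the dissipation \<open>D\<close> absorbs
  the noise up to a multiple of \<open>V\<close>.\<close>

lemma V_step:
  assumes t: "t < n"
  shows "V (Suc t) + rate t * b t / (Ne * g0) \<le> (1 + 5/4 * rate t / (Ne * g0)) * V t"
proof -
  define D where "D = (\<Sum>\<^sub>\<infinity>i\<in>I. wt i * m i * p t i)"
  define N where "N = Ne * g0"
  have N: "0 < N" using g0 Ne by (simp add: N_def)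
  have r: "0 \<le> rate t" "rate t \<le> g0" by (rule rate_nonneg, rule rate_le)
  have D0: "0 \<le> D" unfolding D_def
    by (intro infsum_nonneg mult_nonneg_nonneg wt_nonneg m_nonneg p_nonneg)
  have "b t \<le> (\<Sum>\<^sub>\<infinity>i\<in>I. N * (wt i * m i * p t i) + wt i * p t i)"
  proof (rule has_sum_mono[OF b has_sum_infsum])
    show "(\<lambda>i. N * (wt i * m i * p t i) + wt i * p t i) summable_on I"
      by (intro summable_on_add summable_on_cmult_right wmp_sum wp_sum)
    fix i assume i: "i \<in> I"
    \<comment> \<open>Where the minimum in \<open>wt\<close> is \<open>1 / N\<close> the first
      summand equals \<open>m i\<close>, otherwise the second does.\<close>
    have "m i \<le> N * wt i * m i + wt i"
      using N m_pos[OF i] wt_pos[OF i] by (auto simp: wt_def min_def N_def)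
    from mult_right_mono[OF this p_nonneg[OF i, of t]]
    show "m i * p t i \<le> N * (wt i * m i * p t i) + wt i * p t i" by (simp add: algebra_simps)
  qed
  also have "\<dots> = N * D + V t"
    unfolding D_def V_def
    by (subst infsum_add) (auto simp: infsum_cmult_right' intro!: summable_on_cmult_right wmp_sum wp_sum)
  finally have bD: "b t \<le> N * D + V t" .
  have "(\<Sum>\<^sub>\<infinity>i\<in>I. wt i * m i) \<le> (\<Sum>\<^sub>\<infinity>i\<in>I. 1 / N * m i)"
    using wt_le m_pos by (intro infsum_mono wm_sum summable_on_cmult_right m_sum mult_right_mono)
      (auto simp: N_def less_imp_le)
  then have "\<alpha> * rate t * (\<Sum>\<^sub>\<infinity>i\<in>I. wt i * m i) \<le> \<alpha> * rate t * (1 / N * (\<Sum>\<^sub>\<infinity>i\<in>I. m i))"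
    using alpha r by (intro mult_left_mono) (auto simp: infsum_cmult_right' simp del: times_divide_eq_left)
  also have "\<dots> \<le> \<alpha> * g0 * (1 / N * (\<Sum>\<^sub>\<infinity>i\<in>I. m i))"
    using alpha r N by (intro mult_right_mono mult_left_mono mult_nonneg_nonneg infsum_nonneg m_nonneg) auto
  also have "\<dots> \<le> 1 / (4 * N)" using small N by (simp add: field_simps)
  \<comment> \<open>With weights at most \<open>1 / N\<close>, the step-size condition bounds all
    the noise injected in one step by a quarter of \<open>rate t * b t / N\<close>.\<close>
  finally have noise: "\<alpha> * rate t * (\<Sum>\<^sub>\<infinity>i\<in>I. wt i * m i) \<le> 1 / (4 * N)" .
  have "V (Suc t) \<le> V t + (- (7/4 * rate t)) * D + (rate t)\<^sup>2 * (\<alpha> * b t) * (\<Sum>\<^sub>\<infinity>i\<in>I. wt i * m i)"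
    unfolding V_def D_def
  proof (rule has_sum_mono[OF has_sum_infsum[OF wp_sum] has_sum_add[OF has_sum_add[OF
      has_sum_infsum[OF wp_sum] has_sum_cmult_right[OF has_sum_infsum[OF wmp_sum]]]
      has_sum_cmult_right[OF has_sum_infsum[OF wm_sum]]]])
    fix i assume i: "i \<in> I"
    have a: "0 \<le> rate t * m i" "rate t * m i \<le> 1/4"
      using rate_mult_le[of "m i" "1/4" t] m_pos[OF i] m_small[OF i] by auto
    then have "(rate t * m i) * (rate t * m i) \<le> 1/4 * (rate t * m i)" by (intro mult_right_mono) auto
    then have "(1 - rate t * m i)\<^sup>2 \<le> 1 - 7/4 * (rate t * m i)"
      by (simp add: power2_eq_square algebra_simps)
    then have "p (Suc t) i \<le> (1 - 7/4 * (rate t * m i)) * p t i + (rate t)\<^sup>2 * (\<alpha> * b t) * m i"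
      using rec[OF t i] mult_right_mono[of _ _ "p t i"] p_nonneg[OF i, of t] by fastforce
    from mult_left_mono[OF this, of "wt i"] wt_pos[OF i]
    show "wt i * p (Suc t) i \<le> wt i * p t i + (- (7/4 * rate t)) * (wt i * m i * p t i)
      + (rate t)\<^sup>2 * (\<alpha> * b t) * (wt i * m i)"
      by (simp add: algebra_simps)
  qed
  also have "(rate t)\<^sup>2 * (\<alpha> * b t) * (\<Sum>\<^sub>\<infinity>i\<in>I. wt i * m i)
      = rate t * b t * (\<alpha> * rate t * (\<Sum>\<^sub>\<infinity>i\<in>I. wt i * m i))"
    by (simp add: power2_eq_square)
  also have "\<dots> \<le> rate t * b t * (1 / (4 * N))"
    using noise r b_nonneg by (intro mult_left_mono) auto
  finally have 1: "V (Suc t) \<le> V t + (- (7/4 * rate t)) * D + rate t * b t * (1 / (4 * N))" by simp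
  have 2: "rate t * b t / N \<le> rate t * D + rate t / N * V t"
    using mult_left_mono[OF bD, of "rate t / N"] r N by (simp add: algebra_simps)
  have 3: "0 \<le> rate t * D" using r D0 by simp
  \<comment> \<open>In total \<open>rate t * b t / N\<close> occurs with factor 5/4: once from the
    claim and 1/4 from the noise. By \<open>2\<close> it costs 5/4 of \<open>rate t * D\<close>,
    less than the 7/4 that are dissipated.\<close>
  have "(1 + 5/4 * rate t / N) * V t = V t + 5/4 * (rate t / N * V t)" by (simp add: algebra_simps)
  moreover have "rate t * b t * (1 / (4 * N)) = 1/4 * (rate t * b t / N)" by simp
  ultimately show ?thesis unfolding N_def[symmetric] using 1 2 3 by linarith
qed

text \<open>Discrete Gronwall argument for \<open>V\<close> plus the running sum of
  \<open>rate s * b s / N\<close>. The sum may be multiplied by the growth factor as well, since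
  this factor is at least 1.\<close>

lemma sum_rate_b_le: "(\<Sum>t<n. rate t * b t) \<le> mass_const * (Ne * g0) * V 0"
proof -
  define N where "N = Ne * g0"
  have N: "0 < N" using g0 Ne by (simp add: N_def)
  have "V t + (\<Sum>s<t. rate s * b s) / N \<le> exp (5/4 * rate_sum t / N) * V 0" if "t \<le> n" for t
    using that
  proof (induction t)
    case (Suc t)
    define f where "f = 1 + 5/4 * rate t / N"
    have f: "1 \<le> f" using rate_nonneg[of t] N by (simp add: f_def)
    define s where "s = (\<Sum>s<t. rate s * b s) / N"
    have s: "0 \<le> s" using rate_nonneg b_nonneg N by (auto simp: s_def intro!: divide_nonneg_pos sum_nonneg)
    have "V (Suc t) + (\<Sum>s<Suc t. rate s * b s) / N \<le> f * V t + s"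
      using V_step[of t] Suc.prems by (simp add: N_def[symmetric] f_def s_def add_divide_distrib)
    also have "\<dots> \<le> f * (V t + s)" using f s mult_right_mono[OF f s] by (simp add: algebra_simps)
    also have "\<dots> \<le> exp (5/4 * rate t / N) * (exp (5/4 * rate_sum t / N) * V 0)"
      using Suc f s V_nonneg exp_ge_add_one_self[of "5/4 * rate t / N"]
      by (intro mult_mono) (auto simp: f_def s_def)
    also have "\<dots> = exp (5/4 * rate_sum (Suc t) / N) * V 0"
      by (simp add: exp_add[symmetric] rate_sum_Suc add_divide_distrib algebra_simps)
    finally show ?case .
  qed (simp add: rate_sum_0)
  from this[of n] have "(\<Sum>s<n. rate s * b s) / N \<le> exp (5/4 * rate_sum n / N) * V 0"
    using V_nonneg[of n] by simp
  also have "\<dots> \<le> mass_const * V 0"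
  proof (intro mult_right_mono V_nonneg)
    show "exp (5/4 * rate_sum n / N) \<le> mass_const"
      unfolding mass_const_def using rate_sum_le[of n] N by (simp add: N_def[symmetric] divide_le_eq)
  qed
  finally have "(\<Sum>s<n. rate s * b s) \<le> mass_const * V 0 * N" using N by (simp only: pos_divide_le_eq)
  then show ?thesis by (simp add: N_def algebra_simps)
qed

lemma p_le:
  assumes "t \<le> n" "i \<in> I"
  shows "p t i \<le> surv (m i) 0 t * p 0 i + acc (\<lambda>s. \<alpha> * b s) (m i) t"
  using assms(1)
proof (induction t)
  case (Suc t)
  have "p (Suc t) i \<le> (1 - rate t * m i)\<^sup>2 * p t i + (rate t)\<^sup>2 * (\<alpha> * b t) * m i"
    using Suc.prems assms(2) by (intro rec) auto
  also have "\<dots> \<le> (1 - rate t * m i)\<^sup>2 * (surv (m i) 0 t * p 0 i + acc (\<lambda>s. \<alpha> * b s) (m i) t)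
      + (rate t)\<^sup>2 * (\<alpha> * b t) * m i"
    using Suc by (intro add_right_mono mult_left_mono) auto
  also have "\<dots> = surv (m i) 0 (Suc t) * p 0 i + acc (\<lambda>s. \<alpha> * b s) (m i) (Suc t)"
    by (simp add: surv_Suc acc_Suc algebra_simps)
  finally show ?case .
qed simp

text \<open>The sources \<open>s\<close> before the time at which half of the total rate at \<open>t\<close> has elapsed are damped
  and controlled by \<open>sum_rate_b_le\<close>; the contribution of the later ones to the
  maximum of \<open>rate_sum t * b t\<close> is at most 2/7 of that maximum.\<close>

lemma rate_sum_mult_b_le:
  assumes "t \<le> n"
  shows "rate_sum t * b t \<le> decay_const * (Ne * g0) * V 0"
proof -
  define N where "N = Ne * g0"
  have N: "0 < N" using g0 Ne by (simp add: N_def)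
  define W where "W = V 0"
  have W: "0 \<le> W" using V_nonneg by (simp add: W_def)
  define M where "M = Max ((\<lambda>t. rate_sum t * b t) ` {..n})"
  have M: "rate_sum s * b s \<le> M" if "s \<le> n" for s
    unfolding M_def using that by (intro Max_ge) auto
  have M0: "0 \<le> M" using M[of 0] by (simp add: rate_sum_0)
  \<comment> \<open>The first summand is for the early sources, with 16/9 from
    \<open>surv_Suc_le_exp\<close>, the second for the late ones, with 8/7 as twice the 4/7 of
    \<open>acc_le_first_rate\<close>.\<close>
  define L where "L = 16/9 * mass_const * N * W + 8/7 * M"
  have L: "0 \<le> L" using mass_const N W M0 by (simp add: L_def)
  have main: "rate_sum t * b t \<le> 6 * N * W + 1/4 * L" if t: "t \<le> n" for t
  proof -
    have entry: "rate_sum t * (m i * p t i) \<le> 6 * N * (wt i * p 0 i) + \<alpha> * g0 * L * m i" if i: "i \<in> I" for i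
    proof -
      have x: "0 < m i" "g0 * m i \<le> 1/4" using m_pos[OF i] m_small[OF i] by auto
      define G where "G = rate_sum t"
      have G: "0 \<le> G" "G \<le> 6 * N" using rate_sum_nonneg rate_sum_le by (auto simp: G_def N_def)
      have e: "m i * G * exp (- m i * G) \<le> 1"
      proof -
        have "m i * G \<le> exp (m i * G)" using exp_ge_add_one_self[of "m i * G"] by linarith
        then show ?thesis by (simp add: exp_minus divide_le_eq flip: divide_inverse)
      qed
      have s1: "surv (m i) 0 t \<le> 1" using x by (intro surv_le_1) auto
      have "surv (m i) 0 t \<le> exp (- 2 * m i * G)"
        using surv_le_exp[of "m i" 0 t] x by (simp add: G_def rate_sum_0)
      also have "\<dots> \<le> exp (- m i * G)" using x G by simp
      finally have "m i * G * surv (m i) 0 t \<le> m i * G * exp (- m i * G)"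
        using x G by (intro mult_left_mono) auto
      then have "G * m i * surv (m i) 0 t \<le> m i * G * exp (- m i * G)" by (simp only: mult.commute)
      then have "G * m i * surv (m i) 0 t \<le> 1" using e by simp
      moreover have "G * m i * surv (m i) 0 t \<le> 6 * N * m i * 1"
        using s1 G x N surv_nonneg by (intro mult_mono) auto
      \<comment> \<open>The smaller of 1 and \<open>6 * N * m i\<close> is at most
        \<open>6 * N * min (1 / N) (m i)\<close>.\<close>
      ultimately have init: "G * m i * surv (m i) 0 t \<le> 6 * N * wt i"
        using N by (auto simp: wt_def N_def[symmetric] min_def)
      define d1 d2 where "d1 = (\<lambda>s. if 2 * rate_sum s < G then b s else 0)"
        and "d2 = (\<lambda>s. if 2 * rate_sum s < G then 0 else b s)"
      have "acc b (m i) t = acc d1 (m i) t + acc d2 (m i) t"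
        unfolding acc_add[symmetric] by (rule arg_cong[where f="\<lambda>d. acc d (m i) t"]) (auto simp: d1_def d2_def)
      moreover have "G * acc d2 (m i) t \<le> 8/7 * g0 * M"
      proof -
        have "acc (\<lambda>s. G * d2 s) (m i) t \<le> 4/7 * g0 * (2 * M)"
        proof (rule acc_le_first_rate)
          fix s assume "s < t"
          then have "\<not> 2 * rate_sum s < G \<Longrightarrow> G * b s \<le> 2 * rate_sum s * b s"
            using b_nonneg by (intro mult_right_mono) auto
          then show "G * d2 s \<le> 2 * M" using M[of s] M0 \<open>s < t\<close> t by (auto simp: d2_def)
        qed (use x M0 in auto)
        then show ?thesis by (simp add: acc_cmult)
      qed
      moreover have "G * acc d1 (m i) t \<le> 16/9 * g0 * (mass_const * N * W)"
      proof -
        have "G * ((rate s)\<^sup>2 * d1 s * m i * surv (m i) (Suc s) t) \<le> 16/9 * g0 * (rate s * b s)" if s: "s < t" for s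
        proof (cases "2 * rate_sum s < G")
          case True
          have "surv (m i) (Suc s) t \<le> 16/9 * exp (- 2 * m i * (G - rate_sum s))"
            using surv_Suc_le_exp[of "m i" s t] x s by (simp add: G_def)
          \<comment> \<open>More than half of \<open>G\<close> is still to come after an early
            source, so the exponent \<open>2 * m i * (G - rate_sum s)\<close> is at least
            \<open>m i * G\<close>, which pays for the factor \<open>m i * G\<close>.\<close>
          also have "\<dots> \<le> 16/9 * exp (- m i * G)"
            using mult_left_mono[OF less_imp_le[OF True], of "m i"] x by (simp add: algebra_simps)
          finally have "m i * G * surv (m i) (Suc s) t \<le> m i * G * (16/9 * exp (- m i * G))"
            using x G by (intro mult_left_mono) auto
          then have "G * m i * surv (m i) (Suc s) t \<le> 16/9 * (m i * G * exp (- m i * G))"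
            by (simp add: ac_simps)
          with e have k: "G * m i * surv (m i) (Suc s) t \<le> 16/9" by simp
          have "rate s * (rate s * b s) * (G * m i * surv (m i) (Suc s) t) \<le> g0 * (rate s * b s) * (16/9)"
            using k rate_le[of s] rate_nonneg[of s] b_nonneg[of s] g0 G x surv_nonneg by (intro mult_mono) auto
          then show ?thesis using True by (simp add: d1_def power2_eq_square algebra_simps)
        next
          case False
          then show ?thesis using g0 rate_nonneg b_nonneg by (simp add: d1_def)
        qed
        then have "G * acc d1 (m i) t \<le> 16/9 * g0 * (\<Sum>s<t. rate s * b s)"
          unfolding acc_def sum_distrib_left by (intro sum_mono) auto
        also have "(\<Sum>s<t. rate s * b s) \<le> (\<Sum>s<n. rate s * b s)"
          using t rate_nonneg b_nonneg by (intro sum_mono2) auto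
        also have "\<dots> \<le> mass_const * N * W" unfolding N_def W_def by (rule sum_rate_b_le)
        finally show ?thesis using g0 by simp
      qed
      ultimately have acc: "G * acc b (m i) t \<le> g0 * L"
        by (simp add: L_def algebra_simps)
      have "G * (m i * p t i) \<le> G * (m i * (surv (m i) 0 t * p 0 i + acc (\<lambda>s. \<alpha> * b s) (m i) t))"
        using p_le[OF t i] G x by (intro mult_left_mono) auto
      also have "\<dots> = (G * m i * surv (m i) 0 t) * p 0 i + \<alpha> * m i * (G * acc b (m i) t)"
        by (simp add: acc_cmult algebra_simps)
      also have "\<dots> \<le> (6 * N * wt i) * p 0 i + \<alpha> * m i * (g0 * L)"
        using init acc alpha x p_nonneg[OF i] by (intro add_mono mult_right_mono mult_left_mono) auto
      finally show ?thesis by (simp add: G_def algebra_simps)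
    qed
    have "rate_sum t * b t \<le> 6 * N * V 0 + \<alpha> * g0 * L * (\<Sum>\<^sub>\<infinity>i\<in>I. m i)"
      unfolding V_def
      by (rule has_sum_mono[OF has_sum_cmult_right[OF b]
            has_sum_add[OF has_sum_cmult_right[OF has_sum_infsum[OF wp_sum]]
                           has_sum_cmult_right[OF has_sum_infsum[OF m_sum]]]])
         (rule entry)
    moreover have "(\<alpha> * g0 * (\<Sum>\<^sub>\<infinity>i\<in>I. m i)) * L \<le> 1/4 * L" using small L by (intro mult_right_mono)
    ultimately show ?thesis by (simp add: W_def algebra_simps)
  qed
  \<comment> \<open>The maximum is attained, so \<open>main\<close> can be read at \<open>M\<close>
    itself: M is at most (6 + 4/9 \<open>mass_const\<close>) N W + 2/7 M.\<close>
  have "M \<in> (\<lambda>t. rate_sum t * b t) ` {..n}" unfolding M_def by (intro Max_in) auto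
  then have "M \<le> 6 * N * W + 1/4 * L" using main by auto
  then have "5/7 * M \<le> (6 + 4/9 * mass_const) * (N * W)" by (simp add: L_def algebra_simps)
  then have "M \<le> decay_const * N * W" by (simp add: decay_const_def algebra_simps)
  with M[OF assms] show ?thesis by (simp add: N_def W_def)
qed

text \<open>The branch for small \<open>x\<close> needs only the total mass. For
  \<open>1 / x\<close> the sources are split when a quarter of \<open>Ne * g0\<close> has elapsed.
  The later ones are bounded pointwise by \<open>rate_sum_mult_b_le\<close> and treated as constant
  noise. The earlier ones still see a quarter of \<open>Ne * g0\<close>, since the total rate is at
  least half of it, and are damped exponentially.\<close>

lemma acc_b_le:
  assumes x: "0 < x" "g0 * x \<le> 1/4"
  shows "acc b x n \<le> bias_const * V 0 / Ne * min (1 / x) (Ne\<^sup>2 * g0\<^sup>2 * x)"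
proof -
  define N where "N = Ne * g0"
  have N: "0 < N" using g0 Ne by (simp add: N_def)
  define W where "W = V 0"
  have W: "0 \<le> W" using V_nonneg by (simp add: W_def)
  have "acc b x n \<le> x * g0 * (\<Sum>s<n. rate s * b s)"
    using x b_nonneg by (intro acc_le_rate_sum) auto
  also have "\<dots> \<le> x * g0 * (mass_const * N * W)"
    unfolding N_def W_def using x g0 by (intro mult_left_mono sum_rate_b_le) auto
  also have "\<dots> = mass_const * (W / Ne * (Ne\<^sup>2 * g0\<^sup>2 * x))" using Ne by (simp add: N_def power2_eq_square)
  also have "\<dots> \<le> bias_const * (W / Ne * (Ne\<^sup>2 * g0\<^sup>2 * x))"
    using bias_const W Ne x by (intro mult_right_mono) auto
  finally have 1: "acc b x n \<le> bias_const * W / Ne * (Ne\<^sup>2 * g0\<^sup>2 * x)" by simp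
  define d1 d2 where "d1 = (\<lambda>s. if 4 * rate_sum s < N then b s else 0)"
    and "d2 = (\<lambda>s. if 4 * rate_sum s < N then 0 else b s)"
  have "acc b x n = acc d1 x n + acc d2 x n"
    unfolding acc_add[symmetric] by (rule arg_cong[where f="\<lambda>d. acc d x n"]) (auto simp: d1_def d2_def)
  moreover have "acc d2 x n \<le> 4 * (4 * decay_const * W) / (Ne * x)"
  proof (rule acc_le_inverse)
    show "0 \<le> 4 * decay_const * W" using W mass_const by (simp add: decay_const_def)
    fix s assume s: "s < n"
    show "d2 s \<le> 4 * decay_const * W"
    proof (cases "4 * rate_sum s < N")
      case False
      have "N * b s \<le> 4 * rate_sum s * b s" using False b_nonneg by (intro mult_right_mono) auto
      also have "\<dots> \<le> N * (4 * decay_const * W)"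
        using rate_sum_mult_b_le[of s] s by (simp add: N_def W_def algebra_simps)
      finally show ?thesis using N False by (simp add: d2_def)
    qed (use W mass_const in \<open>simp add: d2_def decay_const_def\<close>)
  qed (use x in auto)
  moreover have "acc d1 x n \<le> 15 * mass_const * W / (Ne * x)"
  proof -
    \<comment> \<open>For \<open>y = N * x / 2\<close> this is four times
      \<open>y\<^sup>2 * exp (- y) \<le> 2\<close>, which comes from the quadratic Taylor bound on
      \<open>exp\<close>.\<close>
    have e: "(N * x)\<^sup>2 * exp (- x * N / 2) \<le> 8"
    proof -
      define y where "y = N * x / 2"
      have "0 \<le> y" using N x by (simp add: y_def)
      then have "y\<^sup>2 / 2 \<le> exp y"
        using exp_lower_Taylor_quadratic[of y] by linarith
      then have "y\<^sup>2 * exp (- y) \<le> 2" by (simp add: exp_minus field_simps)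
      moreover have "(N * x)\<^sup>2 = 4 * y\<^sup>2" by (simp add: y_def power2_eq_square)
      moreover have "- x * N / 2 = - y" by (simp add: y_def)
      ultimately show ?thesis by (simp add: mult.commute)
    qed
    have "(rate s)\<^sup>2 * d1 s * x * surv x (Suc s) n \<le> 16/9 * exp (- x * N / 2) * x * g0 * (rate s * b s)" if s: "s < n" for s
    proof (cases "4 * rate_sum s < N")
      case True
      have "N / 4 \<le> rate_sum n - rate_sum s" using rate_sum_n_ge True by (simp add: N_def)
      then have "x * (N / 4) \<le> x * (rate_sum n - rate_sum s)" using x by (intro mult_left_mono) auto
      then have "- 2 * x * (rate_sum n - rate_sum s) \<le> - x * N / 2" by simp
      then have "exp (- 2 * x * (rate_sum n - rate_sum s)) \<le> exp (- x * N / 2)" by (simp only: exp_le_cancel_iff)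
      then have "surv x (Suc s) n \<le> 16/9 * exp (- x * N / 2)"
        using surv_Suc_le_exp[of x s n] x s by linarith
      then have "rate s * (rate s * b s * x) * surv x (Suc s) n \<le> g0 * (rate s * b s * x) * (16/9 * exp (- x * N / 2))"
        using rate_le[of s] rate_nonneg[of s] b_nonneg[of s] g0 x surv_nonneg by (intro mult_mono) auto
      then show ?thesis using True by (simp add: d1_def power2_eq_square algebra_simps)
    next
      case False
      then show ?thesis using g0 x rate_nonneg b_nonneg by (simp add: d1_def)
    qed
    then have "acc d1 x n \<le> 16/9 * exp (- x * N / 2) * x * g0 * (\<Sum>s<n. rate s * b s)"
      unfolding acc_def sum_distrib_left by (intro sum_mono) auto
    also have "\<dots> \<le> 16/9 * exp (- x * N / 2) * x * g0 * (mass_const * N * W)"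
      unfolding N_def W_def using x g0 by (intro mult_left_mono sum_rate_b_le) auto
    \<comment> \<open>Up to \<open>1 / Ne\<close> the mass bound is of the order
      \<open>N\<^sup>2 * x\<close>, that is \<open>(N * x)\<^sup>2 / x\<close>; the exponential
      absorbs the square.\<close>
    also have "\<dots> = 16/9 * mass_const * W / (Ne * x) * ((N * x)\<^sup>2 * exp (- x * N / 2))"
      using x Ne by (simp add: N_def power2_eq_square)
    also have "\<dots> \<le> 16/9 * mass_const * W / (Ne * x) * 8"
      using e mass_const W Ne x by (intro mult_left_mono) auto
    also have "\<dots> = 128/9 * (mass_const * W / (Ne * x))" by simp
    also have "\<dots> \<le> 15 * (mass_const * W / (Ne * x))" using mass_const W Ne x by (intro mult_right_mono) auto
    finally show ?thesis by simp
  qed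
  ultimately have "acc b x n \<le> (15 * mass_const + 16 * decay_const) * (W / (Ne * x))"
    by (simp add: add_divide_distrib algebra_simps)
  also have "\<dots> \<le> bias_const * (W / (Ne * x))" using bias_const W Ne x by (intro mult_right_mono) auto
  finally have "acc b x n \<le> bias_const * W / Ne * (1 / x)" by simp
  with 1 show ?thesis by (simp add: W_def min_def mult.commute)
qed

end

section \<open>Orthonormal bases and diagonal operators\<close>

lemma psd_linear: "psd A \<Longrightarrow> bounded_linear A"
  and psd_sym: "psd A \<Longrightarrow> A v \<bullet> w = v \<bullet> A w"
  and psd_nonneg: "psd A \<Longrightarrow> 0 \<le> v \<bullet> A v"
  by (auto simp: psd_def)

lemma psd_adjoint: "psd A \<Longrightarrow> adjoint A = A"
  by (rule adjoint_unique) (simp add: psd_sym)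

lemma psd_outer: "psd (outer (w::'a::real_inner))"
proof -
  have "bounded_linear (\<lambda>v. (w \<bullet> v) *\<^sub>R w)"
    by (intro bounded_linear_scaleR_left[THEN bounded_linear_compose] bounded_linear_inner_right)
  then show ?thesis by (auto simp: psd_def outer_def inner_commute)
qed

locale hilbert_basis =
  fixes S :: "'a::{real_inner, banach} set" and I :: "nat set" and e :: "nat \<Rightarrow> 'a"
  assumes subS: "subspace S" and closedS: "closed S" and onb: "orthonormal_basis S I e"
begin

lemma e_inner: "i \<in> I \<Longrightarrow> j \<in> I \<Longrightarrow> e i \<bullet> e j = (if i = j then 1 else 0)"
  using onb by (simp add: orthonormal_basis_def)

lemma e_mem: "i \<in> I \<Longrightarrow> e i \<in> S"
proof -
  assume "i \<in> I"
  then have "e i \<in> span (e ` I)" by (auto intro: span_base)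
  then show ?thesis using onb closure_subset by (auto simp: orthonormal_basis_def)
qed

text \<open>Best approximation: a vector \<open>y\<close> of the span near \<open>v\<close> involves
  only a finite set \<open>F\<close> of basis vectors. For every finite \<open>X\<close> containing
  \<open>F\<close> the partial sum is the orthogonal projection of \<open>v\<close> to the span over
  \<open>X\<close>, hence at least as close to \<open>v\<close> as \<open>y\<close>.\<close>

lemma expansion:
  assumes "v \<in> S"
  shows "((\<lambda>i. (e i \<bullet> v) *\<^sub>R e i) has_sum v) I"
  unfolding has_sum_def
proof (rule tendstoI)
  fix \<epsilon> :: real assume "0 < \<epsilon>"
  have "v \<in> closure (span (e ` I))" using assms onb by (simp add: orthonormal_basis_def)
  then obtain y where y: "y \<in> span (e ` I)" "dist y v < \<epsilon>"
    using \<open>0 < \<epsilon>\<close> closure_approachable by blast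
  obtain t where t: "finite t" "t \<subseteq> e ` I" "y \<in> span t"
    using y(1) by (auto simp: span_explicit intro: span_sum span_scale span_base)
  then obtain F where F: "finite F" "F \<subseteq> I" "y \<in> span (e ` F)"
    by (metis finite_subset_image)
  have "dist (\<Sum>i\<in>X. (e i \<bullet> v) *\<^sub>R e i) v < \<epsilon>" if X: "finite X" "F \<subseteq> X" "X \<subseteq> I" for X
  proof -
    define P where "P = (\<Sum>i\<in>X. (e i \<bullet> v) *\<^sub>R e i)"
    have orth_e: "orthogonal (v - P) (e j)" if "j \<in> X" for j
    proof -
      have "P \<bullet> e j = (\<Sum>i\<in>X. if i = j then e i \<bullet> v else 0)"
        unfolding P_def inner_sum_left using X that by (intro sum.cong) (auto simp: e_inner subset_iff)
      also have "\<dots> = e j \<bullet> v" using X that by simp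
      finally show ?thesis by (simp add: orthogonal_def inner_diff_left inner_commute[of v])
    qed
    have orth: "orthogonal (v - P) z" if "z \<in> span (e ` X)" for z
      by (rule orthogonal_to_span[OF that]) (use orth_e in auto)
    have "y \<in> span (e ` X)" using F X span_mono[of "e ` F" "e ` X"] by auto
    moreover have "P \<in> span (e ` X)" unfolding P_def by (intro span_sum span_scale span_base) auto
    ultimately have "orthogonal (v - P) (P - y)" by (intro orth span_diff)
    then have "(norm (v - y))\<^sup>2 = (norm (v - P))\<^sup>2 + (norm (P - y))\<^sup>2"
      using norm_add_Pythagorean[of "v - P" "P - y"] by simp
    then have "norm (v - P) \<le> norm (v - y)"
      by (metis le_add_same_cancel1 norm_ge_zero power2_le_imp_le zero_le_power2)
    then show ?thesis using y(2) by (simp add: P_def dist_norm norm_minus_commute)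
  qed
  then show "\<forall>\<^sub>F X in finite_subsets_at_top I. dist (\<Sum>i\<in>X. (e i \<bullet> v) *\<^sub>R e i) v < \<epsilon>"
    unfolding eventually_finite_subsets_at_top using F by blast
qed

lemma parseval:
  assumes "v \<in> S" shows "((\<lambda>i. (e i \<bullet> v) * (e i \<bullet> w)) has_sum (v \<bullet> w)) I"
  using has_sum_bounded_linear[OF bounded_linear_inner_left expansion[OF assms], of w] by simp

lemma parseval_norm:
  assumes "v \<in> S" shows "((\<lambda>i. (e i \<bullet> v)\<^sup>2) has_sum (norm v)\<^sup>2) I"
  using parseval[OF assms, of v] by (simp add: power2_eq_square dot_square_norm)

lemma has_sum_in_S:
  assumes "(f has_sum v) K" "\<And>i. i \<in> K \<Longrightarrow> f i \<in> S" shows "v \<in> S"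
proof (rule Lim_in_closed_set[OF closedS])
  show "\<forall>\<^sub>F X in finite_subsets_at_top K. sum f X \<in> S"
    unfolding eventually_finite_subsets_at_top
    using assms(2) by (intro exI[of _ "{}"]) (auto intro!: subspace_sum[OF subS])
qed (use assms(1) in \<open>auto simp: has_sum_def\<close>)

lemma spec_op_const:
  assumes "v \<in> S" "K \<subseteq> I"
  shows "((\<lambda>i. a * (e i \<bullet> v)\<^sup>2) has_sum (v \<bullet> spec_op e K (\<lambda>_. a) v)) K"
proof -
  have "(\<lambda>i. (e i \<bullet> v) *\<^sub>R e i) summable_on K"
    using summable_on_subset_banach[OF has_sum_imp_summable[OF expansion[OF assms(1)]] assms(2)] .
  then have "(\<lambda>i. a *\<^sub>R outer (e i) v) summable_on K"
    unfolding outer_def by (rule summable_on_scaleR_right)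
  from has_sum_bounded_linear[OF bounded_linear_inner_right has_sum_infsum[OF this], of v]
  show ?thesis by (simp add: spec_op_def outer_def inner_commute power2_eq_square mult.assoc)
qed

end

locale diagonal_operator = hilbert_basis S I e
  for S :: "'a::{real_inner, banach} set" and I e +
  fixes A :: "'a \<Rightarrow> 'a" and s :: "nat \<Rightarrow> real"
  assumes psdA: "psd A" and eig: "\<And>i. i \<in> I \<Longrightarrow> A (e i) = s i *\<^sub>R e i"
begin

lemma e_inner_A: "i \<in> I \<Longrightarrow> e i \<bullet> A v = s i * (e i \<bullet> v)"
  using psd_sym[OF psdA, of "e i" v] by (simp add: eig)

lemma A_expansion:
  assumes "v \<in> S" shows "((\<lambda>i. (s i * (e i \<bullet> v)) *\<^sub>R e i) has_sum A v) I"
proof -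
  have "((\<lambda>i. A ((e i \<bullet> v) *\<^sub>R e i)) has_sum A v) I"
    by (rule has_sum_bounded_linear[OF psd_linear[OF psdA] expansion[OF assms]])
  also have "?this \<longleftrightarrow> ?thesis"
    by (intro has_sum_cong) (simp add: eig bounded_linear.linear[OF psd_linear[OF psdA], THEN linear_scale])
  finally show ?thesis .
qed

lemma A_mem: "v \<in> S \<Longrightarrow> A v \<in> S"
  using A_expansion by (rule has_sum_in_S) (auto intro: subspace_scale[OF subS] e_mem)

lemma A_quad: 
  assumes "v \<in> S" shows "((\<lambda>i. s i * (e i \<bullet> v)\<^sup>2) has_sum (v \<bullet> A v)) I"
  using has_sum_bounded_linear[OF bounded_linear_inner_right A_expansion[OF assms], of v]
  by (simp add: inner_commute power2_eq_square mult.assoc)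

lemma spec_op_A:
  assumes "v \<in> S" "K \<subseteq> I"
  shows "((\<lambda>i. s i * (e i \<bullet> v)\<^sup>2) has_sum (v \<bullet> spec_op e K s v)) K"
proof -
  have "(\<lambda>i. s i *\<^sub>R outer (e i) v) summable_on K"
    using summable_on_subset_banach[OF has_sum_imp_summable[OF A_expansion[OF assms(1)]] assms(2)]
    by (simp add: outer_def)
  from has_sum_bounded_linear[OF bounded_linear_inner_right has_sum_infsum[OF this], of v]
  show ?thesis by (simp add: spec_op_def outer_def inner_commute power2_eq_square mult.assoc)
qed

lemma head_tail_quad:
  assumes "v \<in> S" "K \<subseteq> I"
  shows "((\<lambda>i. (if i \<in> K then a else s i) * (e i \<bullet> v)\<^sup>2) has_sum sqnorm (head_tail e s I K a) v) I"
proof -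
  have "((\<lambda>i. (if i \<in> K then a else s i) * (e i \<bullet> v)\<^sup>2) has_sum (v \<bullet> spec_op e K (\<lambda>_. a) v)) K"
    using spec_op_const[OF assms, of a] by (rule has_sum_cong[THEN iffD1, rotated]) auto
  moreover have "((\<lambda>i. (if i \<in> K then a else s i) * (e i \<bullet> v)\<^sup>2) has_sum (v \<bullet> spec_op e (I - K) s v)) (I - K)"
    using spec_op_A[OF assms(1), of "I - K"] by (rule has_sum_cong[THEN iffD1, rotated]) auto
  ultimately have "((\<lambda>i. (if i \<in> K then a else s i) * (e i \<bullet> v)\<^sup>2) has_sum sqnorm (head_tail e s I K a) v) (K \<union> (I - K))"
    unfolding sqnorm_def head_tail_def inner_add_right by (rule has_sum_Un_disjoint) auto
  also have "K \<union> (I - K) = I" using assms by auto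
  finally show ?thesis .
qed

end

section \<open>Weighted second moments\<close>

text \<open>The second moment, the noise covariance and the fourth moment operator are the cases
  where the weight is 1, the squared residual and the quadratic form of \<open>A\<close> at
  \<open>x\<close>; positivity and integrability are thus proved once for all three.\<close>

definition weighted_moment :: "('a::{real_inner, banach, second_countable_topology} \<times> real) measure \<Rightarrow>
    ('a \<times> real \<Rightarrow> real) \<Rightarrow> 'a \<Rightarrow> 'a" where
  "weighted_moment D \<phi> v = (\<integral>z. \<phi> z *\<^sub>R outer (fst z) v \<partial>D)"

locale borel_law =
  fixes D :: "('a::{real_inner, banach, second_countable_topology} \<times> real) measure"
  assumes sets_D: "sets D = sets borel"
begin

lemma meas_D: "f \<in> borel_measurable borel \<Longrightarrow> f \<in> borel_measurable D"
  using measurable_cong_sets[OF sets_D refl] by auto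

lemma fst_meas [measurable]: "fst \<in> borel_measurable D" and snd_meas [measurable]: "snd \<in> borel_measurable D"
  by (auto intro!: meas_D borel_measurable_continuous_onI continuous_intros)

lemma moment_integrable:
  assumes [measurable]: "\<phi> \<in> borel_measurable D" and "integrable D (\<lambda>z. \<phi> z * (norm (fst z))\<^sup>2)"
  shows "integrable D (\<lambda>z. \<phi> z * ((fst z \<bullet> v) * (fst z \<bullet> w)))"
    and "integrable D (\<lambda>z. \<phi> z *\<^sub>R outer (fst z) v)"
proof -
  show "integrable D (\<lambda>z. \<phi> z * ((fst z \<bullet> v) * (fst z \<bullet> w)))"
  proof (rule Bochner_Integration.integrable_bound[OF integrable_mult_right[OF assms(2), of "norm v * norm w"]])
    show "AE z in D. norm (\<phi> z * ((fst z \<bullet> v) * (fst z \<bullet> w)))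
        \<le> norm ((norm v * norm w) * (\<phi> z * (norm (fst z))\<^sup>2))"
    proof (rule AE_I2)
      fix z :: "'a \<times> real"
      have "\<bar>fst z \<bullet> v\<bar> * \<bar>fst z \<bullet> w\<bar> \<le> (norm (fst z) * norm v) * (norm (fst z) * norm w)"
        by (intro mult_mono Cauchy_Schwarz_ineq2) auto
      from mult_left_mono[OF this, of "\<bar>\<phi> z\<bar>"]
      show "norm (\<phi> z * ((fst z \<bullet> v) * (fst z \<bullet> w))) \<le> norm ((norm v * norm w) * (\<phi> z * (norm (fst z))\<^sup>2))"
        by (simp add: abs_mult power2_eq_square ac_simps)
    qed
  qed measurable
  show "integrable D (\<lambda>z. \<phi> z *\<^sub>R outer (fst z) v)"
  proof (rule Bochner_Integration.integrable_bound[OF integrable_mult_right[OF assms(2), of "norm v"]])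
    show "AE z in D. norm (\<phi> z *\<^sub>R outer (fst z) v) \<le> norm (norm v * (\<phi> z * (norm (fst z))\<^sup>2))"
    proof (rule AE_I2)
      fix z :: "'a \<times> real"
      have "\<bar>fst z \<bullet> v\<bar> * norm (fst z) \<le> (norm (fst z) * norm v) * norm (fst z)"
        by (intro mult_mono Cauchy_Schwarz_ineq2) auto
      from mult_left_mono[OF this, of "\<bar>\<phi> z\<bar>"]
      show "norm (\<phi> z *\<^sub>R outer (fst z) v) \<le> norm (norm v * (\<phi> z * (norm (fst z))\<^sup>2))"
        by (simp add: outer_def abs_mult power2_eq_square ac_simps)
    qed
  qed (simp add: outer_def)
qed

lemma weighted_moment_inner:
  assumes "\<phi> \<in> borel_measurable D" "integrable D (\<lambda>z. \<phi> z * (norm (fst z))\<^sup>2)"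
  shows "w \<bullet> weighted_moment D \<phi> v = (\<integral>z. \<phi> z * ((fst z \<bullet> v) * (fst z \<bullet> w)) \<partial>D)"
  unfolding weighted_moment_def
  by (subst integral_inner_right[symmetric])
     (use moment_integrable(2)[OF assms] in \<open>auto simp: outer_def inner_commute mult.assoc\<close>)

lemma psd_weighted_moment:
  assumes "\<phi> \<in> borel_measurable D" "integrable D (\<lambda>z. \<phi> z * (norm (fst z))\<^sup>2)" "\<And>z. 0 \<le> \<phi> z"
  shows "psd (weighted_moment D \<phi>)"
proof -
  note int = moment_integrable[OF assms(1,2)]
  have "bounded_linear (weighted_moment D \<phi>)"
  proof
    show "weighted_moment D \<phi> (x + y) = weighted_moment D \<phi> x + weighted_moment D \<phi> y" for x y
      unfolding weighted_moment_def
      by (subst Bochner_Integration.integral_add[OF int(2) int(2), symmetric])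
         (simp add: outer_def inner_add_right scaleR_add_left scaleR_add_right)
    show "weighted_moment D \<phi> (r *\<^sub>R x) = r *\<^sub>R weighted_moment D \<phi> x" for r x
      unfolding weighted_moment_def
      by (subst integral_scaleR_right[symmetric]) (simp add: outer_def mult.left_commute)
    have "norm (weighted_moment D \<phi> x) \<le> norm x * (\<integral>z. \<phi> z * (norm (fst z))\<^sup>2 \<partial>D)" for x
    proof -
      have "norm (weighted_moment D \<phi> x) \<le> (\<integral>z. norm (\<phi> z *\<^sub>R outer (fst z) x) \<partial>D)"
        unfolding weighted_moment_def by (rule integral_norm_bound)
      also have "\<dots> \<le> (\<integral>z. norm x * (\<phi> z * (norm (fst z))\<^sup>2) \<partial>D)"
      proof (rule integral_mono)
        fix z :: "'a \<times> real"
        have "\<bar>fst z \<bullet> x\<bar> * norm (fst z) \<le> (norm (fst z) * norm x) * norm (fst z)"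
          by (intro mult_mono Cauchy_Schwarz_ineq2) auto
        from mult_left_mono[OF this assms(3)[of z]]
        show "norm (\<phi> z *\<^sub>R outer (fst z) x) \<le> norm x * (\<phi> z * (norm (fst z))\<^sup>2)"
          using assms(3)[of z] by (simp add: outer_def abs_mult power2_eq_square ac_simps)
      qed (rule integrable_norm[OF int(2)] integrable_mult_right[OF assms(2)])+
      finally show ?thesis by simp
    qed
    then show "\<exists>K. \<forall>x. norm (weighted_moment D \<phi> x) \<le> norm x * K" by blast
  qed
  moreover have "v \<bullet> weighted_moment D \<phi> w = weighted_moment D \<phi> v \<bullet> w" for v w
    by (simp add: inner_commute[of _ w] weighted_moment_inner[OF assms(1,2)] mult.commute)
  moreover have "0 \<le> v \<bullet> weighted_moment D \<phi> v" for v
    unfolding weighted_moment_inner[OF assms(1,2)]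
    by (intro Bochner_Integration.integral_nonneg mult_nonneg_nonneg[OF assms(3) zero_le_square])
  ultimately show ?thesis by (simp add: psd_def)
qed

end

lemma bounded_linear_borel_measurable:
  fixes A :: "'a::{real_normed_vector, second_countable_topology} \<Rightarrow> 'b::real_normed_vector"
  shows "bounded_linear A \<Longrightarrow> A \<in> borel_measurable borel"
  by (intro borel_measurable_continuous_onI linear_continuous_on)

lemma second_moment_weighted: "second_moment D = weighted_moment D (\<lambda>_. 1)"
  by (simp add: second_moment_def weighted_moment_def fun_eq_iff)

lemma noise_cov_weighted: "noise_cov D w = weighted_moment D (\<lambda>z. (snd z - w \<bullet> fst z)\<^sup>2)"
  by (simp add: noise_cov_def weighted_moment_def fun_eq_iff)

lemma fourth_moment_weighted:
  assumes "linear A" shows "fourth_moment D A = weighted_moment D (\<lambda>z. fst z \<bullet> A (fst z))"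
  by (simp add: fourth_moment_def weighted_moment_def fun_eq_iff outer_def linear_scale[OF assms] mult.commute)

section \<open>One step of stochastic gradient descent\<close>

locale covariates = hilbert_basis S I e
  for S :: "'a::{real_inner, banach, second_countable_topology} set" and I e +
  fixes D :: "('a \<times> real) measure" and s :: "nat \<Rightarrow> real" and \<alpha> \<sigma> :: real and w :: 'a
  assumes law: "data_law S D"
    and eigen: "\<And>i. i \<in> I \<Longrightarrow> second_moment D (e i) = s i *\<^sub>R e i"
    and int4: "integrable D (\<lambda>z. norm (fst z) ^ 4)"
    and fourth: "\<And>A. psd A \<Longrightarrow> loewner_le (fourth_moment D A)
          (\<lambda>v. (\<alpha> * op_trace e I (second_moment D \<circ> A)) *\<^sub>R second_moment D v)"
    and int_noise: "integrable D (\<lambda>z. (snd z - w \<bullet> fst z)\<^sup>2 * (norm (fst z))\<^sup>2)"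
    and noise: "loewner_le (noise_cov D w) (\<lambda>v. \<sigma>\<^sup>2 *\<^sub>R second_moment D v)"
    and alpha: "0 < \<alpha>"

sublocale covariates \<subseteq> prob_space D
  using law by (simp add: data_law_def)

sublocale covariates \<subseteq> borel_law D
  using law by unfold_locales (simp add: data_law_def)

context covariates
begin

abbreviation "G \<equiv> second_moment D"
abbreviation "F \<equiv> fourth_moment D"
abbreviation "T \<equiv> op_trace e I G"

lemma int2: "integrable D (\<lambda>z. (norm (fst z))\<^sup>2)" and AE_S: "AE z in D. fst z \<in> S"
  using law by (auto simp: data_law_def)

lemma G_inner: "v \<bullet> G u = (\<integral>z. (fst z \<bullet> u) * (fst z \<bullet> v) \<partial>D)"
  and psd_G: "psd G"
  and G_integrable: "integrable D (\<lambda>z. (fst z \<bullet> u) * (fst z \<bullet> v))"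
  using weighted_moment_inner[of "\<lambda>_. 1"] psd_weighted_moment[of "\<lambda>_. 1"] moment_integrable(1)[of "\<lambda>_. 1"] int2
  by (auto simp: second_moment_weighted)

lemma noise_psd: "psd (noise_cov D w)"
  and noise_inner: "v \<bullet> noise_cov D w u = (\<integral>z. (snd z - w \<bullet> fst z)\<^sup>2 * ((fst z \<bullet> u) * (fst z \<bullet> v)) \<partial>D)"
  and noise_integrable: "integrable D (\<lambda>z. (snd z - w \<bullet> fst z)\<^sup>2 * ((fst z \<bullet> u) * (fst z \<bullet> v)))"
proof -
  have "(\<lambda>z. (snd z - w \<bullet> fst z)\<^sup>2) \<in> borel_measurable D" by measurable
  note * = this int_noise
  show "psd (noise_cov D w)" "v \<bullet> noise_cov D w u = (\<integral>z. (snd z - w \<bullet> fst z)\<^sup>2 * ((fst z \<bullet> u) * (fst z \<bullet> v)) \<partial>D)"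
    "integrable D (\<lambda>z. (snd z - w \<bullet> fst z)\<^sup>2 * ((fst z \<bullet> u) * (fst z \<bullet> v)))"
    using weighted_moment_inner[OF *] psd_weighted_moment[OF *] moment_integrable(1)[OF *]
    by (auto simp: noise_cov_weighted)
qed

lemma F_facts:
  assumes A: "psd A"
  shows "psd (F A)"
    and "v \<bullet> F A u = (\<integral>z. (fst z \<bullet> A (fst z)) * ((fst z \<bullet> u) * (fst z \<bullet> v)) \<partial>D)"
    and "integrable D (\<lambda>z. (fst z \<bullet> A (fst z)) * ((fst z \<bullet> u) * (fst z \<bullet> v)))"
proof -
  note bl = psd_linear[OF A]
  have [measurable]: "(\<lambda>z. A (fst z)) \<in> borel_measurable D"
    by (rule measurable_compose[OF fst_meas bounded_linear_borel_measurable[OF bl]])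
  have m: "(\<lambda>z. fst z \<bullet> A (fst z)) \<in> borel_measurable D" by measurable
  obtain K where K: "0 < K" "\<And>x. norm (A x) \<le> norm x * K" using bounded_linear.pos_bounded[OF bl] by blast
  have i: "integrable D (\<lambda>z. (fst z \<bullet> A (fst z)) * (norm (fst z))\<^sup>2)"
  proof (rule Bochner_Integration.integrable_bound[OF integrable_mult_right[OF int4, of K]])
    show "AE z in D. norm ((fst z \<bullet> A (fst z)) * (norm (fst z))\<^sup>2) \<le> norm (K * norm (fst z) ^ 4)"
    proof (rule AE_I2)
      fix z :: "'a \<times> real"
      have "\<bar>fst z \<bullet> A (fst z)\<bar> \<le> norm (fst z) * (norm (fst z) * K)"
        using Cauchy_Schwarz_ineq2[of "fst z" "A (fst z)"] mult_left_mono[OF K(2)[of "fst z"], of "norm (fst z)"] by simp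
      from mult_right_mono[OF this, of "(norm (fst z))\<^sup>2"]
      show "norm ((fst z \<bullet> A (fst z)) * (norm (fst z))\<^sup>2) \<le> norm (K * norm (fst z) ^ 4)"
        using K(1) by (simp add: abs_mult power2_eq_square power4_eq_xxxx ac_simps)
    qed
  qed measurable
  show "psd (F A)" "v \<bullet> F A u = (\<integral>z. (fst z \<bullet> A (fst z)) * ((fst z \<bullet> u) * (fst z \<bullet> v)) \<partial>D)"
    "integrable D (\<lambda>z. (fst z \<bullet> A (fst z)) * ((fst z \<bullet> u) * (fst z \<bullet> v)))"
    using weighted_moment_inner[OF m i] psd_weighted_moment[OF m i] moment_integrable(1)[OF m i] psd_nonneg[OF A]
    by (auto simp: fourth_moment_weighted[OF bounded_linear.linear[OF bl]])
qed

end

sublocale covariates \<subseteq> diagonal_operator S I e "second_moment D" s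
  using psd_G eigen by unfold_locales

section \<open>Spectrum and traces of the second moment operator\<close>

context covariates
begin

lemma s_pos: "i \<in> I \<Longrightarrow> 0 < s i"
proof -
  assume i: "i \<in> I"
  have "e i \<noteq> 0" using e_inner[OF i i] by auto
  then have "0 < e i \<bullet> G (e i)" using law e_mem[OF i] by (auto simp: data_law_def)
  then show ?thesis using e_inner[OF i i] by (simp add: eigen i)
qed

lemma s_nonneg: "i \<in> I \<Longrightarrow> 0 \<le> s i"
  using s_pos by (simp add: less_imp_le)

text \<open>Finite sums of eigenvalues are expectations of Bessel sums of \<open>x\<close>, hence at
  most the expectation of its squared norm.\<close>

lemma s_sum: "s summable_on I"
proof (rule nonneg_bdd_above_summable_on)
  show "bdd_above (sum s ` {X. X \<subseteq> I \<and> finite X})"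
  proof (rule bdd_aboveI2)
    fix X assume X: "X \<in> {X. X \<subseteq> I \<and> finite X}"
    have "sum s X = (\<Sum>i\<in>X. \<integral>z. (fst z \<bullet> e i) * (fst z \<bullet> e i) \<partial>D)"
      using X e_inner by (intro sum.cong) (auto simp: G_inner[symmetric] eigen)
    also have "\<dots> = (\<integral>z. (\<Sum>i\<in>X. (fst z \<bullet> e i) * (fst z \<bullet> e i)) \<partial>D)"
      by (rule Bochner_Integration.integral_sum[symmetric]) (rule G_integrable)
    also have "\<dots> \<le> (\<integral>z. (norm (fst z))\<^sup>2 \<partial>D)"
    proof (rule integral_mono_AE)
      show "AE z in D. (\<Sum>i\<in>X. (fst z \<bullet> e i) * (fst z \<bullet> e i)) \<le> (norm (fst z))\<^sup>2"
        using AE_S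
      proof eventually_elim
        case (elim z)
        have "(\<Sum>i\<in>X. (e i \<bullet> fst z)\<^sup>2) \<le> (norm (fst z))\<^sup>2"
          using X by (intro finite_sum_le_has_sum[OF parseval_norm[OF elim]]) auto
        then show ?case by (simp add: inner_commute power2_eq_square)
      qed
    qed (auto intro!: Bochner_Integration.integrable_sum G_integrable int2)
    finally show "sum s X \<le> (\<integral>z. (norm (fst z))\<^sup>2 \<partial>D)" .
  qed
qed (rule s_nonneg)

lemma T_eq: "T = (\<Sum>\<^sub>\<infinity>i\<in>I. s i)"
  unfolding op_trace_def by (rule infsum_cong) (simp add: eigen e_inner)

lemma s_le_T: "i \<in> I \<Longrightarrow> s i \<le> T"
  unfolding T_eq using finite_sum_le_infsum[OF s_sum, of "{i}"] s_nonneg by simp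

lemma T_nonneg: "0 \<le> T"
  unfolding T_eq by (rule infsum_nonneg) (rule s_nonneg)

lemma norm_G_le:
  assumes v: "v \<in> S" shows "(norm (G v))\<^sup>2 \<le> T * (v \<bullet> G v)"
proof (rule has_sum_mono[OF parseval_norm[OF A_mem[OF v]] has_sum_cmult_right[OF A_quad[OF v]]])
  fix i assume i: "i \<in> I"
  have "s i * (s i * (e i \<bullet> v)\<^sup>2) \<le> T * (s i * (e i \<bullet> v)\<^sup>2)"
    using s_le_T[OF i] s_nonneg[OF i] by (intro mult_right_mono) auto
  then show "(e i \<bullet> G v)\<^sup>2 \<le> T * (s i * (e i \<bullet> v)\<^sup>2)"
    by (simp add: e_inner_A[OF i] power2_eq_square ac_simps)
qed

text \<open>A sum that does not converge has the value 0, so \<open>op_trace\<close> is usable in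
  estimates only together with summability. It holds here because \<open>A\<close> is bounded and
  the eigenvalues of \<open>G\<close> are summable.\<close>

lemma trace_has_sum:
  assumes A: "psd A"
  shows "((\<lambda>i. s i * (e i \<bullet> A (e i))) has_sum op_trace e I (G \<circ> A)) I"
proof -
  obtain K where K: "0 < K" "\<And>x. norm (A x) \<le> norm x * K" using bounded_linear.pos_bounded[OF psd_linear[OF A]] by blast
  have "(\<lambda>i. s i * (e i \<bullet> A (e i))) summable_on I"
  proof (rule summable_on_comparison_test[OF summable_on_cmult_right[OF s_sum, of K]])
    fix i assume i: "i \<in> I"
    have n: "norm (e i) = 1" using e_inner[OF i i] by (simp add: norm_eq_sqrt_inner)
    have "e i \<bullet> A (e i) \<le> K" using norm_cauchy_schwarz[of "e i" "A (e i)"] K(2)[of "e i"] n by simp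
    from mult_left_mono[OF this s_nonneg[OF i]] show "s i * (e i \<bullet> A (e i)) \<le> K * s i" by (simp add: mult.commute)
  qed (intro mult_nonneg_nonneg s_nonneg psd_nonneg[OF A])
  then show ?thesis
    unfolding op_trace_def has_sum_iff by (auto intro!: infsum_cong simp: e_inner_A)
qed

lemma trace_nonneg:
  assumes A: "psd A" shows "0 \<le> op_trace e I (G \<circ> A)"
  by (rule has_sum_nonneg[OF trace_has_sum[OF A]]) (intro mult_nonneg_nonneg s_nonneg psd_nonneg[OF A])

text \<open>Jensen's inequality for the square of a coordinate of \<open>x\<close>.\<close>

lemma alpha_ge_1:
  assumes i: "i \<in> I" shows "1 \<le> \<alpha>"
proof -
  define f where "f z = (fst z \<bullet> e i)\<^sup>2" for z :: "'a \<times> real"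
  have f1: "integrable D f" "(\<integral>z. f z \<partial>D) = s i"
    using G_integrable[of "e i" "e i"] G_inner[of "e i" "e i"] eigen[OF i] e_inner[OF i i]
    by (auto simp: f_def[abs_def] power2_eq_square)
  have f2: "integrable D (\<lambda>z. (f z)\<^sup>2)" "(\<integral>z. (f z)\<^sup>2 \<partial>D) = e i \<bullet> F (outer (e i)) (e i)"
    using F_facts(2,3)[OF psd_outer[of "e i"], of "e i" "e i"]
    by (auto simp: f_def[abs_def] power2_eq_square outer_def inner_commute)
  have "0 \<le> (\<integral>z. (f z)\<^sup>2 \<partial>D) - (\<integral>z. f z \<partial>D)\<^sup>2"
    unfolding variance_eq[OF f1(1) f2(1), symmetric] by (rule variance_positive)
  then have "(s i)\<^sup>2 \<le> e i \<bullet> F (outer (e i)) (e i)"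
    by (simp add: f1 f2)
  also have "\<dots> \<le> \<alpha> * op_trace e I (G \<circ> outer (e i)) * s i"
    using fourth[OF psd_outer[of "e i"]] e_inner[OF i i]
    by (auto simp: loewner_le_def eigen[OF i] dest: spec[of _ "e i"])
  also have "op_trace e I (G \<circ> outer (e i)) = s i"
  proof -
    have "((\<lambda>j. s j * (e j \<bullet> outer (e i) (e j))) has_sum s i) {i}"
      by (rule has_sum_finiteI) (auto simp: outer_def e_inner i)
    then have "((\<lambda>j. s j * (e j \<bullet> outer (e i) (e j))) has_sum s i) I"
      by (rule has_sum_cong_neutral[THEN iffD1, rotated -1]) (use i in \<open>auto simp: outer_def e_inner\<close>)
    then show ?thesis using trace_has_sum[OF psd_outer[of "e i"]] by (rule has_sum_unique[symmetric])
  qed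
  finally have "1 * (s i)\<^sup>2 \<le> \<alpha> * (s i)\<^sup>2" by (simp add: power2_eq_square mult.assoc)
  then show ?thesis using s_pos[OF i] by (simp add: mult_le_cancel_right)
qed

subsection \<open>The operator of a step\<close>

lemma sgd_op_inner:
  assumes A: "psd A"
  shows "v \<bullet> sgd_op D g A u = v \<bullet> A u - g * (G v \<bullet> A u + A v \<bullet> G u) + g\<^sup>2 * (v \<bullet> F A u)"
  using psd_sym[OF psd_G, of v] psd_sym[OF A, of v]
  by (simp add: sgd_op_def inner_add_right inner_diff_right)

text \<open>\<open>sgd_op\<close> averages the conjugation of \<open>A\<close> by the random
  symmetric operator \<open>I - g x x^T\<close>. Positivity is visible in this form, and it is the
  form in which the second moment of an SGD step appears.\<close>

lemma sgd_op_integral: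
  assumes A: "psd A"
  shows "v \<bullet> sgd_op D g A u =
      (\<integral>z. (v - (g * (fst z \<bullet> v)) *\<^sub>R fst z) \<bullet> A (u - (g * (fst z \<bullet> u)) *\<^sub>R fst z) \<partial>D)" (is ?int)
    and "integrable D (\<lambda>z. (v - (g * (fst z \<bullet> v)) *\<^sub>R fst z) \<bullet> A (u - (g * (fst z \<bullet> u)) *\<^sub>R fst z))" (is ?able)
proof -
  note lin = bounded_linear.linear[OF psd_linear[OF A]]
  have *: "(v - (g * (fst z \<bullet> v)) *\<^sub>R fst z) \<bullet> A (u - (g * (fst z \<bullet> u)) *\<^sub>R fst z)
      = v \<bullet> A u - g * ((fst z \<bullet> v) * (fst z \<bullet> A u) + (fst z \<bullet> A v) * (fst z \<bullet> u))
        + g\<^sup>2 * ((fst z \<bullet> A (fst z)) * ((fst z \<bullet> u) * (fst z \<bullet> v)))" for z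
    using psd_sym[OF A, of v "fst z"]
    by (simp add: linear_diff[OF lin] linear_scale[OF lin] inner_diff_left inner_diff_right
        power2_eq_square algebra_simps inner_commute)
  show ?able
    unfolding * by (simp add: G_integrable F_facts(3)[OF A])
  have "(\<integral>z. (v - (g * (fst z \<bullet> v)) *\<^sub>R fst z) \<bullet> A (u - (g * (fst z \<bullet> u)) *\<^sub>R fst z) \<partial>D)
      = v \<bullet> A u - g * (A u \<bullet> G v + u \<bullet> G (A v)) + g\<^sup>2 * (v \<bullet> F A u)"
    unfolding * G_inner F_facts(2)[OF A]
    by (simp add: G_integrable F_facts(3)[OF A] prob_space)
  then show ?int
    using psd_sym[OF psd_G, of u "A v"] by (simp add: sgd_op_inner[OF A] inner_commute)
qed

lemma psd_sgd_op:
  assumes A: "psd A" shows "psd (sgd_op D g A)"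
proof -
  have "bounded_linear (sgd_op D g A)"
    unfolding sgd_op_def
    by (intro bounded_linear_add bounded_linear_sub bounded_linear_const_scaleR psd_linear[OF A]
        psd_linear[OF F_facts(1)[OF A]] bounded_linear_compose[OF psd_linear[OF psd_G] psd_linear[OF A]]
        bounded_linear_compose[OF psd_linear[OF A] psd_linear[OF psd_G]])
  moreover have "v \<bullet> sgd_op D g A u = u \<bullet> sgd_op D g A v" for u v
    using psd_sym[OF A] psd_sym[OF F_facts(1)[OF A]]
    by (simp add: sgd_op_inner[OF A] inner_commute algebra_simps)
  moreover have "0 \<le> v \<bullet> sgd_op D g A v" for v
    unfolding sgd_op_integral(1)[OF A] by (intro Bochner_Integration.integral_nonneg psd_nonneg[OF A])
  ultimately show ?thesis by (simp add: psd_def inner_commute)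
qed

text \<open>Conjugation by \<open>contraction g G\<close> differs from the part of
  \<open>sgd_op\<close> without fourth moments by the second-order term
  \<open>g\<^sup>2 * (G v \<bullet> A (G v))\<close>. It is nonnegative and is given away, so that
  the mean step appears as a perfect square.\<close>

lemma sgd_op_le:
  assumes A: "psd A"
  shows "v \<bullet> sgd_op D g A v \<le> contraction g G v \<bullet> A (contraction g G v)
    + g\<^sup>2 * (\<alpha> * op_trace e I (G \<circ> A)) * (v \<bullet> G v)"
proof -
  note lin = bounded_linear.linear[OF psd_linear[OF A]]
  have "v \<bullet> F A v \<le> \<alpha> * op_trace e I (G \<circ> A) * (v \<bullet> G v)"
    using fourth[OF A] by (simp add: loewner_le_def)
  from mult_left_mono[OF this, of "g\<^sup>2"]
  have "v \<bullet> sgd_op D g A v \<le> v \<bullet> A v - g * (G v \<bullet> A v + A v \<bullet> G v)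
      + g\<^sup>2 * (\<alpha> * op_trace e I (G \<circ> A)) * (v \<bullet> G v)"
    by (simp add: sgd_op_inner[OF A] mult.assoc)
  moreover have "contraction g G v \<bullet> A (contraction g G v)
      = v \<bullet> A v - g * (G v \<bullet> A v + A v \<bullet> G v) + g\<^sup>2 * (G v \<bullet> A (G v))"
    using psd_sym[OF A, of v "G v"]
    by (simp add: contraction_def linear_diff[OF lin] linear_scale[OF lin] inner_diff_left inner_diff_right
        power2_eq_square algebra_simps)
  moreover have "0 \<le> g\<^sup>2 * (G v \<bullet> A (G v))" using psd_nonneg[OF A] by simp
  ultimately show ?thesis by linarith
qed

lemma contraction_sym: "contraction g G v \<bullet> u = v \<bullet> contraction g G u"
  using psd_sym[OF psd_G, of v u] by (simp add: contraction_def inner_diff_left inner_diff_right)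

lemma e_inner_contraction: "i \<in> I \<Longrightarrow> e i \<bullet> contraction g G v = (1 - g * s i) * (e i \<bullet> v)"
  by (simp add: contraction_def inner_diff_right e_inner_A algebra_simps)

lemma contraction_mem: "v \<in> S \<Longrightarrow> contraction g G v \<in> S"
  unfolding contraction_def by (intro subspace_diff[OF subS] subspace_scale[OF subS] A_mem)

text \<open>7/4 is the 2 of the first-order term minus the 1/4 that \<open>norm_G_le\<close> and the
  bound on \<open>g * T\<close> allow the second-order term to take back.\<close>

lemma norm_contraction_le:
  assumes "v \<in> S" "0 \<le> g" "g * T \<le> 1/4"
  shows "(norm (contraction g G v))\<^sup>2 \<le> (norm v)\<^sup>2 - 7/4 * g * (v \<bullet> G v)"
proof -
  have q: "0 \<le> g * (v \<bullet> G v)" using psd_nonneg[OF psd_G] assms by simp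
  have "g\<^sup>2 * (norm (G v))\<^sup>2 \<le> g\<^sup>2 * (T * (v \<bullet> G v))" using norm_G_le[OF assms(1)] by (intro mult_left_mono) auto
  also have "\<dots> = (g * T) * (g * (v \<bullet> G v))" by (simp add: power2_eq_square)
  also have "\<dots> \<le> 1/4 * (g * (v \<bullet> G v))" using q assms by (intro mult_right_mono) auto
  finally have "g\<^sup>2 * (norm (G v))\<^sup>2 \<le> 1/4 * (g * (v \<bullet> G v))" .
  moreover have "(norm (contraction g G v))\<^sup>2 = (norm v)\<^sup>2 - 2 * (g * (v \<bullet> G v)) + g\<^sup>2 * (norm (G v))\<^sup>2"
    unfolding power2_norm_eq_inner
    by (simp add: contraction_def inner_diff_left inner_diff_right inner_commute
        power2_eq_square[of g] algebra_simps)
  ultimately show ?thesis by linarith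
qed

end

section \<open>A phase of stochastic gradient descent\<close>

text \<open>The bias iteration has \<open>c = 0\<close>, the variance iteration has \<open>c = 1\<close>.\<close>

locale sgd_phase = covariates S I e D s \<alpha> \<sigma> w + halving_steps n g0
  for S :: "'a::{real_inner, banach, second_countable_topology} set" and I e D s \<alpha> \<sigma> w n g0 +
  fixes A0 :: "'a \<Rightarrow> 'a" and c :: real
  assumes psd_A0: "psd A0" and c: "0 \<le> c" and small: "\<alpha> * g0 * T \<le> 1/4"
begin

primrec moment :: "nat \<Rightarrow> 'a \<Rightarrow> 'a" where
  "moment 0 = A0"
| "moment (Suc t) = (\<lambda>v. sgd_op D (rate t) (moment t) v + (c * (rate t)\<^sup>2) *\<^sub>R noise_cov D w v)"

definition heat :: "nat \<Rightarrow> real" where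
  "heat t = op_trace e I (G \<circ> moment t)"

text \<open>The coefficient of \<open>(rate t)\<^sup>2 * G\<close> in the one-step bound:
  multiplicative gradient noise through the fourth moment, plus label noise.\<close>

definition drive :: "nat \<Rightarrow> real" where
  "drive t = \<alpha> * heat t + c * \<sigma>\<^sup>2"

definition shrink :: "nat \<Rightarrow> 'a \<Rightarrow> 'a" where
  "shrink t = op_prod (\<lambda>t. contraction (rate t) G) t"

lemma psd_moment: "psd (moment t)"
proof (induction t)
  case (Suc t)
  note A = psd_sgd_op[OF Suc, of "rate t"]
  have "bounded_linear (moment (Suc t))"
    by (auto intro!: bounded_linear_add bounded_linear_const_scaleR psd_linear[OF A] psd_linear[OF noise_psd])
  then show ?case
    using psd_sym[OF A] psd_sym[OF noise_psd] psd_nonneg[OF A] psd_nonneg[OF noise_psd] c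
    by (simp add: psd_def inner_add_right inner_add_left)
qed (simp add: psd_A0)

lemma heat_nonneg: "0 \<le> heat t"
  unfolding heat_def by (rule trace_nonneg[OF psd_moment])

lemma heat_has_sum: "((\<lambda>i. s i * (e i \<bullet> moment t (e i))) has_sum heat t) I"
  unfolding heat_def by (rule trace_has_sum[OF psd_moment])

lemma drive_nonneg: "0 \<le> drive t"
  unfolding drive_def using heat_nonneg alpha c by simp

lemma small_eig:
  assumes "i \<in> I" shows "g0 * s i \<le> 1/4"
proof -
  have "g0 * s i \<le> 1 * (g0 * T)" using s_le_T[OF assms] g0 by simp
  also have "\<dots> \<le> \<alpha> * (g0 * T)" using alpha_ge_1[OF assms] T_nonneg g0 by (intro mult_right_mono) auto
  finally show ?thesis using small by simp
qed

lemma moment_Suc_le: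
  "v \<bullet> moment (Suc t) v \<le> contraction (rate t) G v \<bullet> moment t (contraction (rate t) G v)
     + (rate t)\<^sup>2 * drive t * (v \<bullet> G v)"
proof -
  have "v \<bullet> noise_cov D w v \<le> \<sigma>\<^sup>2 * (v \<bullet> G v)" using noise by (simp add: loewner_le_def)
  then have "c * (rate t)\<^sup>2 * (v \<bullet> noise_cov D w v) \<le> c * (rate t)\<^sup>2 * (\<sigma>\<^sup>2 * (v \<bullet> G v))"
    using c by (intro mult_left_mono) auto
  with sgd_op_le[OF psd_moment[of t], of v "rate t"] show ?thesis
    by (simp add: inner_add_right drive_def heat_def algebra_simps)
qed

text \<open>On an eigenvector the mean contraction is a scalar, so the diagonal obeys scalar
  recursions that are coupled only through \<open>drive\<close>.\<close>

lemma diag_Suc_le: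
  assumes i: "i \<in> I"
  shows "e i \<bullet> moment (Suc t) (e i) \<le> (1 - rate t * s i)\<^sup>2 * (e i \<bullet> moment t (e i)) + (rate t)\<^sup>2 * drive t * s i"
proof -
  have "contraction (rate t) G (e i) = (1 - rate t * s i) *\<^sub>R e i"
    by (simp add: contraction_def eigen i algebra_simps)
  then show ?thesis
    using moment_Suc_le[of "e i" t] psd_linear[OF psd_moment[of t], THEN bounded_linear.linear, THEN linear_scale]
    by (simp add: eigen i e_inner power2_eq_square mult.assoc)
qed

lemma diag_le:
  assumes i: "i \<in> I"
  shows "e i \<bullet> moment t (e i) \<le> surv (s i) 0 t * (e i \<bullet> A0 (e i)) + acc drive (s i) t"
proof (induction t)
  case (Suc t)
  have "e i \<bullet> moment (Suc t) (e i)
      \<le> (1 - rate t * s i)\<^sup>2 * (e i \<bullet> moment t (e i)) + (rate t)\<^sup>2 * drive t * s i"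
    by (rule diag_Suc_le[OF i])
  also have "\<dots> \<le> (1 - rate t * s i)\<^sup>2 * (surv (s i) 0 t * (e i \<bullet> A0 (e i)) + acc drive (s i) t)
      + (rate t)\<^sup>2 * drive t * s i"
    using Suc by (intro add_right_mono mult_left_mono) auto
  also have "\<dots> = surv (s i) 0 (Suc t) * (e i \<bullet> A0 (e i)) + acc drive (s i) (Suc t)"
    by (simp add: surv_Suc acc_Suc algebra_simps)
  finally show ?case .
qed simp

lemma acc_drive_nonneg: "i \<in> I \<Longrightarrow> 0 \<le> acc drive (s i) t"
  by (intro acc_nonneg s_nonneg drive_nonneg)

lemma acc_drive_summable:
  assumes v: "v \<in> S" shows "(\<lambda>i. acc drive (s i) t * (e i \<bullet> v)\<^sup>2) summable_on I"
proof (rule summable_on_comparison_test[OF summable_on_cmult_right[OF has_sum_imp_summable[OF A_quad[OF v]],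
        of "g0 * (\<Sum>r<t. rate r * drive r)"]])
  fix i assume i: "i \<in> I"
  have "acc drive (s i) t \<le> s i * g0 * (\<Sum>r<t. rate r * drive r)"
    using s_nonneg[OF i] small_eig[OF i] drive_nonneg by (intro acc_le_rate_sum) auto
  from mult_right_mono[OF this zero_le_power2[of "e i \<bullet> v"]]
  show "acc drive (s i) t * (e i \<bullet> v)\<^sup>2 \<le> g0 * (\<Sum>r<t. rate r * drive r) * (s i * (e i \<bullet> v)\<^sup>2)"
    by (simp add: ac_simps)
qed (simp add: acc_drive_nonneg)

text \<open>A bound at all vectors of \<open>S\<close>, because finetuning evaluates the source
  moment at eigenvectors of another operator. The rank-one part follows the mean contractions
  exactly. The noise part stays diagonal in the eigenbasis of \<open>G\<close>, since both the
  contraction and the injected multiple of \<open>G\<close> are diagonal there.\<close>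

lemma rank_one_le:
  assumes init: "\<And>v. v \<in> S \<Longrightarrow> v \<bullet> A0 v \<le> (v \<bullet> w0)\<^sup>2" and v: "v \<in> S"
  shows "v \<bullet> moment t v \<le> (v \<bullet> shrink t w0)\<^sup>2 + (\<Sum>\<^sub>\<infinity>i\<in>I. acc drive (s i) t * (e i \<bullet> v)\<^sup>2)"
  using v
proof (induction t arbitrary: v)
  case (Suc t)
  define Q where "Q = contraction (rate t) G"
  have "v \<bullet> moment (Suc t) v \<le> Q v \<bullet> moment t (Q v) + (rate t)\<^sup>2 * drive t * (v \<bullet> G v)"
    unfolding Q_def by (rule moment_Suc_le)
  also have "Q v \<bullet> moment t (Q v) \<le> (Q v \<bullet> shrink t w0)\<^sup>2 + (\<Sum>\<^sub>\<infinity>i\<in>I. acc drive (s i) t * (e i \<bullet> Q v)\<^sup>2)"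
    by (rule Suc.IH) (simp add: Q_def contraction_mem Suc.prems)
  also have "Q v \<bullet> shrink t w0 = v \<bullet> shrink (Suc t) w0"
    by (simp add: Q_def shrink_def contraction_sym)
  also have "(v \<bullet> shrink (Suc t) w0)\<^sup>2 + (\<Sum>\<^sub>\<infinity>i\<in>I. acc drive (s i) t * (e i \<bullet> Q v)\<^sup>2) + (rate t)\<^sup>2 * drive t * (v \<bullet> G v)
      = (v \<bullet> shrink (Suc t) w0)\<^sup>2 + (\<Sum>\<^sub>\<infinity>i\<in>I. acc drive (s i) (Suc t) * (e i \<bullet> v)\<^sup>2)"
  proof -
    have "((\<lambda>i. acc drive (s i) t * (e i \<bullet> Q v)\<^sup>2 + (rate t)\<^sup>2 * drive t * (s i * (e i \<bullet> v)\<^sup>2)) has_sum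
        (\<Sum>\<^sub>\<infinity>i\<in>I. acc drive (s i) t * (e i \<bullet> Q v)\<^sup>2) + (rate t)\<^sup>2 * drive t * (v \<bullet> G v)) I"
      by (intro has_sum_add has_sum_infsum acc_drive_summable has_sum_cmult_right A_quad Suc.prems)
         (simp add: Q_def contraction_mem Suc.prems)
    also have "?this \<longleftrightarrow> ((\<lambda>i. acc drive (s i) (Suc t) * (e i \<bullet> v)\<^sup>2) has_sum
        (\<Sum>\<^sub>\<infinity>i\<in>I. acc drive (s i) t * (e i \<bullet> Q v)\<^sup>2) + (rate t)\<^sup>2 * drive t * (v \<bullet> G v)) I"
    proof (rule has_sum_cong)
      show "acc drive (s i) t * (e i \<bullet> Q v)\<^sup>2 + (rate t)\<^sup>2 * drive t * (s i * (e i \<bullet> v)\<^sup>2)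
        = acc drive (s i) (Suc t) * (e i \<bullet> v)\<^sup>2" if "i \<in> I" for i
      unfolding Q_def e_inner_contraction[OF that] acc_Suc power_mult_distrib by (simp add: distrib_right distrib_left ac_simps)
    qed
    finally show ?thesis by (simp only: infsumI add.assoc)
  qed
  finally show ?case by simp
qed (use init in \<open>simp add: shrink_def\<close>)

lemma acc_heat_bias_le:
  assumes "c = 0" and x: "0 < x" "g0 * x \<le> 1/4"
  shows "acc drive x n \<le> bias_const * \<alpha> * (\<Sum>\<^sub>\<infinity>i\<in>I. min (1 / (Ne * g0)) (s i) * (e i \<bullet> A0 (e i))) / Ne
      * min (1 / x) (Ne\<^sup>2 * g0\<^sup>2 * x)"
proof -
  have drive: "drive t = \<alpha> * heat t" for t unfolding drive_def by (simp add: assms(1))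
  interpret coupled_recursion n g0 I s \<alpha> "\<lambda>t i. e i \<bullet> moment t (e i)" heat
  proof unfold_locales
    show "s summable_on I" by (rule s_sum)
    show "\<alpha> * g0 * infsum s I \<le> 1/4" using small by (simp add: T_eq)
    show "e i \<bullet> moment (Suc t) (e i) \<le> (1 - rate t * s i)\<^sup>2 * (e i \<bullet> moment t (e i)) + (rate t)\<^sup>2 * (\<alpha> * heat t) * s i"
      if "i \<in> I" for t i
      using diag_Suc_le[OF that, of t] by (simp only: drive)
  qed (rule alpha s_pos small_eig psd_nonneg[OF psd_moment] heat_has_sum | assumption)+
  have "acc drive x n = \<alpha> * acc heat x n"
    unfolding acc_cmult[symmetric] by (intro arg_cong[where f="\<lambda>d. acc d x n"] ext) (rule drive)
  also have "\<dots> \<le> \<alpha> * (bias_const * V 0 / Ne * min (1 / x) (Ne\<^sup>2 * g0\<^sup>2 * x))"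
    using alpha by (intro mult_left_mono acc_b_le[OF x]) auto
  finally show ?thesis by (simp add: V_def wt_def ac_simps)
qed

text \<open>The multiple \<open>\<epsilon>\<close> of the identity is a supersolution. In the
  direction \<open>v\<close> the contraction releases
  \<open>7/4 * \<epsilon> * r * (v \<bullet> G v)\<close>, while the drive adds at most 5/4 of
  \<open>\<epsilon> * r * (v \<bullet> G v)\<close>: 1/4 by feedback and 1 by label noise.\<close>

lemma moment_le_const:
  assumes init: "\<And>v. v \<in> S \<Longrightarrow> v \<bullet> A0 v \<le> \<epsilon> * (norm v)\<^sup>2" and eps: "0 \<le> \<epsilon>" "c * \<sigma>\<^sup>2 * g0 \<le> \<epsilon>" and v: "v \<in> S"
  shows "v \<bullet> moment t v \<le> \<epsilon> * (norm v)\<^sup>2" and "heat t \<le> \<epsilon> * T"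
proof -
  have heat: "heat t \<le> \<epsilon> * T" if "\<And>v. v \<in> S \<Longrightarrow> v \<bullet> moment t v \<le> \<epsilon> * (norm v)\<^sup>2" for t
    unfolding T_eq
  proof (rule has_sum_mono[OF heat_has_sum has_sum_cmult_right[OF has_sum_infsum[OF s_sum]]])
    fix i assume i: "i \<in> I"
    have "e i \<bullet> moment t (e i) \<le> \<epsilon>"
      using that[OF e_mem[OF i]] e_inner[OF i i] by (simp add: power2_norm_eq_inner)
    from mult_left_mono[OF this s_nonneg[OF i]] show "s i * (e i \<bullet> moment t (e i)) \<le> \<epsilon> * s i"
      by (simp add: mult.commute)
  qed
  have "v \<bullet> moment t v \<le> \<epsilon> * (norm v)\<^sup>2" if "v \<in> S" for t v
    using that
  proof (induction t arbitrary: v)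
    case (Suc t)
    define r where "r = rate t"
    have r: "0 \<le> r" "r \<le> g0" by (simp_all add: r_def rate_nonneg rate_le)
    have q: "0 \<le> v \<bullet> G v" by (rule psd_nonneg[OF psd_G])
    show ?case
    \<comment> \<open>That \<open>\<alpha>\<close> is at least 1 is derived from an eigenvector;
      with no index at all \<open>S\<close> contains only 0.\<close>
    proof (cases "I = {}")
      case True
      then have "v = 0"
        using has_sum_unique[OF expansion[OF Suc.prems], unfolded True, OF has_sum_empty] by simp
      then show ?thesis using psd_linear[OF psd_moment[of "Suc t"]] by simp
    next
      case False
      then have a: "1 \<le> \<alpha>" using alpha_ge_1 by auto
      have gT: "\<alpha> * r * T \<le> 1/4"
        using small alpha mult_right_mono[OF mult_left_mono[OF r(2), of \<alpha>] T_nonneg] by linarith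
      moreover have "1 * (r * T) \<le> \<alpha> * (r * T)" using a r T_nonneg by (intro mult_right_mono) auto
      ultimately have rT: "r * T \<le> 1/4" by simp
      have "r * drive t \<le> 5/4 * \<epsilon>"
      proof -
        have "\<alpha> * r * heat t \<le> \<alpha> * r * (\<epsilon> * T)"
          using heat[of t] Suc.IH alpha r by (intro mult_left_mono) auto
        also have "\<dots> \<le> 1/4 * \<epsilon>" using mult_right_mono[OF gT eps(1)] by (simp add: ac_simps)
        finally have "\<alpha> * r * heat t \<le> 1/4 * \<epsilon>" .
        moreover have "c * \<sigma>\<^sup>2 * r \<le> c * \<sigma>\<^sup>2 * g0" using r c by (intro mult_left_mono) auto
        ultimately show ?thesis using eps by (simp add: drive_def algebra_simps)
      qed
      then have "r * (r * drive t) * (v \<bullet> G v) \<le> r * (5/4 * \<epsilon>) * (v \<bullet> G v)"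
        using r q by (intro mult_right_mono mult_left_mono) auto
      moreover have "v \<bullet> moment (Suc t) v \<le> \<epsilon> * (norm (contraction r G v))\<^sup>2 + r\<^sup>2 * drive t * (v \<bullet> G v)"
        using moment_Suc_le[of v t] Suc.IH[OF contraction_mem[OF Suc.prems], of r] by (simp add: r_def)
      moreover have "\<epsilon> * (norm (contraction r G v))\<^sup>2 \<le> \<epsilon> * ((norm v)\<^sup>2 - 7/4 * r * (v \<bullet> G v))"
        using eps norm_contraction_le[OF Suc.prems r(1) rT] by (intro mult_left_mono)
      moreover have "0 \<le> \<epsilon> * (r * (v \<bullet> G v))" using eps r q by simp
      ultimately show ?thesis by (simp add: power2_eq_square algebra_simps)
    qed
  qed (use init in simp)
  then show "v \<bullet> moment t v \<le> \<epsilon> * (norm v)\<^sup>2" "heat t \<le> \<epsilon> * T" using v heat by auto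
qed

lemma e_inner_shrink:
  assumes "i \<in> I" shows "(e i \<bullet> shrink t v)\<^sup>2 = surv (s i) 0 t * (e i \<bullet> v)\<^sup>2"
  unfolding shrink_def using assms
  by (induction t) (simp_all add: e_inner_contraction surv_Suc power_mult_distrib)

lemma shrink_mem: "v \<in> S \<Longrightarrow> shrink t v \<in> S"
  unfolding shrink_def by (induction t) (simp_all add: contraction_mem)

end

section \<open>Pretraining followed by finetuning\<close>

lemma has_sum_finite_sum:
  fixes F :: "'i \<Rightarrow> 'j \<Rightarrow> 'b::topological_comm_monoid_add"
  assumes "finite B" "\<And>i. i \<in> B \<Longrightarrow> (F i has_sum x i) A"
  shows "((\<lambda>j. \<Sum>i\<in>B. F i j) has_sum (\<Sum>i\<in>B. x i)) A"
  using assms by (induction B rule: finite_induct) (auto intro: has_sum_add)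

text \<open>\<open>cross\<close> pairs each step size with the trace of the other law: source noise
  is measured against the target operator, and the variance bound uses the larger step size in both
  phases.\<close>

locale transfer =
  src: sgd_phase S I e D s \<alpha> \<sigma> w m g0 "outer w0" c +
  tgt: sgd_phase S I f D' l \<alpha> \<sigma> w n g1 "sgd_phase.moment D w m g0 (outer w0) c m" c
  for S :: "'a::{real_inner, banach, second_countable_topology} set"
    and I e D s \<alpha> \<sigma> w m g0 w0 c f D' l n g1 +
  assumes w0: "w0 \<in> S"
    and cross: "\<alpha> * g0 * op_trace f I (second_moment D') \<le> 1/4"
      "\<alpha> * g1 * op_trace e I (second_moment D) \<le> 1/4"
begin

text \<open>The coefficients of the operator in \<open>D_eff_ft\<close> at the optimal head set, and
  the shape of the bounds on \<open>acc\<close>.\<close>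

definition src_gain :: "nat \<Rightarrow> real" where
  "src_gain j = min (1 / s j) (src.Ne\<^sup>2 * g0\<^sup>2 * s j)"

text \<open>The contribution of direction \<open>i\<close> to \<open>D_eff\<close> at the optimal
  head set; it is \<open>l i\<close> times the shape of the bounds on \<open>acc\<close>, see
  \<open>gain_mult\<close>.\<close>

definition tgt_gain :: "nat \<Rightarrow> real" where
  "tgt_gain i = min 1 (tgt.Ne\<^sup>2 * g1\<^sup>2 * (l i)\<^sup>2)"

text \<open>The quadratic form of the squared finetuning contractions times H at \<open>e j\<close>,
  expanded in the eigenbasis of H: what finetuning leaves of unit noise in the source direction
  \<open>j\<close>.\<close>

definition leak :: "nat \<Rightarrow> real" where
  "leak j = (\<Sum>\<^sub>\<infinity>i\<in>I. tgt.surv (l i) 0 n * l i * (f i \<bullet> e j)\<^sup>2)"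

definition src_dim :: real where
  "src_dim = (\<Sum>\<^sub>\<infinity>j\<in>I. src_gain j * leak j)"

definition tgt_dim :: real where
  "tgt_dim = (\<Sum>\<^sub>\<infinity>i\<in>I. tgt_gain i)"

definition src_dist :: real where
  "src_dist = (\<Sum>\<^sub>\<infinity>j\<in>I. min (1 / (src.Ne * g0)) (s j) * (e j \<bullet> w0)\<^sup>2)"

definition tgt_dist :: real where
  "tgt_dist = (\<Sum>\<^sub>\<infinity>i\<in>I. min (1 / (tgt.Ne * g1)) (l i) * (f i \<bullet> src.shrink m w0)\<^sup>2)"

lemma src_gain_nonneg: "j \<in> I \<Longrightarrow> 0 \<le> src_gain j"
  using src.s_nonneg[of j] by (simp add: src_gain_def)

lemma tgt_gain_nonneg: "0 \<le> tgt_gain i"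
  by (simp add: tgt_gain_def)

lemma tgt_gain_sum: "tgt_gain summable_on I"
proof (rule summable_on_comparison_test[OF summable_on_cmult_right[OF tgt.s_sum, of "tgt.Ne\<^sup>2 * g1\<^sup>2 * tgt.T"]])
  fix i assume i: "i \<in> I"
  have "tgt_gain i \<le> tgt.Ne\<^sup>2 * g1\<^sup>2 * (l i * l i)" by (simp add: tgt_gain_def power2_eq_square)
  also have "\<dots> \<le> tgt.Ne\<^sup>2 * g1\<^sup>2 * (tgt.T * l i)"
    using tgt.s_le_T[OF i] tgt.s_nonneg[OF i] by (intro mult_left_mono mult_right_mono) auto
  finally show "tgt_gain i \<le> tgt.Ne\<^sup>2 * g1\<^sup>2 * tgt.T * l i" by (simp add: mult.assoc)
qed (rule tgt_gain_nonneg)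

lemma surv_bounds: "i \<in> I \<Longrightarrow> tgt.surv (l i) 0 n \<le> 1" "0 \<le> tgt.surv (l i) 0 n"
  using tgt.small_eig[of i] tgt.s_nonneg[of i] by (auto intro!: tgt.surv_le_1 tgt.surv_nonneg)

lemma leak_term_nonneg: "i \<in> I \<Longrightarrow> 0 \<le> tgt.surv (l i) 0 n * l i * (f i \<bullet> v)\<^sup>2"
  using surv_bounds(2) tgt.s_nonneg by simp

lemma leak_term_le: "i \<in> I \<Longrightarrow> tgt.surv (l i) 0 n * l i * (f i \<bullet> v)\<^sup>2 \<le> l i * (f i \<bullet> v)\<^sup>2"
  using mult_right_mono[OF surv_bounds(1), of i "l i * (f i \<bullet> v)\<^sup>2"] tgt.s_nonneg[of i] by (simp add: mult.assoc)

lemma leak_sum: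
  assumes "v \<in> S" shows "(\<lambda>i. tgt.surv (l i) 0 n * l i * (f i \<bullet> v)\<^sup>2) summable_on I"
  by (rule summable_on_comparison_test[OF has_sum_imp_summable[OF tgt.A_quad[OF assms]]])
     (auto intro: leak_term_nonneg leak_term_le)

lemma leak_nonneg: "0 \<le> leak j"
  unfolding leak_def by (rule infsum_nonneg) (rule leak_term_nonneg)

lemma leak_le: 
  assumes j: "j \<in> I" shows "leak j \<le> tgt.T"
proof -
  note ej = src.e_mem[OF j]
  have "leak j \<le> e j \<bullet> tgt.G (e j)"
    unfolding leak_def
    by (rule has_sum_mono[OF has_sum_infsum[OF leak_sum[OF ej]] tgt.A_quad[OF ej]]) (rule leak_term_le)
  also have "\<dots> \<le> tgt.T * (norm (e j))\<^sup>2"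
  proof (rule has_sum_mono[OF tgt.A_quad[OF ej] has_sum_cmult_right[OF tgt.parseval_norm[OF ej]]])
    fix i assume "i \<in> I"
    then show "l i * (f i \<bullet> e j)\<^sup>2 \<le> tgt.T * (f i \<bullet> e j)\<^sup>2"
      by (intro mult_right_mono tgt.s_le_T) auto
  qed
  also have "\<dots> = tgt.T" using src.e_inner[OF j j] by (simp add: power2_norm_eq_inner)
  finally show ?thesis .
qed

lemma src_dim_sum: "(\<lambda>j. src_gain j * leak j) summable_on I"
proof (rule summable_on_comparison_test[OF summable_on_cmult_right[OF src.s_sum, of "src.Ne\<^sup>2 * g0\<^sup>2 * tgt.T"]])
  fix j assume j: "j \<in> I"
  have "src_gain j * leak j \<le> (src.Ne\<^sup>2 * g0\<^sup>2 * s j) * tgt.T"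
    using leak_le[OF j] leak_nonneg src_gain_nonneg[OF j] src.s_nonneg[OF j]
    by (intro mult_mono) (auto simp: src_gain_def)
  then show "src_gain j * leak j \<le> src.Ne\<^sup>2 * g0\<^sup>2 * tgt.T * s j" by (simp add: ac_simps)
qed (intro mult_nonneg_nonneg src_gain_nonneg leak_nonneg)

lemma src_dim_nonneg: "0 \<le> src_dim"
  unfolding src_dim_def by (intro infsum_nonneg mult_nonneg_nonneg src_gain_nonneg leak_nonneg)

lemma tgt_dim_nonneg: "0 \<le> tgt_dim"
  unfolding tgt_dim_def by (rule infsum_nonneg) (rule tgt_gain_nonneg)

lemma src_dist_nonneg: "0 \<le> src_dist"
  unfolding src_dist_def using src.g0 src.Ne
  by (intro infsum_nonneg mult_nonneg_nonneg) (auto simp: src.s_nonneg)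

lemma tgt_dist_sum: "(\<lambda>i. min (1 / (tgt.Ne * g1)) (l i) * (f i \<bullet> src.shrink m w0)\<^sup>2) summable_on I"
proof (rule summable_on_comparison_test[OF has_sum_imp_summable[OF tgt.A_quad[OF src.shrink_mem[OF w0]]]])
  show "0 \<le> min (1 / (tgt.Ne * g1)) (l i) * (f i \<bullet> src.shrink m w0)\<^sup>2" if "i \<in> I" for i
    using tgt.g0 tgt.Ne tgt.s_nonneg[OF that] by auto
qed (auto intro: mult_right_mono)

lemma start_le:
  assumes "v \<in> S"
  shows "v \<bullet> src.moment m v \<le> (v \<bullet> src.shrink m w0)\<^sup>2
    + (\<Sum>\<^sub>\<infinity>j\<in>I. src.acc src.drive (s j) m * (e j \<bullet> v)\<^sup>2)"
  by (rule src.rank_one_le[OF _ assms]) (simp add: outer_def power2_eq_square inner_commute)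

text \<open>Shared by bias and variance, with \<open>X\<close> and \<open>Y\<close> as the noise
  levels of the phases. Only finite partial sums of the final trace are estimated, so the sums over
  the two eigenbases are exchanged with one of them finite.\<close>

lemma error_le:
  assumes X: "0 \<le> X" "\<And>j. j \<in> I \<Longrightarrow> src.acc src.drive (s j) m \<le> X * src_gain j"
    and Y: "0 \<le> Y" "\<And>i. i \<in> I \<Longrightarrow> l i * tgt.acc tgt.drive (l i) n \<le> Y * tgt_gain i"
  shows "tgt.heat n \<le> sqnorm tgt.G (tgt.shrink n (src.shrink m w0)) + X * src_dim + Y * tgt_dim"
proof (rule has_sum_le_finite_sums[OF tgt.heat_has_sum])
  fix B assume B: "finite B" "B \<subseteq> I"
  define P where "P = src.shrink m w0"
  define K where "K j = src.acc src.drive (s j) m" for j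
  define q where "q i = tgt.surv (l i) 0 n * l i" for i
  have q: "0 \<le> q i" if "i \<in> I" for i using surv_bounds tgt.s_nonneg that by (simp add: q_def)
  have PS: "P \<in> S" unfolding P_def by (rule src.shrink_mem[OF w0])
  have K_sum: "(\<lambda>j. K j * (e j \<bullet> f i)\<^sup>2) summable_on I" if "i \<in> I" for i
    unfolding K_def by (rule src.acc_drive_summable[OF tgt.e_mem[OF that]])
  have entry: "l i * (f i \<bullet> tgt.moment n (f i)) \<le> q i * (f i \<bullet> P)\<^sup>2
      + q i * (\<Sum>\<^sub>\<infinity>j\<in>I. K j * (e j \<bullet> f i)\<^sup>2) + Y * tgt_gain i" if i: "i \<in> I" for i
  proof -
    have "l i * (f i \<bullet> tgt.moment n (f i))
        \<le> l i * (tgt.surv (l i) 0 n * (f i \<bullet> src.moment m (f i)) + tgt.acc tgt.drive (l i) n)"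
      by (intro mult_left_mono tgt.diag_le i tgt.s_nonneg)
    also have "\<dots> = q i * (f i \<bullet> src.moment m (f i)) + l i * tgt.acc tgt.drive (l i) n"
      by (simp add: q_def algebra_simps)
    also have "\<dots> \<le> q i * ((f i \<bullet> P)\<^sup>2 + (\<Sum>\<^sub>\<infinity>j\<in>I. K j * (e j \<bullet> f i)\<^sup>2)) + Y * tgt_gain i"
      unfolding P_def K_def by (intro add_mono mult_left_mono start_le tgt.e_mem i q Y)
    finally show ?thesis by (simp add: algebra_simps)
  qed
  have 1: "(\<Sum>i\<in>B. q i * (f i \<bullet> P)\<^sup>2) \<le> sqnorm tgt.G (tgt.shrink n P)"
  proof -
    have "((\<lambda>i. q i * (f i \<bullet> P)\<^sup>2) has_sum sqnorm tgt.G (tgt.shrink n P)) I"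
      using tgt.A_quad[OF tgt.shrink_mem[OF PS]] unfolding sqnorm_def
      by (rule has_sum_cong[THEN iffD1, rotated]) (simp add: tgt.e_inner_shrink q_def)
    then show ?thesis using B q by (intro finite_sum_le_has_sum) auto
  qed
  have 2: "(\<Sum>i\<in>B. q i * (\<Sum>\<^sub>\<infinity>j\<in>I. K j * (e j \<bullet> f i)\<^sup>2)) \<le> X * src_dim"
  proof -
    have "((\<lambda>j. \<Sum>i\<in>B. q i * (K j * (e j \<bullet> f i)\<^sup>2)) has_sum (\<Sum>i\<in>B. q i * (\<Sum>\<^sub>\<infinity>j\<in>I. K j * (e j \<bullet> f i)\<^sup>2))) I"
      using B by (intro has_sum_finite_sum has_sum_cmult_right has_sum_infsum K_sum) auto
    moreover have "((\<lambda>j. X * (src_gain j * leak j)) has_sum X * src_dim) I"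
      unfolding src_dim_def by (intro has_sum_cmult_right has_sum_infsum src_dim_sum)
    ultimately show ?thesis
    proof (rule has_sum_mono)
      fix j assume j: "j \<in> I"
      \<comment> \<open>With \<open>j\<close> fixed the source noise factors out and the rest is a
        partial sum of \<open>leak j\<close>.\<close>
      have "(\<Sum>i\<in>B. q i * (K j * (e j \<bullet> f i)\<^sup>2)) = K j * (\<Sum>i\<in>B. tgt.surv (l i) 0 n * l i * (f i \<bullet> e j)\<^sup>2)"
        by (simp add: q_def sum_distrib_left inner_commute ac_simps)
      also have "\<dots> \<le> K j * leak j"
        unfolding leak_def K_def
        using B by (intro mult_left_mono finite_sum_le_infsum leak_sum src.e_mem j src.acc_drive_nonneg)
          (auto intro: leak_term_nonneg)
      also have "\<dots> \<le> (X * src_gain j) * leak j"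
        unfolding K_def by (intro mult_right_mono X(2) j leak_nonneg)
      finally show "(\<Sum>i\<in>B. q i * (K j * (e j \<bullet> f i)\<^sup>2)) \<le> X * (src_gain j * leak j)" by (simp add: mult.assoc)
    qed
  qed
  have 3: "(\<Sum>i\<in>B. Y * tgt_gain i) \<le> Y * tgt_dim"
    unfolding tgt_dim_def sum_distrib_left[symmetric]
    using B Y(1) by (intro mult_left_mono finite_sum_le_infsum tgt_gain_sum) (auto intro: tgt_gain_nonneg)
  have "(\<Sum>i\<in>B. l i * (f i \<bullet> tgt.moment n (f i))) \<le> (\<Sum>i\<in>B. q i * (f i \<bullet> P)\<^sup>2
      + q i * (\<Sum>\<^sub>\<infinity>j\<in>I. K j * (e j \<bullet> f i)\<^sup>2) + Y * tgt_gain i)"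
    using B by (intro sum_mono entry) auto
  with 1 2 3 show "(\<Sum>i\<in>B. l i * (f i \<bullet> tgt.moment n (f i)))
      \<le> sqnorm tgt.G (tgt.shrink n (src.shrink m w0)) + X * src_dim + Y * tgt_dim"
    by (simp add: sum.distrib P_def)
qed

lemma gain_mult: 
  assumes "0 < x" shows "x * min (1 / x) (a * x) = min 1 (a * (x::real)\<^sup>2)"
  using assms by (auto simp: min_def power2_eq_square divide_le_eq field_simps)

text \<open>Finetuning restarts the coupled recursion at the source moment. The initial value
  \<open>W\<close> of its Lyapunov function is at most \<open>tgt_dist\<close> from the transported
  rank-one part plus \<open>\<epsilon> * tgt.T\<close> from the noise handed over.\<close>

lemma bias_error_le:
  assumes c: "c = 0"
  shows "tgt.heat n \<le> sqnorm tgt.G (tgt.shrink n (src.shrink m w0))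
    + bias_const * \<alpha> * src_dist / src.Ne * src_dim
    + bias_const * \<alpha> * (tgt_dist + bias_const / 4 * src_dist) / tgt.Ne * tgt_dim"
proof (rule error_le)
  have nn: "0 \<le> bias_const" "0 \<le> \<alpha>" "0 < src.Ne" "0 < tgt.Ne" "0 < g0" "0 < g1"
    using bias_const src.alpha src.Ne tgt.Ne src.g0 tgt.g0 by auto
  show "0 \<le> bias_const * \<alpha> * src_dist / src.Ne" using nn src_dist_nonneg by simp
  have td: "0 \<le> tgt_dist"
    unfolding tgt_dist_def using nn by (intro infsum_nonneg mult_nonneg_nonneg) (auto simp: tgt.s_nonneg)
  then show "0 \<le> bias_const * \<alpha> * (tgt_dist + bias_const / 4 * src_dist) / tgt.Ne"
    using nn src_dist_nonneg by simp
  have dist: "(\<Sum>\<^sub>\<infinity>i\<in>I. min (1 / (src.Ne * g0)) (s i) * (e i \<bullet> outer w0 (e i))) = src_dist"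
    unfolding src_dist_def by (simp add: outer_def power2_eq_square inner_commute)
  show acc: "src.acc src.drive (s j) m \<le> bias_const * \<alpha> * src_dist / src.Ne * src_gain j" if "j \<in> I" for j
    using src.acc_heat_bias_le[OF c src.s_pos[OF that] src.small_eig[OF that]] by (simp only: dist src_gain_def)
  define \<epsilon> where "\<epsilon> = bias_const * \<alpha> * src_dist * g0"
  have eps: "0 \<le> \<epsilon>" using nn src_dist_nonneg by (simp add: \<epsilon>_def)
  have acc_eps: "src.acc src.drive (s j) m \<le> \<epsilon>" if j: "j \<in> I" for j
  proof -
    \<comment> \<open>A minimum is at most the geometric mean. In \<open>src_gain\<close> the
      product of the two numbers is \<open>(Ne * g0)\<^sup>2\<close>, whatever the eigenvalue, so
      the bound is uniform in \<open>j\<close>.\<close>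
    have "min a b \<le> r" if "0 \<le> b" "a * b = r * r" "0 \<le> r" for a b r :: real
    proof (rule ccontr)
      assume "\<not> min a b \<le> r"
      then have "r < a" "r < b" by auto
      then have "r * r < a * b" using that by (intro mult_strict_mono') auto
      then show False using that by simp
    qed
    then have "src_gain j \<le> src.Ne * g0"
      unfolding src_gain_def using src.s_pos[OF j] nn by (auto simp: power2_eq_square)
    then have "bias_const * \<alpha> * src_dist / src.Ne * src_gain j \<le> bias_const * \<alpha> * src_dist / src.Ne * (src.Ne * g0)"
      using nn src_dist_nonneg by (intro mult_left_mono) auto
    with acc[OF j] nn show ?thesis by (simp add: \<epsilon>_def)
  qed
  have f_start: "f i \<bullet> src.moment m (f i) \<le> (f i \<bullet> src.shrink m w0)\<^sup>2 + \<epsilon>" if i: "i \<in> I" for i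
  proof -
    have "(\<Sum>\<^sub>\<infinity>j\<in>I. src.acc src.drive (s j) m * (e j \<bullet> f i)\<^sup>2) \<le> \<epsilon> * (norm (f i))\<^sup>2"
      by (rule has_sum_mono[OF has_sum_infsum[OF src.acc_drive_summable[OF tgt.e_mem[OF i]]]
            has_sum_cmult_right[OF src.parseval_norm[OF tgt.e_mem[OF i]]]])
         (intro mult_right_mono acc_eps, auto)
    also have "\<dots> = \<epsilon>" using tgt.e_inner[OF i i] by (simp add: power2_norm_eq_inner)
    finally show ?thesis using start_le[OF tgt.e_mem[OF i]] by simp
  qed
  define W where "W = (\<Sum>\<^sub>\<infinity>i\<in>I. min (1 / (tgt.Ne * g1)) (l i) * (f i \<bullet> src.moment m (f i)))"
  have "W \<le> tgt_dist + \<epsilon> * tgt.T"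
    unfolding W_def tgt_dist_def tgt.T_eq infsum_cmult_right'[symmetric]
  proof (subst infsum_add[symmetric])
    show "(\<lambda>i. \<epsilon> * l i) summable_on I" by (intro summable_on_cmult_right tgt.s_sum)
    show "(\<Sum>\<^sub>\<infinity>i\<in>I. min (1 / (tgt.Ne * g1)) (l i) * (f i \<bullet> src.moment m (f i)))
      \<le> (\<Sum>\<^sub>\<infinity>i\<in>I. min (1 / (tgt.Ne * g1)) (l i) * (f i \<bullet> src.shrink m w0)\<^sup>2 + \<epsilon> * l i)"
    proof (intro infsum_mono summable_on_add tgt_dist_sum summable_on_cmult_right tgt.s_sum)
      show "(\<lambda>i. min (1 / (tgt.Ne * g1)) (l i) * (f i \<bullet> src.moment m (f i))) summable_on I"
        by (rule summable_on_comparison_test[OF has_sum_imp_summable[OF tgt.heat_has_sum[of 0]]])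
           (use nn tgt.s_nonneg psd_nonneg[OF src.psd_moment] in \<open>auto intro!: mult_right_mono mult_nonneg_nonneg\<close>)
      fix i assume i: "i \<in> I"
      have wt: "0 \<le> min (1 / (tgt.Ne * g1)) (l i)" using nn tgt.s_nonneg[OF i] by simp
      have "min (1 / (tgt.Ne * g1)) (l i) * (f i \<bullet> src.moment m (f i))
          \<le> min (1 / (tgt.Ne * g1)) (l i) * ((f i \<bullet> src.shrink m w0)\<^sup>2 + \<epsilon>)"
        by (rule mult_left_mono[OF f_start[OF i] wt])
      \<comment> \<open>For the noise handed over the weight is replaced by \<open>l i\<close>, so
        that the sum over \<open>i\<close> produces \<open>tgt.T\<close>.\<close>
      also have "\<dots> \<le> min (1 / (tgt.Ne * g1)) (l i) * (f i \<bullet> src.shrink m w0)\<^sup>2 + \<epsilon> * l i"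
        using mult_right_mono[OF min.cobounded2 eps, of "1 / (tgt.Ne * g1)" "l i"] by (simp add: algebra_simps)
      finally show "min (1 / (tgt.Ne * g1)) (l i) * (f i \<bullet> src.moment m (f i))
        \<le> min (1 / (tgt.Ne * g1)) (l i) * (f i \<bullet> src.shrink m w0)\<^sup>2 + \<epsilon> * l i" .
    qed
  qed (rule tgt_dist_sum)
  also have "\<epsilon> * tgt.T \<le> bias_const / 4 * src_dist"
  proof -
    have "bias_const * src_dist * (\<alpha> * g0 * tgt.T) \<le> bias_const * src_dist * (1/4)"
      using cross nn src_dist_nonneg by (intro mult_left_mono) auto
    then show ?thesis by (simp add: \<epsilon>_def ac_simps)
  qed
  finally have W: "W \<le> tgt_dist + bias_const / 4 * src_dist" by simp
  fix i assume i: "i \<in> I"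
  have "l i * tgt.acc tgt.drive (l i) n
      \<le> l i * (bias_const * \<alpha> * W / tgt.Ne * min (1 / l i) (tgt.Ne\<^sup>2 * g1\<^sup>2 * l i))"
    using tgt.acc_heat_bias_le[OF c tgt.s_pos[OF i] tgt.small_eig[OF i]] tgt.s_nonneg[OF i]
    by (intro mult_left_mono) (simp_all add: W_def)
  also have "\<dots> = bias_const * \<alpha> * W / tgt.Ne * tgt_gain i"
    using gain_mult[OF tgt.s_pos[OF i], of "tgt.Ne\<^sup>2 * g1\<^sup>2"] by (simp add: tgt_gain_def)
  also have "\<dots> \<le> bias_const * \<alpha> * (tgt_dist + bias_const / 4 * src_dist) / tgt.Ne * tgt_gain i"
    using W nn tgt_gain_nonneg by (intro mult_right_mono divide_right_mono mult_left_mono) auto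
  finally show "l i * tgt.acc tgt.drive (l i) n
      \<le> bias_const * \<alpha> * (tgt_dist + bias_const / 4 * src_dist) / tgt.Ne * tgt_gain i" .
qed

lemma var_error_le:
  assumes c: "c = 1" and w0: "w0 = 0"
  shows "tgt.heat n \<le> 15/2 * \<sigma>\<^sup>2 / src.Ne * src_dim + 15/2 * \<sigma>\<^sup>2 / tgt.Ne * tgt_dim"
proof -
  \<comment> \<open>One \<open>\<epsilon>\<close> has to serve both phases, because finetuning
    starts from the bound reached in pretraining; hence the larger of the two step sizes.\<close>
  define \<epsilon> where "\<epsilon> = \<sigma>\<^sup>2 * max g0 g1"
  have pos: "0 < g0" "0 < g1" "0 < src.Ne" "0 < tgt.Ne" using src.g0 tgt.g0 src.Ne tgt.Ne by auto
  have eps: "0 \<le> \<epsilon>" "c * \<sigma>\<^sup>2 * g0 \<le> \<epsilon>" "c * \<sigma>\<^sup>2 * g1 \<le> \<epsilon>"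
    using pos by (auto simp: \<epsilon>_def c intro!: mult_left_mono)
  have small: "\<alpha> * (\<epsilon> * src.T) \<le> 1/4 * \<sigma>\<^sup>2" "\<alpha> * (\<epsilon> * tgt.T) \<le> 1/4 * \<sigma>\<^sup>2"
  proof -
    have "\<alpha> * max g0 g1 * src.T \<le> 1/4" "\<alpha> * max g0 g1 * tgt.T \<le> 1/4"
      using src.small tgt.small cross by (auto simp: max_def)
    from this[THEN mult_left_mono, of "\<sigma>\<^sup>2"]
    show "\<alpha> * (\<epsilon> * src.T) \<le> 1/4 * \<sigma>\<^sup>2" "\<alpha> * (\<epsilon> * tgt.T) \<le> 1/4 * \<sigma>\<^sup>2"
      by (auto simp: \<epsilon>_def ac_simps)
  qed
  \<comment> \<open>\<open>moment_le_const\<close> is stated at a vector of \<open>S\<close>, also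
    where its conclusion concerns \<open>heat\<close>; 0 is such a vector.\<close>
  note z = subspace_0[OF src.subS]
  have s0: "v \<bullet> outer w0 v \<le> \<epsilon> * (norm v)\<^sup>2" for v using eps by (simp add: w0 outer_def)
  note src_le = src.moment_le_const[OF s0 eps(1,2)]
  note tgt_le = tgt.moment_le_const[OF src_le(1) eps(1,3)]
  have drive: "src.drive t \<le> 5/4 * \<sigma>\<^sup>2" "tgt.drive t \<le> 5/4 * \<sigma>\<^sup>2" for t
  proof -
    have cs: "c * \<sigma>\<^sup>2 = \<sigma>\<^sup>2" by (simp add: c)
    have "src.heat t \<le> \<epsilon> * src.T" "tgt.heat t \<le> \<epsilon> * tgt.T"
      using src_le(2)[OF z] tgt_le(2)[OF _ z] by blast+
    from this[THEN mult_left_mono, of \<alpha>] small src.alpha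
    show "src.drive t \<le> 5/4 * \<sigma>\<^sup>2" "tgt.drive t \<le> 5/4 * \<sigma>\<^sup>2"
      unfolding src.drive_def tgt.drive_def cs by linarith+
  qed
  have "tgt.heat n \<le> sqnorm tgt.G (tgt.shrink n (src.shrink m w0))
      + 15/2 * \<sigma>\<^sup>2 / src.Ne * src_dim + 15/2 * \<sigma>\<^sup>2 / tgt.Ne * tgt_dim"
  proof (rule error_le)
    \<comment> \<open>15/2 is the factor 6 of \<open>acc_const_le\<close> times the bound 5/4 on the
      drive.\<close>
    show "src.acc src.drive (s j) m \<le> 15/2 * \<sigma>\<^sup>2 / src.Ne * src_gain j" if j: "j \<in> I" for j
      using src.acc_const_le[of "s j" "5/4 * \<sigma>\<^sup>2" src.drive] src.s_pos[OF j] src.small_eig[OF j]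
        drive src.drive_nonneg by (simp add: src_gain_def)
    fix i assume i: "i \<in> I"
    have "tgt.acc tgt.drive (l i) n \<le> 15/2 * \<sigma>\<^sup>2 / tgt.Ne * min (1 / l i) (tgt.Ne\<^sup>2 * g1\<^sup>2 * l i)"
      using tgt.acc_const_le[of "l i" "5/4 * \<sigma>\<^sup>2" tgt.drive] tgt.s_pos[OF i] tgt.small_eig[OF i]
        drive tgt.drive_nonneg by simp
    from mult_left_mono[OF this tgt.s_nonneg[OF i]]
    have "l i * tgt.acc tgt.drive (l i) n
        \<le> 15/2 * \<sigma>\<^sup>2 / tgt.Ne * (l i * min (1 / l i) (tgt.Ne\<^sup>2 * g1\<^sup>2 * l i))"
      by (simp only: mult.left_commute)
    then show "l i * tgt.acc tgt.drive (l i) n \<le> 15/2 * \<sigma>\<^sup>2 / tgt.Ne * tgt_gain i"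
      unfolding gain_mult[OF tgt.s_pos[OF i]] tgt_gain_def .
  qed (use pos in auto)
  moreover have "tgt.shrink n (src.shrink m w0) = 0"
  proof -
    have "(norm (src.shrink m w0))\<^sup>2 = 0" 
      using src.parseval_norm[OF src.shrink_mem[OF transfer.w0[OF transfer_axioms]], of m] 
      by (rule has_sum_unique) (simp add: w0 src.e_inner_shrink cong: has_sum_cong)
    moreover from this have "src.shrink m w0 = 0" by simp
    moreover have "(norm (tgt.shrink n 0))\<^sup>2 = 0" 
      using tgt.parseval_norm[OF tgt.shrink_mem[OF z], of n] 
      by (rule has_sum_unique) (simp add: tgt.e_inner_shrink cong: has_sum_cong)
    ultimately show ?thesis by simp
  qed
  ultimately show ?thesis by (simp add: sqnorm_def)
qed

end

section \<open>Expected error of the iterates\<close>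

text \<open>The error of the iterates splits into a path started at the initial error without noise
  (\<open>c = 0\<close>) and a path started at 0 and driven by the noise (\<open>c = 1\<close>). Only the latter has mean
  zero, which is what removes the cross terms between \<open>x\<close> and the noise.\<close>

primrec error_path :: "(nat \<Rightarrow> real) \<Rightarrow> 'a \<Rightarrow> real \<Rightarrow> 'a \<Rightarrow> (nat \<Rightarrow> 'a::real_inner \<times> real) \<Rightarrow> nat \<Rightarrow> 'a" where
  "error_path g w c w0 z 0 = w0"
| "error_path g w c w0 z (Suc t) = error_path g w c w0 z t
     - (g t * (fst (z (Suc t)) \<bullet> error_path g w c w0 z t)) *\<^sub>R fst (z (Suc t))
     + (c * g t * (snd (z (Suc t)) - w \<bullet> fst (z (Suc t)))) *\<^sub>R fst (z (Suc t))"

text \<open>The error recursion is affine, so the effects of the initial error and of the noise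
  superpose.\<close>

lemma sgd_error_split:
  "sgd p z t - wstar p = error_path (step p) (wstar p) 0 (w_init - wstar p) z t
     + error_path (step p) (wstar p) 1 0 z t"
proof (induction t)
  case (Suc t)
  define b h where "b = error_path (step p) (wstar p) 0 (w_init - wstar p) z t"
    and "h = error_path (step p) (wstar p) 1 0 z t"
  have "sgd p z t = wstar p + b + h" using Suc by (simp add: b_def h_def algebra_simps)
  then show ?case
    by (simp add: b_def[symmetric] h_def[symmetric] outer_def inner_add_right inner_commute algebra_simps)
qed simp

lemma error_path_cong:
  assumes "\<And>i. 1 \<le> i \<Longrightarrow> i \<le> t \<Longrightarrow> z i = z' i"
  shows "error_path g w c w0 z t = error_path g w c w0 z' t"
  using assms by (induction t) auto

lemma error_path_measurable:
  fixes w0 :: "'a::{real_inner, banach, second_countable_topology}"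
  assumes "{1..t} \<subseteq> A"
  shows "(\<lambda>z. error_path g w c w0 z t) \<in> borel_measurable (PiM A (\<lambda>_. borel))"
  using assms
proof (induction t)
  case (Suc t)
  then have [measurable]: "(\<lambda>z. error_path g w c w0 z t) \<in> borel_measurable (PiM A (\<lambda>_. borel))"
    by (intro Suc.IH) auto
  have "(\<lambda>z. z (Suc t)) \<in> measurable (PiM A (\<lambda>_. borel)) (borel :: ('a \<times> real) measure)"
    using Suc.prems by (intro measurable_component_singleton) auto
  then have *: "(\<lambda>z. z (Suc t)) \<in> measurable (PiM A (\<lambda>_. borel)) (borel \<Otimes>\<^sub>M borel :: ('a \<times> real) measure)"
    by (simp add: borel_prod)
  note [measurable] = measurable_compose[OF * measurable_fst] measurable_compose[OF * measurable_snd]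
  show ?case by simp
qed simp

section \<open>Residuals, optimality and the evolution of second moments\<close>

context covariates
begin

text \<open>The normal equations of least squares, tested on \<open>S\<close>.\<close>

definition centered :: bool where
  "centered \<longleftrightarrow> (\<forall>v\<in>S. (\<integral>z. (snd z - w \<bullet> fst z) * (fst z \<bullet> v) \<partial>D) = 0)"

lemma noise1_integrable: "integrable D (\<lambda>z. (snd z - w \<bullet> fst z)\<^sup>2)"
  and noise_cross_integrable: "integrable D (\<lambda>z. (snd z - w \<bullet> fst z) * (fst z \<bullet> v))"
proof -
  have y2: "integrable D (\<lambda>z. (snd z)\<^sup>2)" using law by (simp add: data_law_def)
  have wx: "integrable D (\<lambda>z. (fst z \<bullet> w)\<^sup>2)" for w
    using G_integrable[of w w] by (simp add: power2_eq_square)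
  show n: "integrable D (\<lambda>z. (snd z - w \<bullet> fst z)\<^sup>2)"
  proof (rule Bochner_Integration.integrable_bound)
    show "integrable D (\<lambda>z. 2 * (snd z)\<^sup>2 + 2 * (fst z \<bullet> w)\<^sup>2)" using y2 wx by simp
    show "AE z in D. norm ((snd z - w \<bullet> fst z)\<^sup>2) \<le> norm (2 * (snd z)\<^sup>2 + 2 * (fst z \<bullet> w)\<^sup>2)"
    proof (rule AE_I2)
      fix z :: "'a \<times> real"
      show "norm ((snd z - w \<bullet> fst z)\<^sup>2) \<le> norm (2 * (snd z)\<^sup>2 + 2 * (fst z \<bullet> w)\<^sup>2)"
        using zero_le_power2[of "snd z + w \<bullet> fst z"] zero_le_power2[of "snd z - w \<bullet> fst z"]
        by (simp add: power2_eq_square inner_commute algebra_simps)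
    qed
  qed measurable
  show "integrable D (\<lambda>z. (snd z - w \<bullet> fst z) * (fst z \<bullet> v))"
  proof (rule Bochner_Integration.integrable_bound)
    show "integrable D (\<lambda>z. (snd z - w \<bullet> fst z)\<^sup>2 + (fst z \<bullet> v)\<^sup>2)" using n wx by simp
    show "AE z in D. norm ((snd z - w \<bullet> fst z) * (fst z \<bullet> v)) \<le> norm ((snd z - w \<bullet> fst z)\<^sup>2 + (fst z \<bullet> v)\<^sup>2)"
    proof (rule AE_I2)
      fix z :: "'a \<times> real"
      have "2 * \<bar>a * b\<bar> \<le> a\<^sup>2 + b\<^sup>2" for a b :: real
        using sum_squares_bound[of "\<bar>a\<bar>" "\<bar>b\<bar>"] by (simp add: abs_mult)
      from this[of "snd z - w \<bullet> fst z" "fst z \<bullet> v"]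
      show "norm ((snd z - w \<bullet> fst z) * (fst z \<bullet> v)) \<le> norm ((snd z - w \<bullet> fst z)\<^sup>2 + (fst z \<bullet> v)\<^sup>2)"
        by simp
    qed
  qed measurable
qed

lemma risk_diff:
  "risk D (w + v) - risk D w = 1/2 * (v \<bullet> G v) - (\<integral>z. (snd z - w \<bullet> fst z) * (fst z \<bullet> v) \<partial>D)"
proof -
  have *: "(snd z - (w + v) \<bullet> fst z)\<^sup>2 = (snd z - w \<bullet> fst z)\<^sup>2
      - 2 * ((snd z - w \<bullet> fst z) * (fst z \<bullet> v)) + (fst z \<bullet> v) * (fst z \<bullet> v)" for z :: "'a \<times> real"
    by (simp add: power2_eq_square inner_add_left inner_commute algebra_simps)
  show ?thesis
    unfolding risk_def * G_inner
    by (simp add: noise1_integrable noise_cross_integrable G_integrable diff_divide_distrib add_divide_distrib)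
qed

text \<open>First-order optimality: \<open>\<tau> v\<close> with \<open>\<tau>\<close> minimizing the quadratic \<open>risk (w + \<tau> v)\<close>.\<close>

lemma centered_if_minimizer:
  assumes "is_arg_min (risk D) (\<lambda>w. w \<in> S) w"
  shows centered
  unfolding centered_def
proof
  fix v assume v: "v \<in> S"
  define a where "a = (\<integral>z. (snd z - w \<bullet> fst z) * (fst z \<bullet> v) \<partial>D)"
  have opt: "0 \<le> 1/2 * \<tau>\<^sup>2 * (v \<bullet> G v) - \<tau> * a" for \<tau>
  proof -
    have "w + \<tau> *\<^sub>R v \<in> S"
      using assms v by (intro subspace_add[OF subS] subspace_scale[OF subS]) (auto simp: is_arg_min_def)
    then have "0 \<le> risk D (w + \<tau> *\<^sub>R v) - risk D w" using assms by (auto simp: is_arg_min_def not_less)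
    also have "\<dots> = 1/2 * \<tau>\<^sup>2 * (v \<bullet> G v) - \<tau> * a"
      unfolding risk_diff a_def
      using linear_scale[OF bounded_linear.linear[OF psd_linear[OF psd_G]], of \<tau> v]
      by (simp add: power2_eq_square mult.left_commute)
    finally show ?thesis .
  qed
  show "a = 0"
  proof (cases "v = 0")
    case False
    then have q: "0 < v \<bullet> G v" using law v by (auto simp: data_law_def)
    define q where "q = v \<bullet> G v"
    have "0 \<le> 1/2 * (a / q)\<^sup>2 * q - a / q * a" using opt[of "a / q"] by (simp add: q_def)
    also have "\<dots> = - (a\<^sup>2 / (2 * q))" using q by (simp add: q_def[symmetric] power2_eq_square field_simps)
    finally have "a\<^sup>2 / (2 * q) \<le> 0" by simp
    then show ?thesis using q by (simp add: q_def[symmetric] divide_le_0_iff)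
  qed (simp add: a_def)
qed

lemma excess_eq:
  assumes centered "v \<in> S"
  shows "risk D (w + v) - risk D w = 1/2 * (v \<bullet> G v)"
  using assms by (simp add: risk_diff centered_def)

text \<open>One step preserves the invariant of a path: square integrability, values in
  \<open>S\<close>, mean zero and second moment \<open>A\<close>, the last two tested on
  \<open>S\<close>. Independence enters as the product law \<open>ind\<close>, so that expectations
  can be iterated, first over \<open>X\<close> and then over the observation.
  \<open>c * c = c\<close> covers the values 0 and 1 at once, and the factor \<open>c\<close> voids
  the mean condition for the path without noise.\<close>

lemma process_step:
  fixes M :: "'w measure" and g c :: real and X :: "'w \<Rightarrow> 'a" and Z :: "'w \<Rightarrow> 'a \<times> real"
  assumes M: "prob_space M" and Zm: "Z \<in> measurable M borel" and Xm: "X \<in> borel_measurable M" and dist: "distr M borel Z = D"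
    and ind: "D \<Otimes>\<^sub>M distr M borel X = distr M (borel \<Otimes>\<^sub>M borel) (\<lambda>\<omega>. (Z \<omega>, X \<omega>))"
    and X2: "integrable M (\<lambda>\<omega>. (norm (X \<omega>))\<^sup>2)" and XS: "AE \<omega> in M. X \<omega> \<in> S"
    and mean: "\<And>v. v \<in> S \<Longrightarrow> c * (\<integral>\<omega>. X \<omega> \<bullet> v \<partial>M) = 0"
    and second: "\<And>u v. u \<in> S \<Longrightarrow> v \<in> S \<Longrightarrow> (\<integral>\<omega>. (X \<omega> \<bullet> v) * (X \<omega> \<bullet> u) \<partial>M) = v \<bullet> A u"
    and A: "psd A" and cent: centered and cc: "c * c = c"
  defines "X' \<equiv> (\<lambda>\<omega>. X \<omega> - (g * (fst (Z \<omega>) \<bullet> X \<omega>)) *\<^sub>R fst (Z \<omega>)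
      + (c * g * (snd (Z \<omega>) - w \<bullet> fst (Z \<omega>))) *\<^sub>R fst (Z \<omega>))"
  shows "integrable M (\<lambda>\<omega>. (norm (X' \<omega>))\<^sup>2)"
    and "AE \<omega> in M. X' \<omega> \<in> S"
    and "\<And>v. v \<in> S \<Longrightarrow> c * (\<integral>\<omega>. X' \<omega> \<bullet> v \<partial>M) = 0"
    and "\<And>u v. u \<in> S \<Longrightarrow> v \<in> S \<Longrightarrow>
      (\<integral>\<omega>. (X' \<omega> \<bullet> v) * (X' \<omega> \<bullet> u) \<partial>M) = v \<bullet> (sgd_op D g A u + (c * g\<^sup>2) *\<^sub>R noise_cov D w u)"
proof -
  interpret M: prob_space M by (rule M)
  note [measurable] = Xm
  have Zp: "Z \<in> measurable M (borel \<Otimes>\<^sub>M borel)" using Zm by (simp add: borel_prod)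
  have [measurable]: "(\<lambda>\<omega>. fst (Z \<omega>)) \<in> borel_measurable M" "(\<lambda>\<omega>. snd (Z \<omega>)) \<in> borel_measurable M"
    using measurable_compose[OF Zp measurable_fst] measurable_compose[OF Zp measurable_snd] by auto
  define N where "N = distr M borel X"
  interpret N: prob_space N unfolding N_def by (rule M.prob_space_distr) simp
  interpret DN: pair_prob_space D N ..
  have pair: "D \<Otimes>\<^sub>M N = distr M (borel \<Otimes>\<^sub>M borel) (\<lambda>\<omega>. (Z \<omega>, X \<omega>))"
    unfolding N_def by (rule ind)
  have ZX [measurable]: "(\<lambda>\<omega>. (Z \<omega>, X \<omega>)) \<in> measurable M (borel \<Otimes>\<^sub>M borel)"
    by (rule measurable_Pair[OF Zm Xm])
  have intD: "integrable M (\<lambda>\<omega>. f (Z \<omega>)) \<longleftrightarrow> integrable D f"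
    if "f \<in> borel_measurable borel" for f :: "'a \<times> real \<Rightarrow> real"
    unfolding dist[symmetric] using Zm that by (rule integrable_distr_eq[symmetric])
  have intN: "integrable N f \<longleftrightarrow> integrable M (\<lambda>\<omega>. f (X \<omega>))"
    if "f \<in> borel_measurable borel" for f :: "'a \<Rightarrow> real"
    unfolding N_def using Xm that by (rule integrable_distr_eq)
  have fst_b: "(fst :: 'a \<times> real \<Rightarrow> 'a) \<in> borel_measurable borel" and snd_b: "(snd :: 'a \<times> real \<Rightarrow> real) \<in> borel_measurable borel"
    by (auto intro!: borel_measurable_continuous_onI continuous_intros)
  note [measurable] = fst_b snd_b
  have X'm [measurable]: "X' \<in> borel_measurable M" unfolding X'_def by measurable
  show X'2: "integrable M (\<lambda>\<omega>. (norm (X' \<omega>))\<^sup>2)"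
  proof (rule Bochner_Integration.integrable_bound)
    \<comment> \<open>The base \<open>1 + \<bar>g\<bar> * (norm x)\<^sup>2\<close> bounds the norm
      of \<open>I - g x x^T\<close>; its square is integrable by the fourth moment.\<close>
    define f where "f z = (1 + \<bar>g\<bar> * (norm (fst z))\<^sup>2)\<^sup>2" for z :: "'a \<times> real"
    have f: "f \<in> borel_measurable borel" unfolding f_def[abs_def] by measurable
    have "integrable D f"
    proof -
      have "f = (\<lambda>z. 1 + 2 * \<bar>g\<bar> * (norm (fst z))\<^sup>2 + g\<^sup>2 * norm (fst z) ^ 4)"
        by (auto simp: f_def fun_eq_iff power2_eq_square power4_eq_xxxx algebra_simps)
      then show ?thesis using int2 int4 by simp
    qed
    moreover have "integrable N (\<lambda>b. (norm b)\<^sup>2)" using X2 by (simp add: intN)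
    moreover have fb: "(\<lambda>zb. f (fst zb) * (norm (snd zb))\<^sup>2) \<in> borel_measurable (borel \<Otimes>\<^sub>M borel)"
      using f by measurable
    ultimately have "integrable (D \<Otimes>\<^sub>M N) (\<lambda>zb. f (fst zb) * (norm (snd zb))\<^sup>2)"
      by (intro DN.Fubini_integrable) (auto simp: abs_mult pair cong: measurable_cong_sets)
    then have 1: "integrable M (\<lambda>\<omega>. f (Z \<omega>) * (norm (X \<omega>))\<^sup>2)"
      unfolding pair by (subst (asm) integrable_distr_eq[OF ZX fb]) simp
    have "integrable M (\<lambda>\<omega>. (snd (Z \<omega>) - w \<bullet> fst (Z \<omega>))\<^sup>2 * (norm (fst (Z \<omega>)))\<^sup>2)"
      using intD[of "\<lambda>z. (snd z - w \<bullet> fst z)\<^sup>2 * (norm (fst z))\<^sup>2"] int_noise by simp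
    with 1 show "integrable M (\<lambda>\<omega>. 2 * (f (Z \<omega>) * (norm (X \<omega>))\<^sup>2)
        + 2 * (c * g)\<^sup>2 * ((snd (Z \<omega>) - w \<bullet> fst (Z \<omega>))\<^sup>2 * (norm (fst (Z \<omega>)))\<^sup>2))"
      by simp
    show "AE \<omega> in M. norm ((norm (X' \<omega>))\<^sup>2) \<le> norm (2 * (f (Z \<omega>) * (norm (X \<omega>))\<^sup>2)
        + 2 * (c * g)\<^sup>2 * ((snd (Z \<omega>) - w \<bullet> fst (Z \<omega>))\<^sup>2 * (norm (fst (Z \<omega>)))\<^sup>2))"
    proof (rule AE_I2)
      fix \<omega>
      define x \<xi> where "x = fst (Z \<omega>)" and "\<xi> = snd (Z \<omega>) - w \<bullet> fst (Z \<omega>)"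
      define p q where "p = (1 + \<bar>g\<bar> * (norm x)\<^sup>2) * norm (X \<omega>)" and "q = \<bar>c * g * \<xi>\<bar> * norm x"
      have "norm ((g * (x \<bullet> X \<omega>)) *\<^sub>R x) \<le> \<bar>g\<bar> * (norm x * norm (X \<omega>)) * norm x"
        by (auto simp: abs_mult intro!: mult_right_mono mult_left_mono Cauchy_Schwarz_ineq2)
      then have "norm (X \<omega> - (g * (x \<bullet> X \<omega>)) *\<^sub>R x) \<le> p"
        using norm_triangle_ineq4[of "X \<omega>" "(g * (x \<bullet> X \<omega>)) *\<^sub>R x"]
        by (simp add: p_def power2_eq_square algebra_simps)
      then have "norm (X' \<omega>) \<le> p + q"
        using norm_triangle_ineq[of "X \<omega> - (g * (x \<bullet> X \<omega>)) *\<^sub>R x" "(c * g * \<xi>) *\<^sub>R x"]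
        by (simp add: X'_def x_def \<xi>_def q_def)
      then have "(norm (X' \<omega>))\<^sup>2 \<le> (p + q)\<^sup>2" by (intro power_mono) auto
      also have "\<dots> \<le> 2 * p\<^sup>2 + 2 * q\<^sup>2"
        using zero_le_power2[of "p - q"] by (simp add: power2_eq_square algebra_simps)
      also have "p\<^sup>2 = f (Z \<omega>) * (norm (X \<omega>))\<^sup>2"
        by (simp add: p_def f_def x_def power_mult_distrib)
      also have "q\<^sup>2 = (c * g)\<^sup>2 * (\<xi>\<^sup>2 * (norm x)\<^sup>2)"
        by (simp add: q_def power_mult_distrib)
      finally show "norm ((norm (X' \<omega>))\<^sup>2) \<le> norm (2 * (f (Z \<omega>) * (norm (X \<omega>))\<^sup>2)
        + 2 * (c * g)\<^sup>2 * ((snd (Z \<omega>) - w \<bullet> fst (Z \<omega>))\<^sup>2 * (norm (fst (Z \<omega>)))\<^sup>2))"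
        by (simp add: x_def \<xi>_def mult.assoc)
    qed
  qed measurable
  have ZS: "AE \<omega> in M. fst (Z \<omega>) \<in> S"
  proof -
    have "AE z in distr M borel Z. fst z \<in> S" unfolding dist by (rule AE_S)
    then show ?thesis by (rule AE_distrD[OF Zm])
  qed
  show "AE \<omega> in M. X' \<omega> \<in> S"
    using XS ZS
    by eventually_elim (auto simp: X'_def intro!: subspace_add[OF subS] subspace_diff[OF subS] subspace_scale[OF subS])
  have X1: "integrable M (\<lambda>\<omega>. norm (X \<omega>))" and X'1: "integrable M (\<lambda>\<omega>. norm (X' \<omega>))"
    using X2 X'2 by (auto intro!: M.square_integrable_imp_integrable)
  have lin: "integrable M (\<lambda>\<omega>. Y \<omega> \<bullet> v)" if "integrable M (\<lambda>\<omega>. norm (Y \<omega>))" "Y \<in> borel_measurable M" for Y :: "'w \<Rightarrow> 'a" and v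
    using that by (auto simp: integrable_norm_iff)
  have quad: "integrable M (\<lambda>\<omega>. (Y \<omega> \<bullet> v) * (Y \<omega> \<bullet> u))"
    if "integrable M (\<lambda>\<omega>. (norm (Y \<omega>))\<^sup>2)" and [measurable]: "Y \<in> borel_measurable M" for Y :: "'w \<Rightarrow> 'a" and u v
  proof (rule Bochner_Integration.integrable_bound[OF integrable_mult_right[OF that(1), of "norm v * norm u"]])
    show "AE \<omega> in M. norm ((Y \<omega> \<bullet> v) * (Y \<omega> \<bullet> u)) \<le> norm (norm v * norm u * (norm (Y \<omega>))\<^sup>2)"
    proof (rule AE_I2)
      fix \<omega>
      have "\<bar>Y \<omega> \<bullet> v\<bar> * \<bar>Y \<omega> \<bullet> u\<bar> \<le> (norm (Y \<omega>) * norm v) * (norm (Y \<omega>) * norm u)"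
        by (intro mult_mono Cauchy_Schwarz_ineq2) auto
      then show "norm ((Y \<omega> \<bullet> v) * (Y \<omega> \<bullet> u)) \<le> norm (norm v * norm u * (norm (Y \<omega>))\<^sup>2)"
        by (simp add: abs_mult power2_eq_square ac_simps)
    qed
  qed measurable
  define \<phi> where "\<phi> = (\<lambda>(z :: 'a \<times> real, b). b - (g * (fst z \<bullet> b)) *\<^sub>R fst z + (c * g * (snd z - w \<bullet> fst z)) *\<^sub>R fst z)"
  have \<phi>m [measurable]: "\<phi> \<in> borel_measurable (borel \<Otimes>\<^sub>M borel)" unfolding \<phi>_def by measurable
  have X'\<phi>: "X' \<omega> = \<phi> (Z \<omega>, X \<omega>)" for \<omega> by (simp add: X'_def \<phi>_def)
  have fubini: "(\<integral>\<omega>. h (X' \<omega>) \<partial>M) = (\<integral>z. (\<integral>b. h (\<phi> (z, b)) \<partial>N) \<partial>D)"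
    if h [measurable]: "h \<in> borel_measurable borel" and i: "integrable M (\<lambda>\<omega>. h (X' \<omega>))" for h :: "'a \<Rightarrow> real"
  proof -
    have hm: "(\<lambda>zb. h (\<phi> zb)) \<in> borel_measurable (borel \<Otimes>\<^sub>M borel)" by measurable
    have "integrable (D \<Otimes>\<^sub>M N) (\<lambda>zb. h (\<phi> zb))"
      unfolding pair using i by (subst integrable_distr_eq[OF ZX hm]) (simp add: X'\<phi>)
    then have "(\<integral>z. (\<integral>b. h (\<phi> (z, b)) \<partial>N) \<partial>D) = (\<integral>zb. h (\<phi> zb) \<partial>(D \<Otimes>\<^sub>M N))"
      by (rule DN.integral_fst')
    also have "\<dots> = (\<integral>\<omega>. h (X' \<omega>) \<partial>M)"
      unfolding pair by (subst integral_distr[OF ZX hm]) (simp add: X'\<phi>)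
    finally show ?thesis by simp
  qed
  \<comment> \<open>The symmetric factor \<open>I - g x x^T\<close> is moved from the path to the
    test vector; with the observation fixed, the inner integral is then a moment of \<open>X\<close>
    already known from the invariant.\<close>
  define pulled where "pulled z v = v - (g * (fst z \<bullet> v)) *\<^sub>R fst z" for z :: "'a \<times> real" and v
  define k where "k z = c * g * (snd z - w \<bullet> fst z)" for z :: "'a \<times> real"
  have \<phi>_inner: "\<phi> (z, b) \<bullet> v = b \<bullet> pulled z v + k z * (fst z \<bullet> v)" for z b v
    by (simp add: \<phi>_def pulled_def k_def inner_add_left inner_add_right inner_diff_left inner_diff_right inner_commute)
  have pulledS: "pulled z v \<in> S" if "fst z \<in> S" "v \<in> S" for z v
    using that unfolding pulled_def by (intro subspace_diff[OF subS] subspace_scale[OF subS])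
  have N1: "integrable N (\<lambda>b. b \<bullet> v)" and N1v: "(\<integral>b. b \<bullet> v \<partial>N) = (\<integral>\<omega>. X \<omega> \<bullet> v \<partial>M)" for v
    using lin[OF X1 Xm, of v] by (simp_all add: intN) (simp add: N_def integral_distr)
  have N2: "integrable N (\<lambda>b. (b \<bullet> v) * (b \<bullet> u))"
    and N2v: "(\<integral>b. (b \<bullet> v) * (b \<bullet> u) \<partial>N) = (\<integral>\<omega>. (X \<omega> \<bullet> v) * (X \<omega> \<bullet> u) \<partial>M)" for u v
    using quad[OF X2 Xm, of v u] by (simp_all add: intN) (simp add: N_def integral_distr)
  have ck: "c * k z = k z" for z using cc by (simp add: k_def mult.assoc[symmetric])
  show "c * (\<integral>\<omega>. X' \<omega> \<bullet> v \<partial>M) = 0" if v: "v \<in> S" for v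
  proof -
    have "c * (\<integral>\<omega>. X' \<omega> \<bullet> v \<partial>M) = (\<integral>z. c * (\<integral>b. \<phi> (z, b) \<bullet> v \<partial>N) \<partial>D)"
      using fubini[of "\<lambda>x. x \<bullet> v"] lin[OF X'1 X'm, of v] by simp
    also have "\<dots> = (\<integral>z. c * g * ((snd z - w \<bullet> fst z) * (fst z \<bullet> v)) \<partial>D)"
    proof (rule integral_cong_AE)
      show "AE z in D. c * (\<integral>b. \<phi> (z, b) \<bullet> v \<partial>N) = c * g * ((snd z - w \<bullet> fst z) * (fst z \<bullet> v))"
        using AE_S
      proof eventually_elim
        case (elim z)
        have "c * (\<integral>b. \<phi> (z, b) \<bullet> v \<partial>N) = c * (\<integral>b. b \<bullet> pulled z v \<partial>N) + c * k z * (fst z \<bullet> v)"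
          unfolding \<phi>_inner using N1 N.prob_space by (simp add: algebra_simps)
        also have "\<dots> = k z * (fst z \<bullet> v)" using mean[OF pulledS[OF elim v]] by (simp add: N1v ck)
        finally show ?case by (simp add: k_def mult.assoc)
      qed
      show "(\<lambda>z. c * (\<integral>b. \<phi> (z, b) \<bullet> v \<partial>N)) \<in> borel_measurable D"
        by (rule meas_D) (simp add: \<phi>_inner N1 N1v pulled_def k_def)
    qed measurable
    also have "\<dots> = 0" using cent v by (simp add: centered_def)
    finally show ?thesis .
  qed
  show "(\<integral>\<omega>. (X' \<omega> \<bullet> v) * (X' \<omega> \<bullet> u) \<partial>M) = v \<bullet> (sgd_op D g A u + (c * g\<^sup>2) *\<^sub>R noise_cov D w u)"
    if u: "u \<in> S" and v: "v \<in> S" for u v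
  proof -
    have "(\<integral>\<omega>. (X' \<omega> \<bullet> v) * (X' \<omega> \<bullet> u) \<partial>M) = (\<integral>z. (\<integral>b. (\<phi> (z, b) \<bullet> v) * (\<phi> (z, b) \<bullet> u) \<partial>N) \<partial>D)"
      using fubini[of "\<lambda>x. (x \<bullet> v) * (x \<bullet> u)"] quad[OF X'2 X'm, of v u] by simp
    also have "\<dots> = (\<integral>z. pulled z v \<bullet> A (pulled z u)
        + c * g\<^sup>2 * ((snd z - w \<bullet> fst z)\<^sup>2 * ((fst z \<bullet> u) * (fst z \<bullet> v))) \<partial>D)"
    proof (rule integral_cong_AE)
      have k2: "(k z)\<^sup>2 = c * g\<^sup>2 * (snd z - w \<bullet> fst z)\<^sup>2" for z
        using cc by (simp add: k_def power_mult_distrib power2_eq_square[of c])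
      show "AE z in D. (\<integral>b. (\<phi> (z, b) \<bullet> v) * (\<phi> (z, b) \<bullet> u) \<partial>N) = pulled z v \<bullet> A (pulled z u)
          + c * g\<^sup>2 * ((snd z - w \<bullet> fst z)\<^sup>2 * ((fst z \<bullet> u) * (fst z \<bullet> v)))"
        using AE_S
      proof eventually_elim
        case (elim z)
        note bS = pulledS[OF elim u] pulledS[OF elim v]
        \<comment> \<open>The cross terms vanish for two reasons: \<open>k z = 0\<close> if
          \<open>c = 0\<close>, and mean zero of the path if \<open>c = 1\<close>.\<close>
        have z0: "k z * (\<integral>b. b \<bullet> y \<partial>N) = 0" if "y \<in> S" for y
          using mean[OF that] cc by (auto simp: k_def N1v)
        have "(\<integral>b. (\<phi> (z, b) \<bullet> v) * (\<phi> (z, b) \<bullet> u) \<partial>N)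
            = (\<integral>b. (b \<bullet> pulled z v) * (b \<bullet> pulled z u) + (fst z \<bullet> u) * (k z * (b \<bullet> pulled z v))
                + (fst z \<bullet> v) * (k z * (b \<bullet> pulled z u)) + (k z)\<^sup>2 * ((fst z \<bullet> u) * (fst z \<bullet> v)) \<partial>N)"
          unfolding \<phi>_inner by (simp add: power2_eq_square algebra_simps)
        also have "\<dots> = (\<integral>b. (b \<bullet> pulled z v) * (b \<bullet> pulled z u) \<partial>N) + (fst z \<bullet> u) * (k z * (\<integral>b. b \<bullet> pulled z v \<partial>N))
            + (fst z \<bullet> v) * (k z * (\<integral>b. b \<bullet> pulled z u \<partial>N)) + (k z)\<^sup>2 * ((fst z \<bullet> u) * (fst z \<bullet> v))"
          using N1 N2 N.prob_space by simp
        finally show ?case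
          using bS by (simp add: z0 k2 N2v second mult.assoc)
      qed
      have [measurable]: "A \<in> borel_measurable borel" by (rule bounded_linear_borel_measurable[OF psd_linear[OF A]])
      show "(\<lambda>z. pulled z v \<bullet> A (pulled z u)
          + c * g\<^sup>2 * ((snd z - w \<bullet> fst z)\<^sup>2 * ((fst z \<bullet> u) * (fst z \<bullet> v)))) \<in> borel_measurable D"
        unfolding pulled_def by measurable
      show "(\<lambda>z. \<integral>b. (\<phi> (z, b) \<bullet> v) * (\<phi> (z, b) \<bullet> u) \<partial>N) \<in> borel_measurable D"
      proof (rule N.borel_measurable_lebesgue_integral)
        have "sets (D \<Otimes>\<^sub>M N) = sets (borel \<Otimes>\<^sub>M borel)" unfolding pair by simp
        then show "(\<lambda>(z, b). (\<phi> (z, b) \<bullet> v) * (\<phi> (z, b) \<bullet> u)) \<in> borel_measurable (D \<Otimes>\<^sub>M N)"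
          unfolding measurable_cong_sets[OF \<open>sets (D \<Otimes>\<^sub>M N) = _\<close> refl] by (simp add: split_beta')
      qed
    qed
    also have "\<dots> = v \<bullet> (sgd_op D g A u + (c * g\<^sup>2) *\<^sub>R noise_cov D w u)"
    proof -
      have "integrable D (\<lambda>z. pulled z v \<bullet> A (pulled z u))"
        unfolding pulled_def by (rule sgd_op_integral(2)[OF A])
      then show ?thesis
        by (simp add: noise_integrable noise_inner inner_add_right sgd_op_integral(1)[OF A] pulled_def)
    qed
    finally show ?thesis .
  qed
qed

text \<open>The second moment is known only between fixed vectors of \<open>S\<close>, whereas the
  energy is quadratic in the random vector. It is recovered as a limit of finite coordinate sums,
  each dominated by the energy itself and with expectation a partial sum of the trace.\<close>

lemma process_energy:
  fixes M :: "'w measure" and X :: "'w \<Rightarrow> 'a"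
  assumes M: "prob_space M" and Xm [measurable]: "X \<in> borel_measurable M"
    and X2: "integrable M (\<lambda>\<omega>. (norm (X \<omega>))\<^sup>2)" and XS: "AE \<omega> in M. X \<omega> \<in> S"
    and second: "\<And>v. v \<in> S \<Longrightarrow> (\<integral>\<omega>. (X \<omega> \<bullet> v) * (X \<omega> \<bullet> v) \<partial>M) = v \<bullet> A v" and A: "psd A"
  shows "integrable M (\<lambda>\<omega>. X \<omega> \<bullet> G (X \<omega>))"
    and "(\<integral>\<omega>. X \<omega> \<bullet> G (X \<omega>) \<partial>M) \<le> op_trace e I (G \<circ> A)"
proof -
  interpret M: prob_space M by (rule M)
  have [measurable]: "G \<in> borel_measurable borel"
    by (rule bounded_linear_borel_measurable[OF psd_linear[OF psd_G]])
  obtain K where K: "0 < K" "\<And>x. norm (G x) \<le> norm x * K"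
    using bounded_linear.pos_bounded[OF psd_linear[OF psd_G]] by blast
  show int: "integrable M (\<lambda>\<omega>. X \<omega> \<bullet> G (X \<omega>))"
  proof (rule Bochner_Integration.integrable_bound[OF integrable_mult_right[OF X2, of K]])
    show "AE \<omega> in M. norm (X \<omega> \<bullet> G (X \<omega>)) \<le> norm (K * (norm (X \<omega>))\<^sup>2)"
    proof (rule AE_I2)
      fix \<omega>
      have "\<bar>X \<omega> \<bullet> G (X \<omega>)\<bar> \<le> norm (X \<omega>) * (norm (X \<omega>) * K)"
        using Cauchy_Schwarz_ineq2[of "X \<omega>" "G (X \<omega>)"] mult_left_mono[OF K(2)[of "X \<omega>"], of "norm (X \<omega>)"] by simp
      then show "norm (X \<omega> \<bullet> G (X \<omega>)) \<le> norm (K * (norm (X \<omega>))\<^sup>2)"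
        using K(1) by (simp add: power2_eq_square ac_simps)
    qed
  qed measurable
  \<comment> \<open>A sequence cofinal among the finite subsets of \<open>I\<close>, since dominated
    convergence is a statement about sequences.\<close>
  define B where "B k = I \<inter> {..<k}" for k :: nat
  have finB: "finite (B k)" for k by (simp add: B_def)
  have B: "filterlim B (finite_subsets_at_top I) sequentially"
    unfolding filterlim_iff eventually_finite_subsets_at_top
  proof (intro allI impI, elim exE conjE)
    fix Q Y assume Y: "finite Y" "Y \<subseteq> I" and Q: "\<forall>Y'. finite Y' \<and> Y \<subseteq> Y' \<and> Y' \<subseteq> I \<longrightarrow> Q Y'"
    obtain k0 where "\<forall>i\<in>Y. i < k0" using Y(1) finite_nat_set_iff_bounded by blast
    then have "Y \<subseteq> B k" if "k0 \<le> k" for k using that Y(2) by (force simp: B_def)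
    then have "\<forall>k\<ge>k0. Q (B k)" using Q finB by (auto simp: B_def)
    then show "\<forall>\<^sub>F k in sequentially. Q (B k)" by (auto simp: eventually_sequentially)
  qed
  have term_int: "integrable M (\<lambda>\<omega>. (X \<omega> \<bullet> e i) * (X \<omega> \<bullet> e i))" if i: "i \<in> I" for i
  proof (rule Bochner_Integration.integrable_bound[OF X2])
    show "AE \<omega> in M. norm ((X \<omega> \<bullet> e i) * (X \<omega> \<bullet> e i)) \<le> norm ((norm (X \<omega>))\<^sup>2)"
    proof (rule AE_I2)
      fix \<omega>
      have "\<bar>X \<omega> \<bullet> e i\<bar> \<le> norm (X \<omega>)"
        using Cauchy_Schwarz_ineq2[of "X \<omega>" "e i"] e_inner[OF i i] by (simp add: norm_eq_sqrt_inner)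
      then have "\<bar>X \<omega> \<bullet> e i\<bar>\<^sup>2 \<le> (norm (X \<omega>))\<^sup>2" by (intro power_mono) auto
      then show "norm ((X \<omega> \<bullet> e i) * (X \<omega> \<bullet> e i)) \<le> norm ((norm (X \<omega>))\<^sup>2)"
        by (simp add: power2_eq_square abs_mult)
    qed
  qed measurable
  define h where "h k \<omega> = (\<Sum>i\<in>B k. s i * ((X \<omega> \<bullet> e i) * (X \<omega> \<bullet> e i)))" for k \<omega>
  have quad: "((\<lambda>i. s i * ((x \<bullet> e i) * (x \<bullet> e i))) has_sum (x \<bullet> G x)) I" if "x \<in> S" for x
    using A_quad[OF that] by (simp add: power2_eq_square inner_commute)
  have lim: "(\<lambda>k. \<integral>\<omega>. h k \<omega> \<partial>M) \<longlonglongrightarrow> (\<integral>\<omega>. X \<omega> \<bullet> G (X \<omega>) \<partial>M)"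
  proof (rule integral_dominated_convergence[OF _ _ int])
    show "AE \<omega> in M. (\<lambda>k. h k \<omega>) \<longlonglongrightarrow> X \<omega> \<bullet> G (X \<omega>)"
      using XS
    proof eventually_elim
      case (elim \<omega>)
      show ?case
        unfolding h_def by (rule filterlim_compose[OF quad[OF elim, unfolded has_sum_def] B])
    qed
    show "AE \<omega> in M. norm (h k \<omega>) \<le> X \<omega> \<bullet> G (X \<omega>)" for k
      using XS
    proof eventually_elim
      case (elim \<omega>)
      have "0 \<le> h k \<omega>" unfolding h_def
        by (intro sum_nonneg mult_nonneg_nonneg zero_le_square s_nonneg) (auto simp: B_def)
      moreover have "h k \<omega> \<le> X \<omega> \<bullet> G (X \<omega>)"
        unfolding h_def by (rule finite_sum_le_has_sum[OF quad[OF elim] finB]) (auto simp: B_def s_nonneg)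
      ultimately show ?case by simp
    qed
  qed (unfold h_def, measurable)
  have "(\<integral>\<omega>. h k \<omega> \<partial>M) \<le> op_trace e I (G \<circ> A)" for k
  proof -
    have "(\<integral>\<omega>. h k \<omega> \<partial>M) = (\<Sum>i\<in>B k. s i * (e i \<bullet> A (e i)))"
      unfolding h_def
      by (subst Bochner_Integration.integral_sum) (auto simp: B_def term_int second e_mem)
    also have "\<dots> \<le> op_trace e I (G \<circ> A)"
      by (rule finite_sum_le_has_sum[OF trace_has_sum[OF A] finB])
         (auto simp: B_def intro!: mult_nonneg_nonneg s_nonneg psd_nonneg[OF A])
    finally show ?thesis .
  qed
  then show "(\<integral>\<omega>. X \<omega> \<bullet> G (X \<omega>) \<partial>M) \<le> op_trace e I (G \<circ> A)"
    by (intro LIMSEQ_le_const2[OF lim]) auto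
qed

end

text \<open>The path at time \<open>t\<close> is a function of the observations 1 to
  \<open>t\<close>, so grouping the independent family makes it independent of observation
  \<open>Suc t\<close>. The conclusion is phrased as a product law, ready for Fubini.\<close>

lemma (in prob_space) joint_distr_error_path:
  fixes Z :: "nat \<Rightarrow> 'a \<Rightarrow> 'b::{real_inner, banach, second_countable_topology} \<times> real"
  assumes ind: "indep_vars (\<lambda>_. borel) Z {1..N}" and t: "t < N"
  shows "distr M borel (Z (Suc t)) \<Otimes>\<^sub>M distr M borel (\<lambda>\<omega>. error_path g w c w0 (\<lambda>i. Z i \<omega>) t)
      = distr M (borel \<Otimes>\<^sub>M borel) (\<lambda>\<omega>. (Z (Suc t) \<omega>, error_path g w c w0 (\<lambda>i. Z i \<omega>) t))"
    and "(\<lambda>\<omega>. error_path g w c w0 (\<lambda>i. Z i \<omega>) t) \<in> borel_measurable M"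
proof -
  define U V where "U \<omega> = restrict (\<lambda>i. Z i \<omega>) {Suc t}" and "V \<omega> = restrict (\<lambda>i. Z i \<omega>) {1..t}" for \<omega>
  define Y1 :: "(nat \<Rightarrow> 'b \<times> real) \<Rightarrow> 'b \<times> real" where "Y1 z = z (Suc t)" for z
  define Y2 where "Y2 z = error_path g w c w0 z t" for z
  have UV: "indep_var (PiM {Suc t} (\<lambda>_. borel)) U (PiM {1..t} (\<lambda>_. borel)) V"
    unfolding U_def V_def by (rule indep_var_restrict[OF ind]) (use t in auto)
  have UVm [measurable]: "U \<in> measurable M (PiM {Suc t} (\<lambda>_. borel))" "V \<in> measurable M (PiM {1..t} (\<lambda>_. borel))"
    using indep_var_rv1[OF UV] indep_var_rv2[OF UV] by auto
  have Y1 [measurable]: "Y1 \<in> measurable (PiM {Suc t} (\<lambda>_. borel)) borel"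
    unfolding Y1_def by (rule measurable_component_singleton) simp
  have Y2 [measurable]: "Y2 \<in> measurable (PiM {1..t} (\<lambda>_. borel)) borel"
    unfolding Y2_def by (rule error_path_measurable) simp
  have Z: "Z (Suc t) = (\<lambda>\<omega>. Y1 (U \<omega>))" by (simp add: Y1_def U_def fun_eq_iff)
  have X: "(\<lambda>\<omega>. error_path g w c w0 (\<lambda>i. Z i \<omega>) t) = (\<lambda>\<omega>. Y2 (V \<omega>))"
    unfolding Y2_def V_def by (intro ext error_path_cong) auto
  show "(\<lambda>\<omega>. error_path g w c w0 (\<lambda>i. Z i \<omega>) t) \<in> borel_measurable M"
    unfolding X by measurable
  interpret V: prob_space "distr M (PiM {1..t} (\<lambda>_. borel)) V" by (rule prob_space_distr) measurable
  have YV: "prob_space (distr (distr M (PiM {1..t} (\<lambda>_. borel)) V) borel Y2)"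
    by (rule V.prob_space_distr) (simp only: measurable_distr_eq1 Y2)
  have "distr M borel (Z (Suc t)) \<Otimes>\<^sub>M distr M borel (\<lambda>\<omega>. error_path g w c w0 (\<lambda>i. Z i \<omega>) t)
      = distr (distr M (PiM {Suc t} (\<lambda>_. borel)) U) borel Y1 \<Otimes>\<^sub>M distr (distr M (PiM {1..t} (\<lambda>_. borel)) V) borel Y2"
    unfolding Z X distr_distr[OF Y1 UVm(1)] distr_distr[OF Y2 UVm(2)] by (simp add: comp_def)
  also have "\<dots> = distr (distr M (PiM {Suc t} (\<lambda>_. borel)) U \<Otimes>\<^sub>M distr M (PiM {1..t} (\<lambda>_. borel)) V)
      (borel \<Otimes>\<^sub>M borel) (\<lambda>(x, y). (Y1 x, Y2 y))"
    by (rule pair_measure_distr)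
       (use Y1 Y2 YV in \<open>auto intro: prob_space_imp_sigma_finite\<close>)
  also have "distr M (PiM {Suc t} (\<lambda>_. borel)) U \<Otimes>\<^sub>M distr M (PiM {1..t} (\<lambda>_. borel)) V
      = distr M (PiM {Suc t} (\<lambda>_. borel) \<Otimes>\<^sub>M PiM {1..t} (\<lambda>_. borel)) (\<lambda>\<omega>. (U \<omega>, V \<omega>))"
    using UV unfolding indep_var_distribution_eq by simp
  also have "distr \<dots> (borel \<Otimes>\<^sub>M borel) (\<lambda>(x, y). (Y1 x, Y2 y))
      = distr M (borel \<Otimes>\<^sub>M borel) (\<lambda>\<omega>. (Z (Suc t) \<omega>, error_path g w c w0 (\<lambda>i. Z i \<omega>) t))"
  proof -
    have 1: "(\<lambda>(x, y). (Y1 x, Y2 y)) \<in> measurable (PiM {Suc t} (\<lambda>_. borel) \<Otimes>\<^sub>M PiM {1..t} (\<lambda>_. borel)) (borel \<Otimes>\<^sub>M borel)"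
      unfolding split_beta'
      by (rule measurable_Pair[OF measurable_compose[OF measurable_fst Y1] measurable_compose[OF measurable_snd Y2]])
    show ?thesis
      unfolding distr_distr[OF 1 measurable_Pair[OF UVm]] Z fun_cong[OF X] by (simp add: comp_def)
  qed
  finally show "distr M borel (Z (Suc t)) \<Otimes>\<^sub>M distr M borel (\<lambda>\<omega>. error_path g w c w0 (\<lambda>i. Z i \<omega>) t)
      = distr M (borel \<Otimes>\<^sub>M borel) (\<lambda>\<omega>. (Z (Suc t) \<omega>, error_path g w c w0 (\<lambda>i. Z i \<omega>) t))" .
qed

section \<open>Error paths through both phases\<close>

context transfer
begin

definition rates :: "nat \<Rightarrow> real" where
  "rates t = (if t < m then src.rate t else tgt.rate (t - m))"

text \<open>At \<open>t = m\<close> the two branches agree, as finetuning starts from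
  \<open>src.moment m\<close>; step \<open>m\<close> itself already uses the finetuning rate, hence
  the strict inequality in \<open>rates\<close>.\<close>

definition moments :: "nat \<Rightarrow> 'a \<Rightarrow> 'a" where
  "moments t = (if t \<le> m then src.moment t else tgt.moment (t - m))"

text \<open>\<open>start\<close> supplies the base case of the mean condition: it is void for
  \<open>c = 0\<close>, and otherwise the path starts at its mean 0.\<close>

lemma path_moments:
  fixes P :: "'w measure"
  assumes P: "prob_space P" and ind: "prob_space.indep_vars P (\<lambda>_. borel) Z {1..m + n}"
    and dist: "\<And>t. t \<in> {1..m + n} \<Longrightarrow> distr P borel (Z t) = (if t \<le> m then D else D')"
    and cent: "src.centered" "tgt.centered" and cc: "c * c = c" and start: "c = 0 \<or> w0 = 0"
    and t: "t \<le> m + n"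
  defines "X \<equiv> (\<lambda>t \<omega>. error_path rates w c w0 (\<lambda>i. Z i \<omega>) t)"
  shows "integrable P (\<lambda>\<omega>. (norm (X t \<omega>))\<^sup>2) \<and> (AE \<omega> in P. X t \<omega> \<in> S)
    \<and> (\<forall>v\<in>S. c * (\<integral>\<omega>. X t \<omega> \<bullet> v \<partial>P) = 0)
    \<and> (\<forall>u\<in>S. \<forall>v\<in>S. (\<integral>\<omega>. (X t \<omega> \<bullet> v) * (X t \<omega> \<bullet> u) \<partial>P) = v \<bullet> moments t u)"
  using t
proof (induction t)
  case 0
  interpret prob_space P by (rule P)
  have "moments 0 = outer w0" by (simp add: moments_def)
  then show ?case using start w0 by (auto simp: X_def outer_def inner_commute prob_space)
next
  case (Suc t)
  interpret P: prob_space P by (rule P)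
  have IH: "integrable P (\<lambda>\<omega>. (norm (X t \<omega>))\<^sup>2)" "AE \<omega> in P. X t \<omega> \<in> S"
    "\<And>v. v \<in> S \<Longrightarrow> c * (\<integral>\<omega>. X t \<omega> \<bullet> v \<partial>P) = 0"
    "\<And>u v. u \<in> S \<Longrightarrow> v \<in> S \<Longrightarrow> (\<integral>\<omega>. (X t \<omega> \<bullet> v) * (X t \<omega> \<bullet> u) \<partial>P) = v \<bullet> moments t u"
    using Suc by auto
  have tN: "t < m + n" using Suc.prems by simp
  have Zm: "Z (Suc t) \<in> measurable P borel" using ind tN by (auto simp: P.indep_vars_def)
  have Xm: "X t \<in> borel_measurable P" and J: "distr P borel (Z (Suc t)) \<Otimes>\<^sub>M distr P borel (X t)
      = distr P (borel \<Otimes>\<^sub>M borel) (\<lambda>\<omega>. (Z (Suc t) \<omega>, X t \<omega>))"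
    using P.joint_distr_error_path[OF ind tN, of rates w c w0] by (auto simp: X_def)
  have X': "X (Suc t) = (\<lambda>\<omega>. X t \<omega> - (rates t * (fst (Z (Suc t) \<omega>) \<bullet> X t \<omega>)) *\<^sub>R fst (Z (Suc t) \<omega>)
      + (c * rates t * (snd (Z (Suc t) \<omega>) - w \<bullet> fst (Z (Suc t) \<omega>))) *\<^sub>R fst (Z (Suc t) \<omega>))"
    by (simp add: X_def)
  show ?case
  proof (cases "t < m")
    case True
    have d: "distr P borel (Z (Suc t)) = D" using dist[of "Suc t"] True by simp
    have A: "psd (moments t)" using True by (simp add: moments_def src.psd_moment)
    have m: "moments (Suc t) u = sgd_op D (rates t) (moments t) u + (c * (rates t)\<^sup>2) *\<^sub>R noise_cov D w u" for u
      using True by (simp add: moments_def rates_def)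
    show ?thesis
      unfolding X' m using src.process_step[OF P Zm Xm d J[unfolded d] IH A cent(1) cc] by auto
  next
    case False
    have d: "distr P borel (Z (Suc t)) = D'" using dist[of "Suc t"] False tN by simp
    have A: "psd (moments t)" using False by (auto simp: moments_def src.psd_moment tgt.psd_moment)
    have "Suc t - m = Suc (t - m)" using False by simp
    then have m: "moments (Suc t) u = sgd_op D' (rates t) (moments t) u + (c * (rates t)\<^sup>2) *\<^sub>R noise_cov D' w u" for u
      using False by (cases "t = m") (auto simp: moments_def rates_def)
    show ?thesis
      unfolding X' m using tgt.process_step[OF P Zm Xm d J[unfolded d] IH A cent(2) cc] by auto
  qed
qed

lemma path_energy:
  fixes P :: "'w measure"
  assumes P: "prob_space P" and ind: "prob_space.indep_vars P (\<lambda>_. borel) Z {1..m + n}"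
    and dist: "\<And>t. t \<in> {1..m + n} \<Longrightarrow> distr P borel (Z t) = (if t \<le> m then D else D')"
    and cent: "src.centered" "tgt.centered" and cc: "c * c = c" and start: "c = 0 \<or> w0 = 0"
  defines "X \<equiv> (\<lambda>\<omega>. error_path rates w c w0 (\<lambda>i. Z i \<omega>) (m + n))"
  shows "X \<in> borel_measurable P" and "AE \<omega> in P. X \<omega> \<in> S"
    and "integrable P (\<lambda>\<omega>. X \<omega> \<bullet> tgt.G (X \<omega>))" and "(\<integral>\<omega>. X \<omega> \<bullet> tgt.G (X \<omega>) \<partial>P) \<le> tgt.heat n"
proof -
  interpret P: prob_space P by (rule P)
  have "(\<lambda>\<omega>. restrict (\<lambda>i. Z i \<omega>) {1..m + n}) \<in> measurable P (PiM {1..m + n} (\<lambda>_. borel))"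
    using ind by (intro measurable_restrict) (auto simp: P.indep_vars_def)
  from measurable_compose[OF this error_path_measurable[OF subset_refl]]
  have "(\<lambda>\<omega>. error_path rates w c w0 (restrict (\<lambda>i. Z i \<omega>) {1..m + n}) (m + n)) \<in> borel_measurable P" .
  also have "(\<lambda>\<omega>. error_path rates w c w0 (restrict (\<lambda>i. Z i \<omega>) {1..m + n}) (m + n)) = X"
    unfolding X_def by (intro ext error_path_cong) auto
  finally show Xm: "X \<in> borel_measurable P" .
  have *: "integrable P (\<lambda>\<omega>. (norm (X \<omega>))\<^sup>2) \<and> (AE \<omega> in P. X \<omega> \<in> S)
    \<and> (\<forall>v\<in>S. c * (\<integral>\<omega>. X \<omega> \<bullet> v \<partial>P) = 0)
    \<and> (\<forall>u\<in>S. \<forall>v\<in>S. (\<integral>\<omega>. (X \<omega> \<bullet> v) * (X \<omega> \<bullet> u) \<partial>P) = v \<bullet> moments (m + n) u)"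
    unfolding X_def by (rule path_moments[OF P ind dist cent cc start order_refl])
  then show XS: "AE \<omega> in P. X \<omega> \<in> S" by simp
  have "0 < n" using tgt.n2 by simp
  then have mom: "moments (m + n) = tgt.moment n" by (simp add: moments_def)
  have "integrable P (\<lambda>\<omega>. (norm (X \<omega>))\<^sup>2)"
    "\<And>v. v \<in> S \<Longrightarrow> (\<integral>\<omega>. (X \<omega> \<bullet> v) * (X \<omega> \<bullet> v) \<partial>P) = v \<bullet> tgt.moment n v"
    using * by (auto simp: mom)
  note e = tgt.process_energy[OF P Xm this(1) XS this(2) tgt.psd_moment]
  show "integrable P (\<lambda>\<omega>. X \<omega> \<bullet> tgt.G (X \<omega>))" by (rule e(1))
  show "(\<integral>\<omega>. X \<omega> \<bullet> tgt.G (X \<omega>) \<partial>P) \<le> tgt.heat n"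
    unfolding tgt.heat_def by (rule e(2))
qed

end

section \<open>The excess risk bound\<close>

lemma infsum_ennreal_cmult:
  fixes f :: "'i \<Rightarrow> ennreal"
  shows "(\<Sum>\<^sub>\<infinity>i\<in>A. c * f i) = c * (\<Sum>\<^sub>\<infinity>i\<in>A. f i)"
proof -
  have "(SUP F\<in>{F. finite F \<and> F \<subseteq> A}. c * sum f F) = c * (SUP F\<in>{F. finite F \<and> F \<subseteq> A}. sum f F)"
    by (rule SUP_mult_left_ennreal[symmetric])
  then show ?thesis by (simp add: nonneg_infsum_complete sum_distrib_left)
qed

lemma ennreal_infsum:
  assumes "f summable_on A" "\<And>x. x \<in> A \<Longrightarrow> 0 \<le> f x"
  shows "ennreal (infsum f A) = (\<Sum>\<^sub>\<infinity>x\<in>A. ennreal (f x))"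
proof -
  have "(SUP F\<in>{F. finite F \<and> F \<subseteq> A}. ennreal (sum f F)) = (SUP F\<in>{F. finite F \<and> F \<subseteq> A}. \<Sum>x\<in>F. ennreal (f x))"
    using assms(2) by (intro SUP_cong) (auto intro!: sum_ennreal[symmetric])
  then show ?thesis
    by (simp add: infsum_nonneg_is_SUPREMUM_ennreal[OF assms] nonneg_infsum_complete)
qed

lemma op_prod_cong:
  assumes "\<And>t. t < n \<Longrightarrow> F t = F' t" shows "op_prod F n = op_prod F' n"
  using assms by (induction n) auto

lemma (in borel_law) risk_measurable:
  assumes "prob_space D" shows "risk D \<in> borel_measurable borel"
proof -
  interpret prob_space D by (rule assms)
  have "(\<lambda>(u, z). (snd z - u \<bullet> fst z)\<^sup>2) \<in> borel_measurable (borel \<Otimes>\<^sub>M D)"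
    by measurable
  from borel_measurable_lebesgue_integral[OF this]
  have "(\<lambda>u. \<integral>z. (snd z - u \<bullet> fst z)\<^sup>2 \<partial>D) \<in> borel_measurable borel" by simp
  then show ?thesis unfolding risk_def[abs_def] by simp
qed

locale shift_problem =
  fixes p :: "'a::{real_inner, banach, second_countable_topology} problem" and \<alpha> \<sigma> :: real
  assumes shift: "covariate_shift p" and sizes: "2 \<le> n_src p" "2 \<le> n_tgt p"
    and alpha: "0 < \<alpha>" and fourth: "fourth_moment_upper p \<alpha>" and noise: "noise_upper p \<sigma>"
    and step_src: "0 < step_src p" "step_src p < min (1 / (4 * \<alpha> * tr_G p)) (1 / (4 * \<alpha> * tr_H p))"
    and step_tgt: "0 < step_tgt p" "step_tgt p < min (1 / (4 * \<alpha> * tr_G p)) (1 / (4 * \<alpha> * tr_H p))"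
begin

lemma covariates_src: "covariates (hilb p) (idx p) (src_vec p) (src p) (src_val p) \<alpha> \<sigma> (wstar p)"
  and covariates_tgt: "covariates (hilb p) (idx p) (tgt_vec p) (tgt p) (tgt_val p) \<alpha> \<sigma> (wstar p)"
  using shift fourth noise alpha
  by (auto simp: covariates_def hilbert_basis_def covariates_axioms_def covariate_shift_def
      fourth_moment_upper_def noise_upper_def Gop_def Hop_def)

lemma minimizer:
  "is_arg_min (risk (src p)) (\<lambda>w. w \<in> hilb p) (wstar p)" "is_arg_min (risk (tgt p)) (\<lambda>w. w \<in> hilb p) (wstar p)"
  using shift by (auto simp: covariate_shift_def)

lemma wstar_mem: "wstar p \<in> hilb p"
  using minimizer(1) by (simp add: is_arg_min_def)

lemma small_steps:
  "\<alpha> * step_src p * tr_G p \<le> 1/4" "\<alpha> * step_src p * tr_H p \<le> 1/4"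
  "\<alpha> * step_tgt p * tr_G p \<le> 1/4" "\<alpha> * step_tgt p * tr_H p \<le> 1/4"
proof -
  have *: "\<alpha> * g * T \<le> 1/4" if "g < 1 / (4 * \<alpha> * T)" "0 \<le> T" for g T :: real
  \<comment> \<open>For \<open>T = 0\<close> the quotient takes the default value 0 and gives no
    information, but the claim then reads \<open>0 \<le> 1/4\<close>.\<close>
  proof (cases "T = 0")
    case False
    then show ?thesis using that alpha by (simp add: field_simps)
  qed simp
  have "0 \<le> tr_G p" "0 \<le> tr_H p"
    using covariates.T_nonneg[OF covariates_src] covariates.T_nonneg[OF covariates_tgt]
    by (auto simp: tr_G_def tr_H_def Gop_def Hop_def)
  moreover have "step_src p < 1 / (4 * \<alpha> * tr_G p)" "step_src p < 1 / (4 * \<alpha> * tr_H p)"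
    "step_tgt p < 1 / (4 * \<alpha> * tr_G p)" "step_tgt p < 1 / (4 * \<alpha> * tr_H p)"
    using step_src(2) step_tgt(2) by auto
  ultimately show "\<alpha> * step_src p * tr_G p \<le> 1/4" "\<alpha> * step_src p * tr_H p \<le> 1/4"
    "\<alpha> * step_tgt p * tr_G p \<le> 1/4" "\<alpha> * step_tgt p * tr_H p \<le> 1/4"
    by (blast intro: *)+
qed

lemma transfer_phases:
  assumes "w0 \<in> hilb p" "0 \<le> c"
  shows "transfer (hilb p) (idx p) (src_vec p) (src p) (src_val p) \<alpha> \<sigma> (wstar p) (n_src p) (step_src p) w0 c
    (tgt_vec p) (tgt p) (tgt_val p) (n_tgt p) (step_tgt p)"
proof -
  have 1: "sgd_phase (hilb p) (idx p) (src_vec p) (src p) (src_val p) \<alpha> \<sigma> (wstar p) (n_src p) (step_src p) (outer w0) c"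
    using covariates_src sizes step_src small_steps assms psd_outer[of w0]
    by (simp add: sgd_phase_def halving_steps_def sgd_phase_axioms_def tr_G_def Gop_def)
  have 2: "sgd_phase (hilb p) (idx p) (tgt_vec p) (tgt p) (tgt_val p) \<alpha> \<sigma> (wstar p) (n_tgt p) (step_tgt p)
      (sgd_phase.moment (src p) (wstar p) (n_src p) (step_src p) (outer w0) c (n_src p)) c"
    using covariates_tgt sizes step_tgt small_steps assms sgd_phase.psd_moment[OF 1]
    by (simp add: sgd_phase_def halving_steps_def sgd_phase_axioms_def tr_H_def Hop_def)
  show ?thesis
    using 1 2 small_steps assms
    by (simp add: transfer_def transfer_axioms_def tr_G_def tr_H_def Gop_def Hop_def)
qed

lemma w_init_mem: "w_init - wstar p \<in> hilb p"
proof -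
  have "subspace (hilb p)" using shift by (simp add: covariate_shift_def)
  then show ?thesis using wstar_mem by (simp add: w_init_def subspace_neg)
qed

lemma zero_mem: "0 \<in> hilb p"
  using shift by (auto simp: covariate_shift_def subspace_0)

end

sublocale shift_problem \<subseteq> bias: transfer "hilb p" "idx p" "src_vec p" "src p" "src_val p" \<alpha> \<sigma> "wstar p"
    "n_src p" "step_src p" "w_init - wstar p" 0 "tgt_vec p" "tgt p" "tgt_val p" "n_tgt p" "step_tgt p"
  by (rule transfer_phases[OF w_init_mem]) simp

sublocale shift_problem \<subseteq> var: transfer "hilb p" "idx p" "src_vec p" "src p" "src_val p" \<alpha> \<sigma> "wstar p"
    "n_src p" "step_src p" 0 1 "tgt_vec p" "tgt p" "tgt_val p" "n_tgt p" "step_tgt p"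
  by (rule transfer_phases[OF zero_mem]) simp

section \<open>Identification of the error terms with the two phases\<close>

context shift_problem
begin

lemma rates_eq: "bias.rates = step p"
  by (simp add: fun_eq_iff bias.rates_def bias.src.rate_def bias.tgt.rate_def step_def M_eff_def N_eff_def)

lemma bias_iter_eq: "bias_iter p t = bias.moments t"
proof (induction t)
  case (Suc t)
  show ?case
  proof (cases "t < n_src p")
    case True
    then show ?thesis
      using Suc by (simp add: bias.moments_def law_def rates_eq[symmetric] bias.rates_def)
  next
    case False
    then have *: "Suc t - n_src p = Suc (t - n_src p)" by simp
    show ?thesis
      using Suc False by (cases "t = n_src p")
        (auto simp: bias.moments_def law_def rates_eq[symmetric] bias.rates_def *)
  qed
qed (simp add: bias.moments_def)

lemma var_iter_eq: "var_iter p t = var.moments t"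
proof (induction t)
  case 0
  have "var.moments 0 = outer 0" by (simp add: var.moments_def)
  then show ?case by (simp add: outer_def)
next
  case (Suc t)
  show ?case
  proof (cases "t < n_src p")
    case True
    \<comment> \<open>Both instances share the constant \<open>rates\<close>, which depends only on
      sample sizes and step sizes; facts about \<open>bias.rates\<close> therefore apply.\<close>
    then show ?thesis
      using Suc by (simp add: var.moments_def law_def rates_eq[symmetric] bias.rates_def)
  next
    case False
    then have *: "Suc t - n_src p = Suc (t - n_src p)" by simp
    show ?thesis
      using Suc False by (cases "t = n_src p")
        (auto simp: var.moments_def law_def rates_eq[symmetric] bias.rates_def *)
  qed
qed

lemma n_tgt_pos: "\<not> n_src p + n_tgt p \<le> n_src p"
  using sizes by simp

lemma bias_err_eq: "bias_err p = bias.tgt.heat (n_tgt p)"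
  using n_tgt_pos psd_adjoint[OF bias.tgt.psd_G]
  by (simp add: bias_err_def op_inner_def bias_iter_eq bias.moments_def bias.tgt.heat_def Hop_def)

lemma var_err_eq: "var_err p = var.tgt.heat (n_tgt p)"
  using n_tgt_pos psd_adjoint[OF bias.tgt.psd_G]
  by (simp add: var_err_def op_inner_def var_iter_eq var.moments_def var.tgt.heat_def Hop_def)

lemma expected_excess_risk:
  fixes P :: "'w measure"
  assumes "is_sample p P Z"
  shows "integrable P (\<lambda>\<omega>. excess_risk p (sgd_output p (\<lambda>t. Z t \<omega>)))"
    and "(\<integral>\<omega>. excess_risk p (sgd_output p (\<lambda>t. Z t \<omega>)) \<partial>P) \<le> bias_err p + var_err p"
proof -
  have P: "prob_space P" and ind: "prob_space.indep_vars P (\<lambda>_. borel) Z {1..n_src p + n_tgt p}"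
    and dist: "\<And>t. t \<in> {1..n_src p + n_tgt p} \<Longrightarrow> distr P borel (Z t) = (if t \<le> n_src p then src p else tgt p)"
    using assms by (auto simp: is_sample_def law_def)
  have cent: "bias.src.centered" "bias.tgt.centered"
    using bias.src.centered_if_minimizer[OF minimizer(1)] bias.tgt.centered_if_minimizer[OF minimizer(2)] by auto
  define b where "b \<omega> = error_path (step p) (wstar p) 0 (w_init - wstar p) (\<lambda>i. Z i \<omega>) (n_src p + n_tgt p)" for \<omega>
  define h where "h \<omega> = error_path (step p) (wstar p) 1 0 (\<lambda>i. Z i \<omega>) (n_src p + n_tgt p)" for \<omega>
  have b: "b \<in> borel_measurable P" "AE \<omega> in P. b \<omega> \<in> hilb p"
    "integrable P (\<lambda>\<omega>. b \<omega> \<bullet> Hop p (b \<omega>))" "(\<integral>\<omega>. b \<omega> \<bullet> Hop p (b \<omega>) \<partial>P) \<le> bias_err p"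
    using bias.path_energy[OF P ind dist cent] unfolding rates_eq b_def[abs_def] bias_err_eq Hop_def by auto
  have h: "h \<in> borel_measurable P" "AE \<omega> in P. h \<omega> \<in> hilb p"
    "integrable P (\<lambda>\<omega>. h \<omega> \<bullet> Hop p (h \<omega>))" "(\<integral>\<omega>. h \<omega> \<bullet> Hop p (h \<omega>) \<partial>P) \<le> var_err p"
    using var.path_energy[OF P ind dist cent] unfolding rates_eq h_def[abs_def] var_err_eq Hop_def by auto
  have out: "sgd_output p (\<lambda>t. Z t \<omega>) = wstar p + (b \<omega> + h \<omega>)" for \<omega>
    using sgd_error_split[of p "\<lambda>t. Z t \<omega>" "n_src p + n_tgt p"]
    by (simp add: sgd_output_def b_def h_def algebra_simps)
  define ex where "ex \<omega> = excess_risk p (sgd_output p (\<lambda>t. Z t \<omega>))" for \<omega>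
  have "(\<lambda>\<omega>. wstar p + (b \<omega> + h \<omega>)) \<in> borel_measurable P" using b(1) h(1) by measurable
  from measurable_compose[OF this bias.tgt.risk_measurable[OF bias.tgt.prob_space_axioms]]
  have exm: "ex \<in> borel_measurable P"
    unfolding ex_def[abs_def] out excess_risk_def by simp
  have bound: "AE \<omega> in P. 0 \<le> ex \<omega> \<and> ex \<omega> \<le> b \<omega> \<bullet> Hop p (b \<omega>) + h \<omega> \<bullet> Hop p (h \<omega>)"
    using b(2) h(2)
  proof eventually_elim
    case (elim \<omega>)
    note psdH = bias.tgt.psd_G[folded Hop_def]
    note lin = bounded_linear.linear[OF psd_linear[OF psdH]]
    have e: "ex \<omega> = 1/2 * ((b \<omega> + h \<omega>) \<bullet> Hop p (b \<omega> + h \<omega>))"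
      unfolding ex_def out excess_risk_def Hop_def
      using elim by (intro bias.tgt.excess_eq cent subspace_add[OF bias.tgt.subS])
    \<comment> \<open>The cross terms are not computed: nonnegativity of the form at
      \<open>b - h\<close> bounds them by the squares, and the factor 2 lost here is the 1/2 in the
      risk.\<close>
    have "0 \<le> (b \<omega> - h \<omega>) \<bullet> Hop p (b \<omega> - h \<omega>)" by (rule psd_nonneg[OF psdH])
    then have "ex \<omega> \<le> b \<omega> \<bullet> Hop p (b \<omega>) + h \<omega> \<bullet> Hop p (h \<omega>)"
      unfolding e by (simp add: linear_add[OF lin] linear_diff[OF lin] inner_add_left inner_add_right
          inner_diff_left inner_diff_right)
    moreover have "0 \<le> ex \<omega>" unfolding e using psd_nonneg[OF psdH] by simp
    ultimately show ?case by simp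
  qed
  have int: "integrable P (\<lambda>\<omega>. b \<omega> \<bullet> Hop p (b \<omega>) + h \<omega> \<bullet> Hop p (h \<omega>))" using b(3) h(3) by simp
  have "integrable P ex"
    using bound by (intro Bochner_Integration.integrable_bound[OF int exm]) auto
  then show "integrable P (\<lambda>\<omega>. excess_risk p (sgd_output p (\<lambda>t. Z t \<omega>)))"
    by (simp add: ex_def[abs_def])
  have "(\<integral>\<omega>. ex \<omega> \<partial>P) \<le> (\<integral>\<omega>. b \<omega> \<bullet> Hop p (b \<omega>) + h \<omega> \<bullet> Hop p (h \<omega>) \<partial>P)"
    using bound by (intro integral_mono_AE \<open>integrable P ex\<close> int) auto
  also have "\<dots> \<le> bias_err p + var_err p" using b h by simp
  finally show "(\<integral>\<omega>. excess_risk p (sgd_output p (\<lambda>t. Z t \<omega>)) \<partial>P) \<le> bias_err p + var_err p"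
    by (simp add: ex_def)
qed

subsection \<open>Effective dimensions\<close>

lemma J_opt: "J_opt p \<subseteq> idx p" and K_opt: "K_opt p \<subseteq> idx p"
  by (auto simp: J_opt_def K_opt_def)

lemma src_prod_eq: "src_prod p = bias.src.shrink (n_src p)"
  unfolding src_prod_def bias.src.shrink_def rates_eq[symmetric]
  by (rule op_prod_cong) (simp add: bias.rates_def Gop_def)

lemma tgt_prod_eq: "tgt_prod p = bias.tgt.shrink (n_tgt p)"
  unfolding tgt_prod_def bias.tgt.shrink_def rates_eq[symmetric]
  by (rule op_prod_cong) (simp add: bias.rates_def Hop_def)

lemma src_weight_has_sum:
  assumes "J \<subseteq> idx p" "v \<in> hilb p"
  shows "((\<lambda>j. (if j \<in> J then 1 / (M_eff p * step_src p) else src_val p j) * (src_vec p j \<bullet> v)\<^sup>2)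
    has_sum sqnorm (src_weight p J) v) (idx p)"
  unfolding src_weight_def by (rule bias.src.head_tail_quad[OF assms(2,1)])

lemma tgt_weight_has_sum:
  assumes "K \<subseteq> idx p" "v \<in> hilb p"
  shows "((\<lambda>j. (if j \<in> K then 1 / (N_eff p * step_tgt p) else tgt_val p j) * (tgt_vec p j \<bullet> v)\<^sup>2)
    has_sum sqnorm (tgt_weight p K) v) (idx p)"
  unfolding tgt_weight_def by (rule bias.tgt.head_tail_quad[OF assms(2,1)])

lemma src_dist_eq: "bias.src_dist = sqnorm (src_weight p (J_opt p)) (w_init - wstar p)"
proof -
  have "((\<lambda>j. min (1 / (M_eff p * step_src p)) (src_val p j) * (src_vec p j \<bullet> (w_init - wstar p))\<^sup>2)
      has_sum sqnorm (src_weight p (J_opt p)) (w_init - wstar p)) (idx p)"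
    using src_weight_has_sum[OF J_opt w_init_mem]
    by (rule has_sum_cong[THEN iffD1, rotated]) (auto simp: J_opt_def min_def mult.commute)
  then show ?thesis unfolding bias.src_dist_def M_eff_def by (rule infsumI)
qed

lemma shrunk_mem: "src_prod p (w_init - wstar p) \<in> hilb p"
  unfolding src_prod_eq by (rule bias.src.shrink_mem[OF w_init_mem])

lemma tgt_dist_eq: "bias.tgt_dist = sqnorm (tgt_weight p (K_opt p)) (src_prod p (w_init - wstar p))"
proof -
  have "((\<lambda>j. min (1 / (N_eff p * step_tgt p)) (tgt_val p j) * (tgt_vec p j \<bullet> src_prod p (w_init - wstar p))\<^sup>2)
      has_sum sqnorm (tgt_weight p (K_opt p)) (src_prod p (w_init - wstar p))) (idx p)"
    using tgt_weight_has_sum[OF K_opt shrunk_mem]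
    by (rule has_sum_cong[THEN iffD1, rotated]) (auto simp: K_opt_def min_def mult.commute)
  then show ?thesis unfolding bias.tgt_dist_def N_eff_def src_prod_eq by (rule infsumI)
qed

lemma src_weight_opt:
  assumes "J \<subseteq> idx p"
  shows "sqnorm (src_weight p (J_opt p)) (w_init - wstar p) \<le> sqnorm (src_weight p J) (w_init - wstar p)"
  by (rule has_sum_mono[OF src_weight_has_sum[OF J_opt w_init_mem] src_weight_has_sum[OF assms w_init_mem]])
     (rule mult_right_mono, auto simp: J_opt_def mult.commute)

lemma tgt_weight_opt:
  assumes "K \<subseteq> idx p" "v \<in> hilb p"
  shows "sqnorm (tgt_weight p (K_opt p)) v \<le> sqnorm (tgt_weight p K) v"
  by (rule has_sum_mono[OF tgt_weight_has_sum[OF K_opt assms(2)] tgt_weight_has_sum[OF assms]])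
     (rule mult_right_mono, auto simp: K_opt_def mult.commute)

text \<open>Counting \<open>K\<close> as a sum of ones turns \<open>D_eff\<close> into a single sum
  over all directions, which can be minimized term by term, also for infinite
  \<open>K\<close>.\<close>

lemma D_eff_sum:
  assumes "K \<subseteq> idx p"
  shows "D_eff p K = (\<Sum>\<^sub>\<infinity>i\<in>idx p. ennreal (if i \<in> K then 1 else (N_eff p)\<^sup>2 * (step_tgt p)\<^sup>2 * (tgt_val p i)\<^sup>2))"
proof -
  define f where "f i = (if i \<in> K then 1 else (N_eff p)\<^sup>2 * (step_tgt p)\<^sup>2 * (tgt_val p i)\<^sup>2)" for i
  have "(\<Sum>\<^sub>\<infinity>i\<in>K \<union> (idx p - K). ennreal (f i)) = (\<Sum>\<^sub>\<infinity>i\<in>K. ennreal (f i)) + (\<Sum>\<^sub>\<infinity>i\<in>idx p - K. ennreal (f i))"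
    by (intro infsum_Un_disjoint nonneg_summable_on_complete zero_le) auto
  also have "(\<Sum>\<^sub>\<infinity>i\<in>K. ennreal (f i)) = (if finite K then of_nat (card K) else \<infinity>)"
  proof (cases "finite K")
    case True
    then show ?thesis by (simp add: f_def)
  next
    case False
    then show ?thesis by (simp add: infsum_superconst_infinite_ennreal[of K 1] f_def)
  qed
  also have "(\<Sum>\<^sub>\<infinity>i\<in>idx p - K. ennreal (f i))
      = (\<Sum>\<^sub>\<infinity>i\<in>idx p - K. ennreal ((N_eff p)\<^sup>2 * (step_tgt p)\<^sup>2) * ennreal ((tgt_val p i)\<^sup>2))"
    by (rule infsum_cong) (simp add: f_def ennreal_mult)
  also have "K \<union> (idx p - K) = idx p" using assms by auto
  finally show ?thesis by (simp add: D_eff_def infsum_ennreal_cmult f_def)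
qed

text \<open>The threshold of \<open>K_opt\<close> is where
  \<open>(N_eff p * step_tgt p * tgt_val p i)\<^sup>2\<close> crosses 1, so membership selects the
  smaller of the two possible terms in every direction.\<close>

lemma D_eff_opt:
  assumes "K \<subseteq> idx p" shows "D_eff p (K_opt p) \<le> D_eff p K"
  and "D_eff p (K_opt p) = ennreal bias.tgt_dim"
proof -
  define a where "a = N_eff p * step_tgt p"
  have a: "0 < a" using bias.tgt.Ne bias.tgt.g0 by (simp add: a_def N_eff_def)
  have opt: "(if i \<in> K_opt p then 1 else (N_eff p)\<^sup>2 * (step_tgt p)\<^sup>2 * (tgt_val p i)\<^sup>2) = bias.tgt_gain i"
    if i: "i \<in> idx p" for i
  proof -
    have "i \<in> K_opt p \<longleftrightarrow> 1 \<le> a * tgt_val p i"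
      using i a by (simp add: K_opt_def a_def field_simps)
    also have "\<dots> \<longleftrightarrow> 1\<^sup>2 \<le> (a * tgt_val p i)\<^sup>2"
      using bias.tgt.s_nonneg[OF i] a by (intro power_mono_iff[symmetric]) auto
    also have "(a * tgt_val p i)\<^sup>2 = (N_eff p)\<^sup>2 * (step_tgt p)\<^sup>2 * (tgt_val p i)\<^sup>2"
      by (simp add: a_def power_mult_distrib)
    finally show ?thesis by (auto simp: bias.tgt_gain_def N_eff_def min_def)
  qed
  have le: "bias.tgt_gain i \<le> (if i \<in> K then 1 else (N_eff p)\<^sup>2 * (step_tgt p)\<^sup>2 * (tgt_val p i)\<^sup>2)" for i
    by (simp add: bias.tgt_gain_def N_eff_def)
  have D: "D_eff p (K_opt p) = (\<Sum>\<^sub>\<infinity>i\<in>idx p. ennreal (bias.tgt_gain i))"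
    unfolding D_eff_sum[OF K_opt] by (rule infsum_cong) (simp only: opt)
  show "D_eff p (K_opt p) \<le> D_eff p K"
    unfolding D D_eff_sum[OF assms] by (intro infsum_mono nonneg_summable_on_complete zero_le ennreal_leI le)
  show "D_eff p (K_opt p) = ennreal bias.tgt_dim"
    unfolding D bias.tgt_dim_def by (rule ennreal_infsum[symmetric]) (rule bias.tgt_gain_sum bias.tgt_gain_nonneg)+
qed

lemma spec_op_basis:
  assumes "j \<in> idx p" "J \<subseteq> idx p"
  shows "spec_op (src_vec p) J a (src_vec p j) = (if j \<in> J then a j *\<^sub>R src_vec p j else 0)"
proof -
  have "spec_op (src_vec p) J a (src_vec p j) = (\<Sum>\<^sub>\<infinity>i\<in>J. if i = j then a j *\<^sub>R src_vec p j else 0)"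
    unfolding spec_op_def using assms
    by (intro infsum_cong) (auto simp: outer_def bias.src.e_inner subset_iff)
  also have "\<dots> = (\<Sum>\<^sub>\<infinity>i\<in>J \<inter> {j}. a j *\<^sub>R src_vec p j)"
    by (rule infsum_cong_neutral) auto
  finally show ?thesis by (cases "j \<in> J") auto
qed

text \<open>Parseval in the eigenbasis of H, where every squared contraction acts as a scalar and
  the product becomes \<open>surv\<close>.\<close>

lemma leak_eq:
  assumes j: "j \<in> idx p"
  shows "src_vec p j \<bullet> op_prod (\<lambda>t. contraction (step p (n_src p + t)) (Hop p) ^^ 2) (n_tgt p) (Hop p (a *\<^sub>R src_vec p j))
    = a * bias.leak j"
proof -
  define Y where "Y k = op_prod (\<lambda>t. contraction (step p (n_src p + t)) (Hop p) ^^ 2) k" for k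
  have rate: "step p (n_src p + t) = bias.tgt.rate t" for t
    unfolding rates_eq[symmetric] by (simp add: bias.rates_def)
  have mem: "Y k v \<in> hilb p" if "v \<in> hilb p" for k v
    using that by (induction k) (simp_all add: Y_def numeral_2_eq_2 Hop_def bias.tgt.contraction_mem)
  have coord: "tgt_vec p i \<bullet> Y k v = bias.tgt.surv (tgt_val p i) 0 k * (tgt_vec p i \<bullet> v)" if "i \<in> idx p" for i k v
    using that
    by (induction k) (simp_all add: Y_def numeral_2_eq_2 Hop_def bias.tgt.e_inner_contraction rate
        bias.tgt.surv_Suc)
  note ej = bias.src.e_mem[OF j]
  define x where "x = Hop p (a *\<^sub>R src_vec p j)"
  have xS: "x \<in> hilb p"
    unfolding x_def Hop_def by (rule bias.tgt.A_mem) (rule subspace_scale[OF bias.tgt.subS ej])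
  have x: "tgt_vec p i \<bullet> x = tgt_val p i * (a * (tgt_vec p i \<bullet> src_vec p j))" if "i \<in> idx p" for i
    using that by (simp add: x_def Hop_def bias.tgt.e_inner_A)
  have "((\<lambda>i. (tgt_vec p i \<bullet> src_vec p j) * (tgt_vec p i \<bullet> Y (n_tgt p) x)) has_sum (src_vec p j \<bullet> Y (n_tgt p) x)) (idx p)"
    by (rule bias.tgt.parseval[OF ej])
  then have "((\<lambda>i. a * (bias.tgt.surv (tgt_val p i) 0 (n_tgt p) * tgt_val p i * (tgt_vec p i \<bullet> src_vec p j)\<^sup>2))
      has_sum (src_vec p j \<bullet> Y (n_tgt p) x)) (idx p)"
    by (rule has_sum_cong[THEN iffD1, rotated]) (simp add: coord x power2_eq_square)
  moreover have "((\<lambda>i. a * (bias.tgt.surv (tgt_val p i) 0 (n_tgt p) * tgt_val p i * (tgt_vec p i \<bullet> src_vec p j)\<^sup>2))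
      has_sum (a * bias.leak j)) (idx p)"
    unfolding bias.leak_def by (intro has_sum_cmult_right has_sum_infsum bias.leak_sum ej)
  ultimately show ?thesis unfolding x_def Y_def by (rule has_sum_unique)
qed

lemma D_eff_ft_sum:
  assumes J: "J \<subseteq> idx p"
  shows "D_eff_ft p J = (\<Sum>\<^sub>\<infinity>j\<in>idx p.
    ennreal ((if j \<in> J then 1 / src_val p j else (M_eff p)\<^sup>2 * (step_src p)\<^sup>2 * src_val p j) * bias.leak j))"
  unfolding D_eff_ft_def op_etrace_def
proof (rule infsum_cong)
  fix j assume j: "j \<in> idx p"
  have "spec_op (src_vec p) J (\<lambda>j. 1 / src_val p j) (src_vec p j)
      + ((M_eff p)\<^sup>2 * (step_src p)\<^sup>2) *\<^sub>R spec_op (src_vec p) (idx p - J) (src_val p) (src_vec p j)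
    = (if j \<in> J then 1 / src_val p j else (M_eff p)\<^sup>2 * (step_src p)\<^sup>2 * src_val p j) *\<^sub>R src_vec p j"
    using J j by (auto simp: spec_op_basis)
  then show "ennreal (src_vec p j \<bullet>
      (op_prod (\<lambda>t. contraction (step p (n_src p + t)) (Hop p) ^^ 2) (n_tgt p) \<circ> Hop p \<circ>
        (\<lambda>x. spec_op (src_vec p) J (\<lambda>j. 1 / src_val p j) x
             + ((M_eff p)\<^sup>2 * (step_src p)\<^sup>2) *\<^sub>R spec_op (src_vec p) (idx p - J) (src_val p) x)) (src_vec p j))
    = ennreal ((if j \<in> J then 1 / src_val p j else (M_eff p)\<^sup>2 * (step_src p)\<^sup>2 * src_val p j) * bias.leak j)"
    by (simp only: comp_def leak_eq[OF j])
qed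

text \<open>\<open>1 / \<mu>\<close> and \<open>(M_eff p * step_src p)\<^sup>2 * \<mu>\<close> cross
  exactly at the threshold of \<open>J_opt\<close>; the weights \<open>leak\<close> are nonnegative,
  so the choice is optimal in each direction.\<close>

lemma D_eff_ft_opt:
  assumes "J \<subseteq> idx p" shows "D_eff_ft p (J_opt p) \<le> D_eff_ft p J"
  and "D_eff_ft p (J_opt p) = ennreal bias.src_dim"
proof -
  define a where "a = M_eff p * step_src p"
  have a: "0 < a" using bias.src.Ne bias.src.g0 by (simp add: a_def M_eff_def)
  have opt: "(if j \<in> J_opt p then 1 / src_val p j else (M_eff p)\<^sup>2 * (step_src p)\<^sup>2 * src_val p j) = bias.src_gain j"
    if j: "j \<in> idx p" for j
  proof -
    note s = bias.src.s_pos[OF j]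
    have "j \<in> J_opt p \<longleftrightarrow> 1 \<le> a * src_val p j"
      using j a by (simp add: J_opt_def a_def field_simps)
    also have "\<dots> \<longleftrightarrow> 1\<^sup>2 \<le> (a * src_val p j)\<^sup>2"
      using s a by (intro power_mono_iff[symmetric]) auto
    also have "\<dots> \<longleftrightarrow> 1 / src_val p j \<le> (M_eff p)\<^sup>2 * (step_src p)\<^sup>2 * src_val p j"
      using s by (simp add: a_def power_mult_distrib power2_eq_square divide_le_eq ac_simps)
    finally show ?thesis by (auto simp: bias.src_gain_def M_eff_def min_def)
  qed
  have D: "D_eff_ft p (J_opt p) = (\<Sum>\<^sub>\<infinity>j\<in>idx p. ennreal (bias.src_gain j * bias.leak j))"
    unfolding D_eff_ft_sum[OF J_opt] by (rule infsum_cong) (simp only: opt)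
  show "D_eff_ft p (J_opt p) \<le> D_eff_ft p J"
    unfolding D D_eff_ft_sum[OF assms]
    by (intro infsum_mono nonneg_summable_on_complete zero_le ennreal_leI mult_right_mono bias.leak_nonneg)
       (auto simp: bias.src_gain_def M_eff_def)
  show "D_eff_ft p (J_opt p) = ennreal bias.src_dim"
    unfolding D bias.src_dim_def
    by (rule ennreal_infsum[symmetric])
       (rule bias.src_dim_sum, intro mult_nonneg_nonneg bias.src_gain_nonneg bias.leak_nonneg)
qed

section \<open>Comparison of the errors with the bounds at the optimal index sets\<close>

lemma var_bound_opt:
  assumes "J \<subseteq> idx p" "K \<subseteq> idx p"
  shows "var_bound p \<sigma> (J_opt p) (K_opt p) \<le> var_bound p \<sigma> J K"
  unfolding var_bound_def
  by (intro mult_left_mono add_mono divide_right_mono_ennreal D_eff_opt D_eff_ft_opt assms) auto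

lemma bias_bound_opt:
  assumes "J \<subseteq> idx p" "K \<subseteq> idx p"
  shows "bias_bound p \<alpha> (J_opt p) (K_opt p) \<le> bias_bound p \<alpha> J K"
  unfolding bias_bound_def using alpha
  by (intro add_mono mult_mono divide_right_mono_ennreal D_eff_opt D_eff_ft_opt assms ennreal_leI
      mult_left_mono src_weight_opt tgt_weight_opt shrunk_mem) auto

text \<open>At the optimal index sets both effective dimensions are finite, so the extended bound is
  the image of a real one and the real estimate transfers.\<close>

lemma var_err_le:
  assumes "15/2 \<le> C"
  shows "ennreal (var_err p) \<le> ennreal C * var_bound p \<sigma> (J_opt p) (K_opt p)"
proof -
  have nn: "0 < M_eff p" "0 < N_eff p" "0 \<le> bias.src_dim" "0 \<le> bias.tgt_dim"
    using bias.src.Ne bias.tgt.Ne bias.src_dim_nonneg bias.tgt_dim_nonneg by (auto simp: M_eff_def N_eff_def)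
  define B where "B = \<sigma>\<^sup>2 * (bias.src_dim / M_eff p + bias.tgt_dim / N_eff p)"
  have B: "0 \<le> B" using nn by (simp add: B_def)
  have "var_err p \<le> 15/2 * B"
    using var.var_error_le by (simp add: var_err_eq B_def M_eff_def N_eff_def algebra_simps)
  also have "\<dots> \<le> C * B" using assms B by (intro mult_right_mono)
  finally have "ennreal (var_err p) \<le> ennreal C * ennreal B"
    using assms B by (simp add: ennreal_mult[symmetric] ennreal_leI)
  also have "ennreal B = var_bound p \<sigma> (J_opt p) (K_opt p)"
    using nn by (simp add: var_bound_def D_eff_opt(2)[OF K_opt] D_eff_ft_opt(2)[OF J_opt] B_def
        divide_ennreal ennreal_plus[symmetric] ennreal_mult[symmetric] del: ennreal_plus)
  finally show ?thesis .
qed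

lemma bias_err_le:
  assumes "1 \<le> C" "bias_const \<le> C" "bias_const * bias_const \<le> C"
  shows "ennreal (bias_err p) \<le> ennreal C * bias_bound p \<alpha> (J_opt p) (K_opt p)"
proof -
  define Q where "Q = sqnorm (Hop p) (tgt_prod p (src_prod p (w_init - wstar p)))"
  have Q: "0 \<le> Q" unfolding Q_def sqnorm_def Hop_def by (rule psd_nonneg[OF bias.tgt.psd_G])
  have td: "0 \<le> bias.tgt_dist"
    unfolding bias.tgt_dist_def using bias.tgt.Ne bias.tgt.g0 bias.tgt.s_nonneg
    by (intro infsum_nonneg mult_nonneg_nonneg) auto
  have nn: "0 < M_eff p" "0 < N_eff p" "0 \<le> bias.src_dim" "0 \<le> bias.tgt_dim" "0 \<le> bias.src_dist" "0 \<le> bias_const"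
    using bias.src.Ne bias.tgt.Ne bias.src_dim_nonneg bias.tgt_dim_nonneg bias.src_dist_nonneg bias_const
    by (auto simp: M_eff_def N_eff_def)
  define X where "X = \<alpha> * bias.src_dist * (bias.src_dim / M_eff p)"
  define Y where "Y = \<alpha> * (bias.tgt_dist + bias.src_dist) * (bias.tgt_dim / N_eff p)"
  have XY: "0 \<le> X" "0 \<le> Y" using nn td alpha by (auto simp: X_def Y_def)
  have "bias_err p \<le> Q + bias_const * X
      + bias_const * \<alpha> * (bias.tgt_dist + bias_const / 4 * bias.src_dist) * (bias.tgt_dim / N_eff p)"
    using bias.bias_error_le
    by (simp add: bias_err_eq Q_def X_def M_eff_def N_eff_def Hop_def src_prod_eq tgt_prod_eq ac_simps)
  also have "\<dots> \<le> C * Q + C * X + C * Y"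
  proof (intro add_mono)
    show "Q \<le> C * Q" using mult_right_mono[OF assms(1) Q] by simp
    show "bias_const * X \<le> C * X" by (intro mult_right_mono assms XY)
    have "bias_const * (bias.tgt_dist + bias_const / 4 * bias.src_dist)
        \<le> C * bias.tgt_dist + C * bias.src_dist"
    proof -
      have "bias_const * bias.tgt_dist \<le> C * bias.tgt_dist" by (intro mult_right_mono assms td)
      \<comment> \<open>The square appears because noise created in pretraining is amplified in both
        phases; it is charged to the distance that the bias bound contains in its last
        bracket.\<close>
      moreover have "bias_const * bias_const * bias.src_dist \<le> C * bias.src_dist"
        by (intro mult_right_mono assms nn)
      moreover have "0 \<le> bias_const * bias_const * bias.src_dist" using nn by simp
      ultimately show ?thesis by (simp add: algebra_simps)
    qed
    then have "(bias_const * (bias.tgt_dist + bias_const / 4 * bias.src_dist)) * (\<alpha> * (bias.tgt_dim / N_eff p))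
        \<le> (C * bias.tgt_dist + C * bias.src_dist) * (\<alpha> * (bias.tgt_dim / N_eff p))"
      using alpha nn by (intro mult_right_mono) auto
    then show "bias_const * \<alpha> * (bias.tgt_dist + bias_const / 4 * bias.src_dist) * (bias.tgt_dim / N_eff p) \<le> C * Y"
      by (simp add: Y_def distrib_left ac_simps)
  qed
  finally have "bias_err p \<le> C * (Q + X + Y)" by (simp add: algebra_simps)
  then have "ennreal (bias_err p) \<le> ennreal C * ennreal (Q + X + Y)"
    using assms Q XY by (simp add: ennreal_mult[symmetric] ennreal_leI del: ennreal_plus)
  also have "ennreal (Q + X + Y) = bias_bound p \<alpha> (J_opt p) (K_opt p)"
    unfolding bias_bound_def D_eff_opt(2)[OF K_opt] D_eff_ft_opt(2)[OF J_opt] src_dist_eq[symmetric]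
      tgt_dist_eq[symmetric] Q_def[symmetric]
    using nn Q XY td alpha
    by (simp add: X_def Y_def divide_ennreal ennreal_mult[symmetric] ennreal_plus[symmetric] del: ennreal_plus)
  finally show ?thesis .
qed

end

theorem theorem1:
  "\<exists>c>0. \<forall>(p :: 'a::{real_inner, banach, second_countable_topology} problem) \<alpha> \<sigma>.
     covariate_shift p \<longrightarrow> 2 \<le> n_src p \<longrightarrow> 2 \<le> n_tgt p \<longrightarrow>
     0 < \<alpha> \<longrightarrow> fourth_moment_upper p \<alpha> \<longrightarrow>
     0 < \<sigma> \<longrightarrow> noise_upper p \<sigma> \<longrightarrow>
     0 < step_src p \<longrightarrow> step_src p < min (1 / (4 * \<alpha> * tr_G p)) (1 / (4 * \<alpha> * tr_H p)) \<longrightarrow>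
     0 < step_tgt p \<longrightarrow> step_tgt p < min (1 / (4 * \<alpha> * tr_G p)) (1 / (4 * \<alpha> * tr_H p)) \<longrightarrow>
       (\<forall>(P :: 'w measure) Z. is_sample p P Z \<longrightarrow>
          integrable P (\<lambda>\<omega>. excess_risk p (sgd_output p (\<lambda>t. Z t \<omega>))) \<and>
          (\<integral>\<omega>. excess_risk p (sgd_output p (\<lambda>t. Z t \<omega>)) \<partial>P) \<le> bias_err p + var_err p) \<and>
       (\<forall>J K. J \<subseteq> idx p \<longrightarrow> K \<subseteq> idx p \<longrightarrow>
          ennreal (var_err p) \<le> ennreal c * var_bound p \<sigma> J K \<and>
          ennreal (bias_err p) \<le> ennreal c * bias_bound p \<alpha> J K) \<and>
       (\<forall>J K. J \<subseteq> idx p \<longrightarrow> K \<subseteq> idx p \<longrightarrow>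
          var_bound p \<sigma> (J_opt p) (K_opt p) \<le> var_bound p \<sigma> J K \<and>
          bias_bound p \<alpha> (J_opt p) (K_opt p) \<le> bias_bound p \<alpha> J K)"
proof -
  \<comment> \<open>Chosen before the problem: 15/2 serves the variance, the other summands serve
    one and two passes through a coupled recursion.\<close>
  define c where "c = 15/2 + bias_const + bias_const * bias_const"
  have c: "0 < c" "15/2 \<le> c" "1 \<le> c" "bias_const \<le> c" "bias_const * bias_const \<le> c"
    using bias_const mult_nonneg_nonneg[OF bias_const(2) bias_const(2)] unfolding c_def by linarith+
  show ?thesis
  proof (intro exI[of _ c] conjI allI impI, goal_cases)
    case 1
    show ?case by (rule c)
  next
    case (2 p \<alpha> \<sigma> P Z)
    then interpret shift_problem p \<alpha> \<sigma> by unfold_locales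
    show ?case using 2 by (intro expected_excess_risk)
  next
    case (3 p \<alpha> \<sigma> P Z)
    then interpret shift_problem p \<alpha> \<sigma> by unfold_locales
    show ?case using 3 by (intro expected_excess_risk)
  next
    case (4 p \<alpha> \<sigma> J K)
    then interpret shift_problem p \<alpha> \<sigma> by unfold_locales
    show ?case
      using 4 var_err_le[OF c(2)] by (blast intro: order_trans mult_left_mono[OF var_bound_opt zero_le])
  next
    case (5 p \<alpha> \<sigma> J K)
    then interpret shift_problem p \<alpha> \<sigma> by unfold_locales
    show ?case
      using 5 bias_err_le[OF c(3-5)] by (blast intro: order_trans mult_left_mono[OF bias_bound_opt zero_le])
  next
    case (6 p \<alpha> \<sigma> J K)
    then interpret shift_problem p \<alpha> \<sigma> by unfold_locales
    show ?case using 6 by (intro var_bound_opt)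
  next
    case (7 p \<alpha> \<sigma> J K)
    then interpret shift_problem p \<alpha> \<sigma> by unfold_locales
    show ?case using 7 by (intro bias_bound_opt)
  qed
qed

end
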